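(* Let $(M,L)$ be a Finsler manifold with Finsler metric $g$, let $D^\diamond$ be its Chern (Rund) connection with h-curvature $R^\diamond$ and hv-curvature $P^\diamond$, and let $T$, $\widehat P$, $\widehat R$ be the (h)hv-torsion, (v)hv-torsion and (v)h-torsion of the Cartan connection. Let $\mathfrak R$ be the curvature of the Barthel connection. Then for all $\pi$-vector fields $X,Y,Z,W$: (a) $R^\diamond(X,Y,Z,W)=-R^\diamond(Y,X,Z,W)$; (b) $\widehat{R^\diamond}(X,Y)=\widehat R(X,Y)=-K\,\mathfrak R(\beta X,\beta Y)$; (c) $R^\diamond(X,Y,Z,W)=-R^\diamond(X,Y,W,Z)-2T(\widehat R(X,Y),Z,W)$; (d) $\mathfrak S_{X,Y,Z}\{R^\diamond(X,Y)Z\}=0$; (e) $\mathfrak S_{X,Y,Z}\{(D^\diamond_{\beta X}R^\diamond)(Y,Z,W)+P^\diamond(X,\widehat R(Y,Z))W\}=0$; (f) $(D^\diamond_{\gamma X}R^\diamond)(Y,Z,W)+(D^\diamond_{\beta Y}P^\diamond)(Z,X,W)-(D^\diamond_{\beta Z}P^\diamond)(Y,X,W)-P^\diamond(Z,\widehat P(Y,X))W+P^\diamond(Y,\widehat P(Z,X))W=0$; (g) $(D^\diamond_{\gamma\eta}R^\diamond)(X,Y,Z)=0$.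
   Context: $M$ is a real paracompact $C^\infty$ manifold of finite dimension, $\mathcal TM\subset TM$ is the set of nonzero tangent vectors, $\pi:\mathcal TM\to M$ the projection, $\pi^{-1}(TM)\to\mathcal TM$ the pullback of $TM$ by $\pi$; everything is $C^\infty$. Sections of $\pi^{-1}(TM)$ are called $\pi$-vector fields. $\eta$ is the $\pi$-vector field $\eta(u)=(u,u)$. $\rho:T(\mathcal TM)\to\pi^{-1}(TM)$ is $\rho(A)=(u,d\pi(A))$ for $A\in T_u(\mathcal TM)$, and $\gamma:\pi^{-1}(TM)\to T(\mathcal TM)$ is the vertical lift $\gamma(u,v)=\frac{d}{dt}|_{t=0}(u+tv)$; $V=\ker\rho=\operatorname{im}\gamma$; $J=\gamma\circ\rho$. $(M,L)$ is a Finsler manifold: $L:TM\to[0,\infty)$ is smooth and positive on $\mathcal TM$, positively homogeneous of degree 1 on fibres, and the fibrewise Hessian of $E=\frac12L^2$ is positive definite on $\mathcal TM$; this Hessian (in coordinates $g_{ij}=\frac12\partial^2L^2/\partial y^i\partial y^j$) is the Finsler metric $g$ on $\pi^{-1}(TM)$. For a linear connection $D$ on $\pi^{-1}(TM)$, put $K(A)=D_A\eta$ and $H=\ker K$. $D$ is regular if $T(\mathcal TM)=V\oplus H$; then $\beta:=(\rho|_H)^{-1}:\pi^{-1}(TM)\to H$. Torsion: $\mathbf T(A,B)=D_A\rho B-D_B\rho A-\rho[A,B]$; curvature (note the sign): $\mathbf K(A,B)\rho C=-D_AD_B\rho C+D_BD_A\rho C+D_{[A,B]}\rho C$. $Q(X,Y)=\mathbf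 T(\beta X,\beta Y)$, $T(X,Y)=\mathbf T(\gamma X,\beta Y)$; h-, hv-, v-curvatures $R(X,Y)Z=\mathbf K(\beta X,\beta Y)Z$, $P(X,Y)Z=\mathbf K(\beta X,\gamma Y)Z$, $S(X,Y)Z=\mathbf K(\gamma X,\gamma Y)Z$; a hat denotes contraction with $\eta$: $\widehat R(X,Y)=R(X,Y)\eta$, $\widehat P(X,Y)=P(X,Y)\eta$. The Cartan connection $\nabla$ is the unique regular connection on $\pi^{-1}(TM)$ with $\nabla g=0$, $Q=0$, and $g(T(X,Y),Z)=g(T(X,Z),Y)$; unadorned $T,\widehat P,\widehat R,K,\beta$ refer to $\nabla$. The Chern connection $D^\diamond$ is the unique regular connection on $\pi^{-1}(TM)$ such that $(D^\diamond_Ag)(Y,Z)=2g(T(K^\diamond A,Y),Z)$ and $\mathbf T^\diamond=0$; objects with $^\diamond$ are those of $D^\diamond$. Known facts: $\beta^\diamond=\beta$, $K^\diamond=K$, and $D^\diamond_AY=\nabla_AY-T(KA,Y)$. Barthel connection: $\Gamma=[J,G]$, i.e. $\Gamma(A)=[JA,G]-J[A,G]$, where $G$ is the canonical spray defined by $i_G\,dd_JE=-dE$ ($d_JE=dE\circ J$). With $h=\frac12(I+\Gamma)$, $v=\frac12(I-\Gamma)$ its curvature is $\mathfrak R(A,B)=-v[hA,hB]$. Known: $\Gamma=2\beta\circ\rho-I$. Notation: $R^\diamond(X,Y,Z,W):=g(R^\diamond(X,Y)Z,W)$, $T(X,Y,Z):=g(T(X,Y),Z)$. For $B\in\{R^\diamond,P^\diamond\}$,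 $(D^\diamond_AB)(X,Y,Z)$ is the vector-valued covariant derivative of $(X,Y,Z)\mapsto B(X,Y)Z$. $\mathfrak S_{X,Y,Z}$ is the cyclic sum. *)

theory Defs
  imports "HOL-Analysis.Analysis" "HOL-Library.Function_Algebras"
begin

section \<open>Smooth manifolds\<close>

text \<open>
  Continuous differentiability of all orders; only meaningful (and only used) for open \<open>S\<close>.
\<close>

primrec Ck_on :: "nat \<Rightarrow> 'a set \<Rightarrow> ('a::real_normed_vector \<Rightarrow> 'b::real_normed_vector) \<Rightarrow> bool" where
  "Ck_on 0 S f \<longleftrightarrow> continuous_on S f"
| "Ck_on (Suc k) S f \<longleftrightarrow>
     (\<forall>x\<in>S. f differentiable (at x)) \<and> (\<forall>v. Ck_on k S (\<lambda>x. frechet_derivative f (at x) v))"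

definition smooth_on :: "'a set \<Rightarrow> ('a::real_normed_vector \<Rightarrow> 'b::real_normed_vector) \<Rightarrow> bool" where
  "smooth_on S f \<longleftrightarrow> (\<forall>k. Ck_on k S f)"

text \<open>
  An atlas is a family of charts, indexed by \<open>chart_ids\<close>; the values of \<open>chart_map i\<close> outside
  \<open>chart_dom i\<close> are irrelevant. Indexing the charts lets the induced atlas of a tangent bundle use
  the same index set.
\<close>

record ('a, 'i, 'e) atlas =
  chart_ids :: "'i set"
  chart_dom :: "'i \<Rightarrow> 'a set"
  chart_map :: "'i \<Rightarrow> 'a \<Rightarrow> 'e"

definition points :: "('a, 'i, 'e) atlas \<Rightarrow> 'a set" where
  "points N = (\<Union>i\<in>chart_ids N. chart_dom N i)"

definition charts_at :: "('a, 'i, 'e) atlas \<Rightarrow> 'a \<Rightarrow> 'i set" where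
  "charts_at N p = {i \<in> chart_ids N. p \<in> chart_dom N i}"

definition chart_image :: "('a, 'i, 'e) atlas \<Rightarrow> 'i \<Rightarrow> 'e set" where
  "chart_image N i = chart_map N i ` chart_dom N i"

definition chart_inv :: "('a, 'i, 'e) atlas \<Rightarrow> 'i \<Rightarrow> 'e \<Rightarrow> 'a" where
  "chart_inv N i = inv_into (chart_dom N i) (chart_map N i)"

definition manifold_topology :: "('a, 'i, 'e::topological_space) atlas \<Rightarrow> 'a topology" where
  "manifold_topology N = topology_generated_by
     {{p \<in> chart_dom N i. chart_map N i p \<in> U} | i U. i \<in> chart_ids N \<and> open U}"

definition paracompact_space :: "'a topology \<Rightarrow> bool" where
  "paracompact_space X \<longleftrightarrow>
     (\<forall>\<U>. (\<forall>U\<in>\<U>. openin X U) \<and> \<Union>\<U> = topspace X \<longrightarrow>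
        (\<exists>\<V>. (\<forall>V\<in>\<V>. openin X V) \<and> \<Union>\<V> = topspace X \<and>
             (\<forall>V\<in>\<V>. \<exists>U\<in>\<U>. V \<subseteq> U) \<and> locally_finite_in X \<V>))"

definition smooth_manifold :: "('a, 'i, 'e::euclidean_space) atlas \<Rightarrow> bool" where
  "smooth_manifold N \<longleftrightarrow>
     (\<forall>i\<in>chart_ids N. inj_on (chart_map N i) (chart_dom N i) \<and> open (chart_image N i)) \<and>
     (\<forall>i\<in>chart_ids N. \<forall>j\<in>chart_ids N.
        open (chart_map N i ` (chart_dom N i \<inter> chart_dom N j)) \<and>
        smooth_on (chart_map N i ` (chart_dom N i \<inter> chart_dom N j))
          (chart_map N j \<circ> chart_inv N i)) \<and>
     Hausdorff_space (manifold_topology N) \<and> paracompact_space (manifold_topology N)"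

text \<open>
  A tangent vector at \<open>p\<close> is its family of components in the charts around \<open>p\<close>, related by the
  derivatives of the transition maps. It is set to 0 at the indices of all other charts, so that
  vectors are equal iff their components are. Vectors at a point are added and scaled
  componentwise (addition is that of \<^theory>\<open>HOL-Library.Function_Algebras\<close>).
\<close>

definition tangent_space :: "('a, 'i, 'e::euclidean_space) atlas \<Rightarrow> 'a \<Rightarrow> ('i \<Rightarrow> 'e) set" where
  "tangent_space N p =
     {a. (\<forall>i. i \<notin> charts_at N p \<longrightarrow> a i = 0) \<and>
         (\<forall>i\<in>charts_at N p. \<forall>j\<in>charts_at N p.
            a j = frechet_derivative (chart_map N j \<circ> chart_inv N i) (at (chart_map N i p)) (a i))}"

definition vscale :: "real \<Rightarrow> ('i \<Rightarrow> 'e::real_vector) \<Rightarrow> 'i \<Rightarrow> 'e" (infixr "\<odot>" 75) where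
  "r \<odot> a = (\<lambda>i. r *\<^sub>R a i)"

definition smooth_function :: "('a, 'i, 'e::euclidean_space) atlas \<Rightarrow> ('a \<Rightarrow> real) \<Rightarrow> bool" where
  "smooth_function N f \<longleftrightarrow> (\<forall>i\<in>chart_ids N. smooth_on (chart_image N i) (f \<circ> chart_inv N i))"

definition vector_field :: "('a, 'i, 'e::euclidean_space) atlas \<Rightarrow> ('a \<Rightarrow> 'i \<Rightarrow> 'e) \<Rightarrow> bool" where
  "vector_field N A \<longleftrightarrow>
     (\<forall>p\<in>points N. A p \<in> tangent_space N p) \<and>
     (\<forall>i\<in>chart_ids N. smooth_on (chart_image N i) (\<lambda>x. A (chart_inv N i x) i))"

definition some_chart :: "('a, 'i, 'e) atlas \<Rightarrow> 'a \<Rightarrow> 'i" where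
  "some_chart N p = (SOME i. i \<in> charts_at N p)"

text \<open>The differential of a real function; \<open>dfun N f p a\<close> is also the derivative \<open>a \<cdot> f\<close>.\<close>

definition dfun :: "('a, 'i, 'e::euclidean_space) atlas \<Rightarrow> ('a \<Rightarrow> real) \<Rightarrow> 'a \<Rightarrow> ('i \<Rightarrow> 'e) \<Rightarrow> real" where
  "dfun N f p a =
     (let i = some_chart N p in frechet_derivative (f \<circ> chart_inv N i) (at (chart_map N i p)) (a i))"

text \<open>The differential of a map between manifolds.\<close>

definition dmap :: "('a, 'i, 'e::euclidean_space) atlas \<Rightarrow> ('b, 'j, 'f::euclidean_space) atlas \<Rightarrow>
    ('a \<Rightarrow> 'b) \<Rightarrow> 'a \<Rightarrow> ('i \<Rightarrow> 'e) \<Rightarrow> 'j \<Rightarrow> 'f" where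
  "dmap N N' F p a =
     (let i = some_chart N p in
      (\<lambda>j. if j \<in> charts_at N' (F p)
           then frechet_derivative (chart_map N' j \<circ> F \<circ> chart_inv N i) (at (chart_map N i p)) (a i)
           else 0))"

definition velocity_at_0 :: "('a, 'i, 'e::euclidean_space) atlas \<Rightarrow> (real \<Rightarrow> 'a) \<Rightarrow> 'i \<Rightarrow> 'e" where
  "velocity_at_0 N c =
     (\<lambda>i. if i \<in> charts_at N (c 0) then vector_derivative (chart_map N i \<circ> c) (at 0) else 0)"

definition bracket :: "('a, 'i, 'e::euclidean_space) atlas \<Rightarrow>
    ('a \<Rightarrow> 'i \<Rightarrow> 'e) \<Rightarrow> ('a \<Rightarrow> 'i \<Rightarrow> 'e) \<Rightarrow> 'a \<Rightarrow> 'i \<Rightarrow> 'e" where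
  "bracket N A B p =
     (\<lambda>i. if i \<in> charts_at N p
          then frechet_derivative (\<lambda>x. B (chart_inv N i x) i) (at (chart_map N i p)) (A p i)
             - frechet_derivative (\<lambda>x. A (chart_inv N i x) i) (at (chart_map N i p)) (B p i)
          else 0)"

text \<open>
  Exterior derivative of a 1-form \<open>\<omega>\<close>, given by its action on vector fields. The normalisation
  (no factor 1/2) is the one for which the canonical spray below satisfies \<open>J G = \<gamma> \<eta>\<close>.
\<close>

definition ext_deriv :: "('a, 'i, 'e::euclidean_space) atlas \<Rightarrow> (('a \<Rightarrow> 'i \<Rightarrow> 'e) \<Rightarrow> 'a \<Rightarrow> real) \<Rightarrow>
    ('a \<Rightarrow> 'i \<Rightarrow> 'e) \<Rightarrow> ('a \<Rightarrow> 'i \<Rightarrow> 'e) \<Rightarrow> 'a \<Rightarrow> real" where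
  "ext_deriv N \<omega> A B p = dfun N (\<omega> B) p (A p) - dfun N (\<omega> A) p (B p) - \<omega> (bracket N A B) p"


section \<open>The slit tangent bundle and the pullback bundle\<close>

type_synonym ('a, 'i, 'e) tvec = "'a \<times> ('i \<Rightarrow> 'e)"

definition tangent_bundle :: "('a, 'i, 'e::euclidean_space) atlas \<Rightarrow> ('a, 'i, 'e) tvec set" where
  "tangent_bundle M = Sigma (points M) (tangent_space M)"

text \<open>The manifold of nonzero tangent vectors.\<close>

definition slit :: "('a, 'i, 'e::euclidean_space) atlas \<Rightarrow> (('a, 'i, 'e) tvec, 'i, 'e \<times> 'e) atlas" where
  "slit M =
     \<lparr>chart_ids = chart_ids M,
      chart_dom = (\<lambda>i. {(p, y). p \<in> chart_dom M i \<and> y \<in> tangent_space M p \<and> y \<noteq> 0}),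
      chart_map = (\<lambda>i (p, y). (chart_map M i p, y i))\<rparr>"

text \<open>
  The fibre of the pullback bundle over \<open>u\<close> is \<open>{u} \<times> tangent_space M (fst u)\<close>. A section
  \<open>u \<mapsto> (u, X u)\<close> is represented by the function \<open>X\<close>, and bundle maps such as \<open>\<rho>\<close> and \<open>\<gamma>\<close> take the
  base point \<open>u\<close> as a separate first argument. Vector fields and sections are functions on
  the whole type, with only their values on \<open>points (slit M)\<close> being relevant.
\<close>

type_synonym ('a, 'i, 'e) pifield = "('a, 'i, 'e) tvec \<Rightarrow> 'i \<Rightarrow> 'e"
type_synonym ('a, 'i, 'e) vfield = "('a, 'i, 'e) tvec \<Rightarrow> 'i \<Rightarrow> 'e \<times> 'e"

definition pi_vector_field :: "('a, 'i, 'e::euclidean_space) atlas \<Rightarrow> ('a, 'i, 'e) pifield \<Rightarrow> bool" where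
  "pi_vector_field M X \<longleftrightarrow>
     (\<forall>u\<in>points (slit M). X u \<in> tangent_space M (fst u)) \<and>
     (\<forall>i\<in>chart_ids M. smooth_on (chart_image (slit M) i) (\<lambda>z. X (chart_inv (slit M) i z) i))"

definition bundle_map_app :: "('u \<Rightarrow> 'v \<Rightarrow> 'w) \<Rightarrow> ('u \<Rightarrow> 'v) \<Rightarrow> 'u \<Rightarrow> 'w" (infixr "\<star>" 90) where
  "F \<star> X = (\<lambda>u. F u (X u))"

definition eta :: "('a, 'i, 'e) pifield" where
  "eta u = snd u"

definition rho :: "('a, 'i, 'e::euclidean_space) atlas \<Rightarrow>
    ('a, 'i, 'e) tvec \<Rightarrow> ('i \<Rightarrow> 'e \<times> 'e) \<Rightarrow> 'i \<Rightarrow> 'e" where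
  "rho M u a = dmap (slit M) M fst u a"

definition gam :: "('a, 'i, 'e::euclidean_space) atlas \<Rightarrow>
    ('a, 'i, 'e) tvec \<Rightarrow> ('i \<Rightarrow> 'e) \<Rightarrow> 'i \<Rightarrow> 'e \<times> 'e" where
  "gam M u v = velocity_at_0 (slit M) (\<lambda>t. (fst u, snd u + t \<odot> v))"

definition Jmap :: "('a, 'i, 'e::euclidean_space) atlas \<Rightarrow>
    ('a, 'i, 'e) tvec \<Rightarrow> ('i \<Rightarrow> 'e \<times> 'e) \<Rightarrow> 'i \<Rightarrow> 'e \<times> 'e" where
  "Jmap M u a = gam M u (rho M u a)"


section \<open>Finsler manifolds\<close>

definition energy :: "(('a, 'i, 'e) tvec \<Rightarrow> real) \<Rightarrow> ('a, 'i, 'e) tvec \<Rightarrow> real" where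
  "energy L u = (L u)\<^sup>2 / 2"

text \<open>The Hessian, at \<open>snd u\<close>, of the energy restricted to the tangent space at \<open>fst u\<close>.\<close>

definition finsler_metric :: "(('a, 'i, 'e::euclidean_space) tvec \<Rightarrow> real) \<Rightarrow>
    ('a, 'i, 'e) tvec \<Rightarrow> ('i \<Rightarrow> 'e) \<Rightarrow> ('i \<Rightarrow> 'e) \<Rightarrow> real" where
  "finsler_metric L u v w =
     deriv (\<lambda>s. deriv (\<lambda>t. energy L (fst u, snd u + s \<odot> v + t \<odot> w)) 0) 0"

definition finsler_manifold :: "('a, 'i, 'e::euclidean_space) atlas \<Rightarrow>
    (('a, 'i, 'e) tvec \<Rightarrow> real) \<Rightarrow> bool" where
  "finsler_manifold M L \<longleftrightarrow>
     smooth_manifold M \<and>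
     (\<forall>u\<in>tangent_bundle M. 0 \<le> L u) \<and>
     (\<forall>u\<in>points (slit M). 0 < L u) \<and>
     smooth_function (slit M) L \<and>
     (\<forall>(p, y)\<in>tangent_bundle M. \<forall>r>0. L (p, r \<odot> y) = r * L (p, y)) \<and>
     (\<forall>u\<in>points (slit M). \<forall>v\<in>tangent_space M (fst u). v \<noteq> 0 \<longrightarrow> 0 < finsler_metric L u v v)"


section \<open>Regular connections on the pullback bundle\<close>

text \<open>
  A connection is a map \<open>D u a Y\<close>, the covariant derivative of the section \<open>Y\<close> at \<open>u\<close> in the
  direction of the vector \<open>a\<close> tangent to \<open>slit M\<close> at \<open>u\<close>.
\<close>

type_synonym ('a, 'i, 'e) connection =
  "('a, 'i, 'e) tvec \<Rightarrow> ('i \<Rightarrow> 'e \<times> 'e) \<Rightarrow> ('a, 'i, 'e) pifield \<Rightarrow> 'i \<Rightarrow> 'e"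

definition cov :: "('a, 'i, 'e) connection \<Rightarrow>
    ('a, 'i, 'e) vfield \<Rightarrow> ('a, 'i, 'e) pifield \<Rightarrow> ('a, 'i, 'e) pifield" where
  "cov D A Y = (\<lambda>u. D u (A u) Y)"

definition linear_connection :: "('a, 'i, 'e::euclidean_space) atlas \<Rightarrow>
    ('a, 'i, 'e) connection \<Rightarrow> bool" where
  "linear_connection M D \<longleftrightarrow>
     (\<forall>A Y. vector_field (slit M) A \<and> pi_vector_field M Y \<longrightarrow> pi_vector_field M (cov D A Y)) \<and>
     (\<forall>u\<in>points (slit M). \<forall>a\<in>tangent_space (slit M) u. \<forall>Y. pi_vector_field M Y \<longrightarrow>
        D u a Y \<in> tangent_space M (fst u) \<and>
        (\<forall>b\<in>tangent_space (slit M) u. D u (a + b) Y = D u a Y + D u b Y) \<and>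
        (\<forall>r. D u (r \<odot> a) Y = r \<odot> D u a Y) \<and>
        (\<forall>Z. pi_vector_field M Z \<longrightarrow> D u a (Y + Z) = D u a Y + D u a Z) \<and>
        (\<forall>f. smooth_function (slit M) f \<longrightarrow>
           D u a (\<lambda>w. f w \<odot> Y w) = dfun (slit M) f u a \<odot> Y u + f u \<odot> D u a Y))"

definition Kmap :: "('a, 'i, 'e) connection \<Rightarrow>
    ('a, 'i, 'e) tvec \<Rightarrow> ('i \<Rightarrow> 'e \<times> 'e) \<Rightarrow> 'i \<Rightarrow> 'e" where
  "Kmap D u a = D u a eta"

definition horizontal :: "('a, 'i, 'e::euclidean_space) atlas \<Rightarrow> ('a, 'i, 'e) connection \<Rightarrow>
    ('a, 'i, 'e) tvec \<Rightarrow> ('i \<Rightarrow> 'e \<times> 'e) set" where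
  "horizontal M D u = {a \<in> tangent_space (slit M) u. Kmap D u a = 0}"

definition vertical :: "('a, 'i, 'e::euclidean_space) atlas \<Rightarrow>
    ('a, 'i, 'e) tvec \<Rightarrow> ('i \<Rightarrow> 'e \<times> 'e) set" where
  "vertical M u = {a \<in> tangent_space (slit M) u. rho M u a = 0}"

definition regular_connection :: "('a, 'i, 'e::euclidean_space) atlas \<Rightarrow>
    ('a, 'i, 'e) connection \<Rightarrow> bool" where
  "regular_connection M D \<longleftrightarrow>
     linear_connection M D \<and>
     (\<forall>u\<in>points (slit M).
        {a + b | a b. a \<in> vertical M u \<and> b \<in> horizontal M D u} = tangent_space (slit M) u \<and>
        vertical M u \<inter> horizontal M D u = {0})"

definition beta :: "('a, 'i, 'e::euclidean_space) atlas \<Rightarrow> ('a, 'i, 'e) connection \<Rightarrow>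
    ('a, 'i, 'e) tvec \<Rightarrow> ('i \<Rightarrow> 'e) \<Rightarrow> 'i \<Rightarrow> 'e \<times> 'e" where
  "beta M D u = inv_into (horizontal M D u) (rho M u)"

definition torsion :: "('a, 'i, 'e::euclidean_space) atlas \<Rightarrow> ('a, 'i, 'e) connection \<Rightarrow>
    ('a, 'i, 'e) vfield \<Rightarrow> ('a, 'i, 'e) vfield \<Rightarrow> ('a, 'i, 'e) pifield" where
  "torsion M D A B =
     cov D A (rho M \<star> B) - cov D B (rho M \<star> A) - rho M \<star> bracket (slit M) A B"

text \<open>
  The opposite of the more common sign. Its last argument is an arbitrary section, every
  section being of the form \<open>rho M \<star> C\<close>.
\<close>

definition curvature :: "('a, 'i, 'e::euclidean_space) atlas \<Rightarrow> ('a, 'i, 'e) connection \<Rightarrow>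
    ('a, 'i, 'e) vfield \<Rightarrow> ('a, 'i, 'e) vfield \<Rightarrow> ('a, 'i, 'e) pifield \<Rightarrow> ('a, 'i, 'e) pifield" where
  "curvature M D A B Z =
     - cov D A (cov D B Z) + cov D B (cov D A Z) + cov D (bracket (slit M) A B) Z"

definition h_torsion :: "('a, 'i, 'e::euclidean_space) atlas \<Rightarrow> ('a, 'i, 'e) connection \<Rightarrow>
    ('a, 'i, 'e) pifield \<Rightarrow> ('a, 'i, 'e) pifield \<Rightarrow> ('a, 'i, 'e) pifield" where
  "h_torsion M D X Y = torsion M D (beta M D \<star> X) (beta M D \<star> Y)"

definition hv_torsion :: "('a, 'i, 'e::euclidean_space) atlas \<Rightarrow> ('a, 'i, 'e) connection \<Rightarrow>
    ('a, 'i, 'e) pifield \<Rightarrow> ('a, 'i, 'e) pifield \<Rightarrow> ('a, 'i, 'e) pifield" where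
  "hv_torsion M D X Y = torsion M D (gam M \<star> X) (beta M D \<star> Y)"

definition h_curvature :: "('a, 'i, 'e::euclidean_space) atlas \<Rightarrow> ('a, 'i, 'e) connection \<Rightarrow>
    ('a, 'i, 'e) pifield \<Rightarrow> ('a, 'i, 'e) pifield \<Rightarrow> ('a, 'i, 'e) pifield \<Rightarrow> ('a, 'i, 'e) pifield" where
  "h_curvature M D X Y Z = curvature M D (beta M D \<star> X) (beta M D \<star> Y) Z"

definition hv_curvature :: "('a, 'i, 'e::euclidean_space) atlas \<Rightarrow> ('a, 'i, 'e) connection \<Rightarrow>
    ('a, 'i, 'e) pifield \<Rightarrow> ('a, 'i, 'e) pifield \<Rightarrow> ('a, 'i, 'e) pifield \<Rightarrow> ('a, 'i, 'e) pifield" where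
  "hv_curvature M D X Y Z = curvature M D (beta M D \<star> X) (gam M \<star> Y) Z"

definition contract_eta ::
    "(('a, 'i, 'e) pifield \<Rightarrow> ('a, 'i, 'e) pifield \<Rightarrow> ('a, 'i, 'e) pifield \<Rightarrow> ('a, 'i, 'e) pifield) \<Rightarrow>
     ('a, 'i, 'e) pifield \<Rightarrow> ('a, 'i, 'e) pifield \<Rightarrow> ('a, 'i, 'e) pifield" where
  "contract_eta B X Y = B X Y eta"

definition cov_metric :: "('a, 'i, 'e::euclidean_space) atlas \<Rightarrow> (('a, 'i, 'e) tvec \<Rightarrow> real) \<Rightarrow>
    ('a, 'i, 'e) connection \<Rightarrow> ('a, 'i, 'e) vfield \<Rightarrow>
    ('a, 'i, 'e) pifield \<Rightarrow> ('a, 'i, 'e) pifield \<Rightarrow> ('a, 'i, 'e) tvec \<Rightarrow> real" where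
  "cov_metric M L D A Y Z u =
     dfun (slit M) (\<lambda>w. finsler_metric L w (Y w) (Z w)) u (A u)
     - finsler_metric L u (cov D A Y u) (Z u) - finsler_metric L u (Y u) (cov D A Z u)"

definition cov_tensor :: "('a, 'i, 'e::euclidean_space) connection \<Rightarrow> ('a, 'i, 'e) vfield \<Rightarrow>
     (('a, 'i, 'e) pifield \<Rightarrow> ('a, 'i, 'e) pifield \<Rightarrow> ('a, 'i, 'e) pifield \<Rightarrow> ('a, 'i, 'e) pifield) \<Rightarrow>
     ('a, 'i, 'e) pifield \<Rightarrow> ('a, 'i, 'e) pifield \<Rightarrow> ('a, 'i, 'e) pifield \<Rightarrow> ('a, 'i, 'e) pifield" where
  "cov_tensor D A B X Y Z =
     cov D A (B X Y Z) - B (cov D A X) Y Z - B X (cov D A Y) Z - B X Y (cov D A Z)"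

definition cyclic_sum :: "('x \<Rightarrow> 'x \<Rightarrow> 'x \<Rightarrow> 'y::plus) \<Rightarrow> 'x \<Rightarrow> 'x \<Rightarrow> 'x \<Rightarrow> 'y" where
  "cyclic_sum F X Y Z = F X Y Z + F Y Z X + F Z X Y"


section \<open>The Cartan, Chern and Barthel connections\<close>

definition cartan_connection :: "('a, 'i, 'e::euclidean_space) atlas \<Rightarrow>
    (('a, 'i, 'e) tvec \<Rightarrow> real) \<Rightarrow> ('a, 'i, 'e) connection \<Rightarrow> bool" where
  "cartan_connection M L D \<longleftrightarrow>
     regular_connection M D \<and>
     (\<forall>A Y Z. vector_field (slit M) A \<and> pi_vector_field M Y \<and> pi_vector_field M Z \<longrightarrow>
        (\<forall>u\<in>points (slit M). cov_metric M L D A Y Z u = 0)) \<and>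
     (\<forall>X Y. pi_vector_field M X \<and> pi_vector_field M Y \<longrightarrow>
        (\<forall>u\<in>points (slit M). h_torsion M D X Y u = 0)) \<and>
     (\<forall>X Y Z. pi_vector_field M X \<and> pi_vector_field M Y \<and> pi_vector_field M Z \<longrightarrow>
        (\<forall>u\<in>points (slit M).
           finsler_metric L u (hv_torsion M D X Y u) (Z u)
           = finsler_metric L u (hv_torsion M D X Z u) (Y u)))"

text \<open>In the following, \<open>C\<close> is the Cartan connection, whose (h)hv-torsion enters the definition.\<close>

definition chern_connection :: "('a, 'i, 'e::euclidean_space) atlas \<Rightarrow>
    (('a, 'i, 'e) tvec \<Rightarrow> real) \<Rightarrow> ('a, 'i, 'e) connection \<Rightarrow> ('a, 'i, 'e) connection \<Rightarrow> bool" where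
  "chern_connection M L C D \<longleftrightarrow>
     regular_connection M D \<and>
     (\<forall>A Y Z. vector_field (slit M) A \<and> pi_vector_field M Y \<and> pi_vector_field M Z \<longrightarrow>
        (\<forall>u\<in>points (slit M).
           cov_metric M L D A Y Z u
           = 2 * finsler_metric L u (hv_torsion M C (Kmap D \<star> A) Y u) (Z u))) \<and>
     (\<forall>A B. vector_field (slit M) A \<and> vector_field (slit M) B \<longrightarrow>
        (\<forall>u\<in>points (slit M). torsion M D A B u = 0))"

definition d_J :: "('a, 'i, 'e::euclidean_space) atlas \<Rightarrow> (('a, 'i, 'e) tvec \<Rightarrow> real) \<Rightarrow>
    ('a, 'i, 'e) vfield \<Rightarrow> ('a, 'i, 'e) tvec \<Rightarrow> real" where
  "d_J M f A = dfun (slit M) f \<star> (Jmap M \<star> A)"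

definition canonical_spray :: "('a, 'i, 'e::euclidean_space) atlas \<Rightarrow>
    (('a, 'i, 'e) tvec \<Rightarrow> real) \<Rightarrow> ('a, 'i, 'e) vfield \<Rightarrow> bool" where
  "canonical_spray M L G \<longleftrightarrow>
     vector_field (slit M) G \<and>
     (\<forall>A. vector_field (slit M) A \<longrightarrow>
        (\<forall>u\<in>points (slit M).
           ext_deriv (slit M) (d_J M (energy L)) G A u = - dfun (slit M) (energy L) u (A u)))"

definition barthel :: "('a, 'i, 'e::euclidean_space) atlas \<Rightarrow> ('a, 'i, 'e) vfield \<Rightarrow>
    ('a, 'i, 'e) vfield \<Rightarrow> ('a, 'i, 'e) vfield" where
  "barthel M G A = bracket (slit M) (Jmap M \<star> A) G - Jmap M \<star> bracket (slit M) A G"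

definition barthel_h :: "('a, 'i, 'e::euclidean_space) atlas \<Rightarrow> ('a, 'i, 'e) vfield \<Rightarrow>
    ('a, 'i, 'e) vfield \<Rightarrow> ('a, 'i, 'e) vfield" where
  "barthel_h M G A = (\<lambda>u. (1/2) \<odot> (A u + barthel M G A u))"

definition barthel_v :: "('a, 'i, 'e::euclidean_space) atlas \<Rightarrow> ('a, 'i, 'e) vfield \<Rightarrow>
    ('a, 'i, 'e) vfield \<Rightarrow> ('a, 'i, 'e) vfield" where
  "barthel_v M G A = (\<lambda>u. (1/2) \<odot> (A u - barthel M G A u))"

definition barthel_curvature :: "('a, 'i, 'e::euclidean_space) atlas \<Rightarrow> ('a, 'i, 'e) vfield \<Rightarrow>
    ('a, 'i, 'e) vfield \<Rightarrow> ('a, 'i, 'e) vfield \<Rightarrow> ('a, 'i, 'e) vfield" where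
  "barthel_curvature M G A B =
     - barthel_v M G (bracket (slit M) (barthel_h M G A) (barthel_h M G B))"

end

theory Submission
  imports Defs
begin

text \<open>
  Regard the sections of the pullback bundle as a module on which vector fields act by \<open>D\<^bsub>A\<^esub>\<close>. The
  Bianchi identities then follow from the Jacobi identities for vector fields and for the operators
  \<open>D\<^bsub>A\<^esub>\<close>, using \<open>[\<beta>X, \<beta>Y] = \<beta>(D\<^bsub>\<beta>X\<^esub>Y - D\<^bsub>\<beta>Y\<^esub>X) + \<gamma>R(X, Y)\<eta>\<close> and its analogue for \<open>[\<beta>X, \<gamma>Y]\<close>; (c) is the
  Ricci identity for \<open>g\<close>, and (g) is (f) at \<open>X = \<eta>\<close>, since \<open>P(_, \<eta>) = 0\<close>.

  The relations between the connections reduce to \<open>K \<gamma> = 1\<close>. Then \<open>\<nabla> - T(K _, _)\<close> is torsion-free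
  with the metric defect of \<open>D\<close>, and a Koszul-type argument shows that it is \<open>D\<close>; the spray
  equation gives \<open>G = \<beta>\<eta>\<close>, whence, as \<open>P(\<eta>, _)\<eta> = 0\<close>, \<open>\<Gamma> = 2\<beta>\<rho> - 1\<close>. For the Cartan connection, \<open>K \<gamma> = 1\<close> needs that
  horizontal lifts are differentiable, which follows from the existence of local frames consisting
  of global sections.
\<close>

section \<open>Calculus of smooth maps\<close>

text \<open>The obstacle is that \<open>beta\<close> is a pointwise inverse of \<open>rho\<close>:
  nothing says in advance that \<open>beta M C \<star> X\<close> is differentiable, yet the torsion
  T of the Cartan connection brackets it, and \<open>bracket\<close> is meaningful only for
  differentiable fields. A torsion-free connection escapes this: its torsion on \<gamma>X and G
  gives K \<gamma> = 1, and the horizontal lift arises from any smooth lift by removing its vertical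
  part. For the Cartan connection the components of K \<gamma> in a smooth frame are smooth,
  regularity makes their matrix injective, and the horizontal lift solves a linear system with this
  matrix. Differentiability of the solution is enough to make T usable; smoothness follows after K
  \<gamma> = 1 is known. The frame must consist of global sections because smoothness of covariant
  derivatives is postulated for global fields only. The spray has a second role: bracketing
  \<gamma>X with it yields a smooth field over every section X.\<close>

abbreviation fd :: "('a::real_normed_vector \<Rightarrow> 'b::real_normed_vector) \<Rightarrow> 'a \<Rightarrow> 'a \<Rightarrow> 'b"
  where "fd f x \<equiv> frechet_derivative f (at x)"

lemma has_derivative_cong_open:
  assumes "open S" "x \<in> S" "\<And>y. y \<in> S \<Longrightarrow> f y = g y"
  shows "(f has_derivative F) (at x) \<longleftrightarrow> (g has_derivative F) (at x)"
  using has_derivative_transform_within_open[of f F x UNIV S g]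
    has_derivative_transform_within_open[of g F x UNIV S f] assms by auto

lemma fd_cong_open:
  assumes "open S" "x \<in> S" "\<And>y. y \<in> S \<Longrightarrow> f y = g y"
  shows "fd f x = fd g x"
  unfolding frechet_derivative_def using has_derivative_cong_open[OF assms] by simp

lemma differentiable_cong_open:
  assumes "open S" "x \<in> S" "\<And>y. y \<in> S \<Longrightarrow> f y = g y"
  shows "f differentiable (at x) \<longleftrightarrow> g differentiable (at x)"
  unfolding differentiable_def using has_derivative_cong_open[OF assms] by simp

lemma fd_eqI: "(f has_derivative F) (at x) \<Longrightarrow> fd f x = F"
  using frechet_derivative_at by metis

lemma has_derivative_fd: "f differentiable (at x) \<Longrightarrow> (f has_derivative fd f x) (at x)"
  by (simp add: frechet_derivative_works)

section \<open>Calculus of maps of class C^k\<close>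

lemma Ck_on_cong:
  assumes "open S" "Ck_on k S f" "\<And>y. y \<in> S \<Longrightarrow> f y = g y"
  shows "Ck_on k S g"
  using assms
proof (induction k arbitrary: f g)
  case 0
  then show ?case by (simp add: continuous_on_cong[of S S f g])
next
  case (Suc k)
  have "Ck_on k S (\<lambda>x. fd g x v)" for v
    by (rule Suc.IH[of "\<lambda>x. fd f x v"]) (use Suc.prems fd_cong_open[of S _ f g] in auto)
  then show ?case using Suc.prems differentiable_cong_open[of S _ f g] by auto
qed

lemma Ck_on_subset: "Ck_on k S f \<Longrightarrow> T \<subseteq> S \<Longrightarrow> Ck_on k T f"
proof (induction k arbitrary: f)
  case 0
  then show ?case using continuous_on_subset by auto
qed auto

lemma Ck_on_Un:
  assumes "open S" "open T" "Ck_on k S f" "Ck_on k T f"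
  shows "Ck_on k (S \<union> T) f"
  using assms(3,4)
proof (induction k arbitrary: f)
  case 0
  then show ?case using assms by (simp add: continuous_on_open_Un)
qed auto

lemma Ck_on_Suc_imp:
  assumes "Ck_on (Suc k) S f"
  shows "Ck_on k S f"
  using assms
proof (induction k arbitrary: f)
  case 0
  then show ?case
    by (auto simp: continuous_on_eq_continuous_within differentiable_imp_continuous_within
        intro: continuous_at_imp_continuous_at_within)
next
  case (Suc k)
  then show ?case by (metis Ck_on.simps(2))
qed

lemma Ck_on_const: "Ck_on k S (\<lambda>x. c)"
  by (induction k arbitrary: c) auto

lemma Ck_on_bounded_linear_comp:
  assumes h: "bounded_linear h" and S: "open S" "Ck_on k S f"
  shows "Ck_on k S (\<lambda>x. h (f x))"
  using S(2)
proof (induction k arbitrary: f)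
  case 0
  then show ?case using h by (auto intro: bounded_linear.continuous_on)
next
  case (Suc k)
  have d: "((\<lambda>x. h (f x)) has_derivative (\<lambda>v. h (fd f x v))) (at x)" if "x \<in> S" for x
    using bounded_linear.has_derivative[OF h has_derivative_fd] Suc.prems that by auto
  have "Ck_on k S (\<lambda>x. fd (\<lambda>x. h (f x)) x v)" for v
    by (rule Ck_on_cong[OF S(1), of _ "\<lambda>x. h (fd f x v)"]) (use Suc in \<open>auto simp: fd_eqI[OF d]\<close>)
  then show ?case using d by (auto intro: differentiableI)
qed

lemma Ck_on_add:
  assumes S: "open S" and "Ck_on k S f" "Ck_on k S g"
  shows "Ck_on k S (\<lambda>x. f x + g x)"
  using assms(2,3)
proof (induction k arbitrary: f g)
  case 0
  then show ?case by (auto intro: continuous_on_add)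
next
  case (Suc k)
  have d: "((\<lambda>x. f x + g x) has_derivative (\<lambda>v. fd f x v + fd g x v)) (at x)" if "x \<in> S" for x
    by (intro has_derivative_add has_derivative_fd) (use Suc.prems that in auto)
  have "Ck_on k S (\<lambda>x. fd (\<lambda>x. f x + g x) x v)" for v
    by (rule Ck_on_cong[OF S, of _ "\<lambda>x. fd f x v + fd g x v"])
      (use Suc in \<open>auto simp: fd_eqI[OF d]\<close>)
  then show ?case using d by (auto intro: differentiableI)
qed

text \<open>The product rule expresses the derivative through \<open>f\<close>, \<open>g\<close> and
  their derivatives; \<open>Ck_on_Suc_imp\<close> brings \<open>f\<close> and \<open>g\<close>
  themselves down to the class of their derivatives, so that the induction hypothesis applies to
  both products.\<close>

lemma Ck_on_bilinear:
  assumes S: "open S" and p: "bounded_bilinear p" and "Ck_on k S f" "Ck_on k S g"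
  shows "Ck_on k S (\<lambda>x. p (f x) (g x))"
  using assms(3,4)
proof (induction k arbitrary: f g)
  case 0
  then show ?case using p by (auto intro: bounded_bilinear.continuous_on)
next
  case (Suc k)
  have d: "((\<lambda>x. p (f x) (g x)) has_derivative (\<lambda>v. p (f x) (fd g x v) + p (fd f x v) (g x))) (at x)"
    if "x \<in> S" for x
    by (intro bounded_bilinear.FDERIV[OF p] has_derivative_fd) (use Suc.prems that in auto)
  have "Ck_on k S (\<lambda>x. fd (\<lambda>x. p (f x) (g x)) x v)" for v
    by (rule Ck_on_cong[OF S, of _ "\<lambda>x. p (f x) (fd g x v) + p (fd f x v) (g x)"])
      (use Suc.prems Ck_on_Suc_imp[of k S f] Ck_on_Suc_imp[of k S g] in
        \<open>auto simp: fd_eqI[OF d] intro!: Ck_on_add[OF S] Suc.IH\<close>)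
  then show ?case using d by (auto intro: differentiableI)
qed

lemma Ck_on_sum:
  assumes S: "open S" and "\<And>i. i \<in> I \<Longrightarrow> Ck_on k S (f i)"
  shows "Ck_on k S (\<lambda>x. \<Sum>i\<in>I. f i x)"
  using assms(2) by (induction I rule: infinite_finite_induct) (auto simp: Ck_on_const Ck_on_add[OF S])

text \<open>\<open>Ck_on\<close> controls \<open>fd f x v\<close> for a fixed \<open>v\<close> only.
  Expansion in the basis reduces a direction that varies with the point to fixed ones, as the chain
  rule and \<open>smooth_on_fd_apply\<close> require.\<close>

lemma fd_euclidean_sum:
  fixes f :: "'a::euclidean_space \<Rightarrow> 'b::real_normed_vector"
  assumes "f differentiable (at x)"
  shows "fd f x v = (\<Sum>b\<in>Basis. (v \<bullet> b) *\<^sub>R fd f x b)"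
proof -
  have l: "linear (fd f x)" using assms linear_frechet_derivative by blast
  have "fd f x v = fd f x (\<Sum>b\<in>Basis. (v \<bullet> b) *\<^sub>R b)" by (simp add: euclidean_representation)
  then show ?thesis by (simp only: linear_sum[OF l] linear_scale[OF l])
qed

lemma Ck_on_compose:
  fixes g :: "'b::euclidean_space \<Rightarrow> 'c::real_normed_vector"
  assumes S: "open S" and T: "open T" and "f ` S \<subseteq> T" and "Ck_on k T g" "Ck_on k S f"
  shows "Ck_on k S (\<lambda>x. g (f x))"
  using assms(4,5)
proof (induction k arbitrary: g)
  case 0
  then show ?case using assms(3) by (auto intro: continuous_on_compose2)
next
  case (Suc k)
  have d: "((\<lambda>x. g (f x)) has_derivative (\<lambda>v. fd g (f x) (fd f x v))) (at x)" if "x \<in> S" for x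
    using diff_chain_at[OF has_derivative_fd has_derivative_fd, of f x g] Suc.prems assms(3) that
    by (auto simp: o_def)
  have fk: "Ck_on k S f" using Suc.prems(2) Ck_on_Suc_imp by blast
  have "Ck_on k S (\<lambda>x. fd (\<lambda>x. g (f x)) x v)" for v
  proof (rule Ck_on_cong[OF S, of _ "\<lambda>x. \<Sum>b\<in>Basis. (fd f x v \<bullet> b) *\<^sub>R fd g (f x) b"])
    show "Ck_on k S (\<lambda>x. \<Sum>b\<in>Basis. (fd f x v \<bullet> b) *\<^sub>R fd g (f x) b)"
      using Suc.prems Suc.IH[of "\<lambda>y. fd g y _"] fk
      by (intro Ck_on_sum[OF S] Ck_on_bilinear[OF S bounded_bilinear_scaleR]
          Ck_on_bounded_linear_comp[OF bounded_linear_inner_left S]) auto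
    show "(\<Sum>b\<in>Basis. (fd f x v \<bullet> b) *\<^sub>R fd g (f x) b) = fd (\<lambda>x. g (f x)) x v" if "x \<in> S" for x
      using Suc.prems assms(3) that by (subst fd_euclidean_sum[symmetric]) (auto simp: fd_eqI[OF d])
  qed
  then show ?case using d by (auto intro: differentiableI)
qed

lemma smooth_on_cong: "open S \<Longrightarrow> smooth_on S f \<Longrightarrow> (\<And>y. y \<in> S \<Longrightarrow> f y = g y) \<Longrightarrow> smooth_on S g"
  unfolding smooth_on_def using Ck_on_cong by blast

lemma smooth_on_subset: "smooth_on S f \<Longrightarrow> T \<subseteq> S \<Longrightarrow> smooth_on T f"
  unfolding smooth_on_def using Ck_on_subset by blast

lemma smooth_on_Un: "open S \<Longrightarrow> open T \<Longrightarrow> smooth_on S f \<Longrightarrow> smooth_on T f \<Longrightarrow> smooth_on (S \<union> T) f"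
  unfolding smooth_on_def using Ck_on_Un by blast

lemma smooth_on_const: "smooth_on S (\<lambda>x. c)"
  unfolding smooth_on_def using Ck_on_const by blast

lemma smooth_on_linear_comp:
  "bounded_linear h \<Longrightarrow> open S \<Longrightarrow> smooth_on S f \<Longrightarrow> smooth_on S (\<lambda>x. h (f x))"
  unfolding smooth_on_def using Ck_on_bounded_linear_comp by blast

lemma smooth_on_add: "open S \<Longrightarrow> smooth_on S f \<Longrightarrow> smooth_on S g \<Longrightarrow> smooth_on S (\<lambda>x. f x + g x)"
  unfolding smooth_on_def using Ck_on_add by blast

lemma smooth_on_uminus: "open S \<Longrightarrow> smooth_on S f \<Longrightarrow> smooth_on S (\<lambda>x. - f x)"
  using smooth_on_linear_comp[OF bounded_linear_minus[OF bounded_linear_ident]] .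

lemma smooth_on_diff: "open S \<Longrightarrow> smooth_on S f \<Longrightarrow> smooth_on S g \<Longrightarrow> smooth_on S (\<lambda>x. f x - g x)"
  using smooth_on_add[of S f "\<lambda>x. - g x"] smooth_on_uminus[of S g] by simp

lemma smooth_on_bilinear:
  "open S \<Longrightarrow> bounded_bilinear p \<Longrightarrow> smooth_on S f \<Longrightarrow> smooth_on S g \<Longrightarrow> smooth_on S (\<lambda>x. p (f x) (g x))"
  unfolding smooth_on_def using Ck_on_bilinear by blast

lemma smooth_on_sum:
  "open S \<Longrightarrow> (\<And>i. i \<in> I \<Longrightarrow> smooth_on S (f i)) \<Longrightarrow> smooth_on S (\<lambda>x. \<Sum>i\<in>I. f i x)"
  unfolding smooth_on_def using Ck_on_sum[of S I _ f] by blast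

lemma smooth_on_compose:
  fixes g :: "'b::euclidean_space \<Rightarrow> 'c::real_normed_vector"
  shows "open S \<Longrightarrow> open T \<Longrightarrow> f ` S \<subseteq> T \<Longrightarrow> smooth_on T g \<Longrightarrow> smooth_on S f \<Longrightarrow> smooth_on S (\<lambda>x. g (f x))"
  unfolding smooth_on_def using Ck_on_compose by blast

lemma smooth_on_linear:
  assumes "bounded_linear h" "open S" shows "smooth_on S h"
proof -
  have "Ck_on k S (\<lambda>x. x)" for k
    by (cases k) (auto simp: Ck_on_const)
  then have "smooth_on S (\<lambda>x. x)" by (simp add: smooth_on_def)
  then show ?thesis using smooth_on_linear_comp[OF assms] by blast
qed

lemma smooth_on_Pair:
  assumes "open S" "smooth_on S f" "smooth_on S g"
  shows "smooth_on S (\<lambda>x. (f x, g x))"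
proof -
  have "smooth_on S (\<lambda>x. (f x, 0) + (0, g x))"
    by (intro smooth_on_add smooth_on_linear_comp[of "\<lambda>y. (y, 0)"] smooth_on_linear_comp[of "\<lambda>y. (0, y)"] assms
        bounded_linear_Pair bounded_linear_ident bounded_linear_zero)
  then show ?thesis by simp
qed

lemma smooth_on_fst: "open S \<Longrightarrow> smooth_on S f \<Longrightarrow> smooth_on S (\<lambda>x. fst (f x))"
  and smooth_on_snd: "open S \<Longrightarrow> smooth_on S f \<Longrightarrow> smooth_on S (\<lambda>x. snd (f x))"
  by (auto intro: smooth_on_linear_comp bounded_linear_fst bounded_linear_snd)

lemma smooth_on_differentiable: "smooth_on S f \<Longrightarrow> x \<in> S \<Longrightarrow> f differentiable (at x)"
  unfolding smooth_on_def by (metis Ck_on.simps(2))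

lemma smooth_on_fd: "smooth_on S f \<Longrightarrow> smooth_on S (\<lambda>x. fd f x v)"
  unfolding smooth_on_def by (metis Ck_on.simps(2))

lemma smooth_on_fd_apply:
  fixes f :: "'a::euclidean_space \<Rightarrow> 'b::real_normed_vector"
  assumes "open S" "open T" "h ` S \<subseteq> T" "smooth_on T f" "smooth_on S h" "smooth_on S v"
  shows "smooth_on S (\<lambda>x. fd f (h x) (v x))"
proof (rule smooth_on_cong[OF assms(1), of "\<lambda>x. \<Sum>b\<in>Basis. (v x \<bullet> b) *\<^sub>R fd f (h x) b"])
  show "smooth_on S (\<lambda>x. \<Sum>b\<in>Basis. (v x \<bullet> b) *\<^sub>R fd f (h x) b)"
    by (intro smooth_on_sum smooth_on_bilinear[OF _ bounded_bilinear_scaleR] assms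
        smooth_on_linear_comp[OF bounded_linear_inner_left]
        smooth_on_compose[OF assms(1,2,3) smooth_on_fd])
  show "(\<Sum>b\<in>Basis. (v x \<bullet> b) *\<^sub>R fd f (h x) b) = fd f (h x) (v x)" if "x \<in> S" for x
    using fd_euclidean_sum[of f "h x" "v x"] smooth_on_differentiable assms that
    by (metis image_subset_iff)
qed

section \<open>Symmetry of second derivatives\<close>

text \<open>Both mixed derivatives are limits of the same second difference quotient.\<close>

lemma second_difference_quotient:
  fixes f :: "'a::real_normed_vector \<Rightarrow> real"
  assumes S: "open S" "x \<in> S" and f: "Ck_on 2 S f" and e: "0 < e"
  shows "\<exists>d>0. \<forall>h. 0 < h \<and> h < d \<longrightarrow>
     \<bar>f (x + h *\<^sub>R v + h *\<^sub>R w) - f (x + h *\<^sub>R v) - f (x + h *\<^sub>R w) + f x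
        - h * h * fd (\<lambda>y. fd f y v) x w\<bar> < e * (h * h)"
proof -
  let ?g = "\<lambda>y. fd (\<lambda>z. fd f z v) y w"
  have f': "\<And>y. y \<in> S \<Longrightarrow> f differentiable (at y)"
    "\<And>y. y \<in> S \<Longrightarrow> (\<lambda>z. fd f z v) differentiable (at y)" "continuous_on S ?g"
    using f by (auto simp: numeral_2_eq_2)
  have "isCont ?g x" using f'(3) S continuous_on_eq_continuous_at by blast
  then obtain d1 where d1: "d1 > 0" "\<And>y. dist y x < d1 \<Longrightarrow> dist (?g y) (?g x) < e"
    using e unfolding continuous_at_eps_delta by blast
  obtain d2 where d2: "d2 > 0" "ball x d2 \<subseteq> S" using S open_contains_ball by blast
  \<comment> \<open>Keeps the parallelogram spanned by \<open>d\<close> times \<open>v\<close> and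
    \<open>w\<close> within both radii; the summand 1 keeps the denominator positive when both
    vectors vanish.\<close>
  define d where "d = min d1 d2 / (norm v + norm w + 1)"
  have pos: "0 < norm v + norm w + 1" by (smt (verit) norm_ge_zero)
  have d0: "d > 0" unfolding d_def by (rule divide_pos_pos[OF _ pos]) (use d1(1) d2(1) in simp)
  have near: "dist (x + s *\<^sub>R v + t *\<^sub>R w) x < min d1 d2" if "0 \<le> s" "s < d" "0 \<le> t" "t < d" for s t
  proof -
    have "dist (x + s *\<^sub>R v + t *\<^sub>R w) x = norm (s *\<^sub>R v + t *\<^sub>R w)"
      by (simp add: dist_norm)
    also have "\<dots> \<le> s * norm v + t * norm w"
      using norm_triangle_ineq[of "s *\<^sub>R v" "t *\<^sub>R w"] that by simp
    also have "\<dots> \<le> d * norm v + d * norm w"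
      using that by (intro add_mono mult_right_mono) auto
    also have "\<dots> < d * (norm v + norm w + 1)" using d0 by (simp add: algebra_simps)
    also have "\<dots> = min d1 d2" unfolding d_def using pos by simp
    finally show ?thesis .
  qed
  have inS: "x + s *\<^sub>R v + t *\<^sub>R w \<in> S" if "0 \<le> s" "s < d" "0 \<le> t" "t < d" for s t
    using near[OF that] d2(2) by (auto simp: mem_ball dist_commute)
  show ?thesis
  proof (rule exI[of _ d], rule conjI[OF d0], intro allI impI)
    fix h assume h: "0 < h \<and> h < d"
    let ?p = "\<lambda>s. f (x + s *\<^sub>R v + h *\<^sub>R w) - f (x + s *\<^sub>R v + 0 *\<^sub>R w)"
    have "(?p has_real_derivative (fd f (x + s *\<^sub>R v + h *\<^sub>R w) v - fd f (x + s *\<^sub>R v + 0 *\<^sub>R w) v)) (at s)"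
      if "0 \<le> s" "s \<le> h" for s
    proof -
      have "((\<lambda>s. f (x + s *\<^sub>R v + t *\<^sub>R w)) has_real_derivative fd f (x + s *\<^sub>R v + t *\<^sub>R w) v) (at s)"
        if "0 \<le> t" "t \<le> h" for t
      proof -
        have "((\<lambda>s. x + s *\<^sub>R v + t *\<^sub>R w) has_derivative (\<lambda>r. r *\<^sub>R v)) (at s)"
          by (auto intro!: derivative_eq_intros)
        from diff_chain_at[OF this has_derivative_fd[OF f'(1)[OF inS]]]
        have "((\<lambda>s. f (x + s *\<^sub>R v + t *\<^sub>R w)) has_derivative (\<lambda>r. fd f (x + s *\<^sub>R v + t *\<^sub>R w) (r *\<^sub>R v))) (at s)"
          using that \<open>0 \<le> s\<close> \<open>s \<le> h\<close> h by (simp add: o_def)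
        moreover have "fd f (x + s *\<^sub>R v + t *\<^sub>R w) (r *\<^sub>R v) = r * fd f (x + s *\<^sub>R v + t *\<^sub>R w) v" for r
          using linear_scale[OF linear_frechet_derivative[OF f'(1)[OF inS]]] that \<open>0 \<le> s\<close> \<open>s \<le> h\<close> h by simp
        ultimately show ?thesis by (simp add: has_field_derivative_def mult_commute_abs)
      qed
      from DERIV_diff[OF this[of h] this[of 0]] h show ?thesis by auto
    qed
    \<comment> \<open>The mean value theorem in direction \<open>v\<close> for the increment in
      direction \<open>w\<close>; a second application, in direction \<open>w\<close>, then reaches
      the mixed derivative at an intermediate point.\<close>
    from MVT2[of 0 h ?p, OF _ this] h obtain s where s: "0 < s" "s < h"
      "?p h - ?p 0 = h * (fd f (x + s *\<^sub>R v + h *\<^sub>R w) v - fd f (x + s *\<^sub>R v + 0 *\<^sub>R w) v)" by auto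
    let ?q = "\<lambda>t. fd f (x + s *\<^sub>R v + t *\<^sub>R w) v"
    have "(?q has_real_derivative ?g (x + s *\<^sub>R v + t *\<^sub>R w)) (at t)" if t: "0 \<le> t" "t \<le> h" for t
    proof -
      have iS: "x + s *\<^sub>R v + t *\<^sub>R w \<in> S" using inS t s h by auto
      have "((\<lambda>t. x + s *\<^sub>R v + t *\<^sub>R w) has_derivative (\<lambda>r. r *\<^sub>R w)) (at t)"
        by (auto intro!: derivative_eq_intros)
      from diff_chain_at[OF this has_derivative_fd[OF f'(2)[OF iS]]]
      have "(?q has_derivative (\<lambda>r. fd (\<lambda>z. fd f z v) (x + s *\<^sub>R v + t *\<^sub>R w) (r *\<^sub>R w))) (at t)"
        by (simp add: o_def)
      moreover have "fd (\<lambda>z. fd f z v) (x + s *\<^sub>R v + t *\<^sub>R w) (r *\<^sub>R w) = r * ?g (x + s *\<^sub>R v + t *\<^sub>R w)" for r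
        using linear_scale[OF linear_frechet_derivative[OF f'(2)[OF iS]]] by simp
      ultimately show ?thesis by (simp add: has_field_derivative_def mult_commute_abs)
    qed
    from MVT2[of 0 h ?q, OF _ this] h obtain t where t: "0 < t" "t < h"
      "?q h - ?q 0 = h * ?g (x + s *\<^sub>R v + t *\<^sub>R w)" by auto
    have "?p h - ?p 0 = h * (h * ?g (x + s *\<^sub>R v + t *\<^sub>R w))" using s(3) t(3) by simp
    then have "f (x + h *\<^sub>R v + h *\<^sub>R w) - f (x + h *\<^sub>R v) - f (x + h *\<^sub>R w) + f x - h * h * ?g x
        = h * h * (?g (x + s *\<^sub>R v + t *\<^sub>R w) - ?g x)"
      by (simp add: algebra_simps)
    moreover have "\<bar>?g (x + s *\<^sub>R v + t *\<^sub>R w) - ?g x\<bar> < e"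
      using d1(2)[of "x + s *\<^sub>R v + t *\<^sub>R w"] near[of s t] s t h by (simp add: dist_real_def)
    ultimately show "\<bar>f (x + h *\<^sub>R v + h *\<^sub>R w) - f (x + h *\<^sub>R v) - f (x + h *\<^sub>R w) + f x - h * h * ?g x\<bar> < e * (h * h)"
      using h by (simp add: abs_mult mult.commute)
  qed
qed

lemma fd_fd_commute_real:
  fixes f :: "'a::real_normed_vector \<Rightarrow> real"
  assumes S: "open S" "x \<in> S" and f: "Ck_on 2 S f"
  shows "fd (\<lambda>y. fd f y v) x w = fd (\<lambda>y. fd f y w) x v" (is "?a = ?b")
proof (rule ccontr)
  assume "?a \<noteq> ?b"
  \<comment> \<open>The two estimates, for \<open>v, w\<close> and for \<open>w, v\<close>, concern
    the same second difference. Together they make the gap smaller than \<open>2 * e\<close>, which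
    is the gap itself.\<close>
  define e where "e = \<bar>?a - ?b\<bar> / 2"
  have e: "e > 0" using \<open>?a \<noteq> ?b\<close> by (simp add: e_def)
  obtain d1 where d1: "d1 > 0" "\<And>h. 0 < h \<Longrightarrow> h < d1 \<Longrightarrow>
     \<bar>f (x + h *\<^sub>R v + h *\<^sub>R w) - f (x + h *\<^sub>R v) - f (x + h *\<^sub>R w) + f x - h * h * ?a\<bar> < e * (h * h)"
    using second_difference_quotient[OF S f e, of v w] by blast
  obtain d2 where d2: "d2 > 0" "\<And>h. 0 < h \<Longrightarrow> h < d2 \<Longrightarrow>
     \<bar>f (x + h *\<^sub>R w + h *\<^sub>R v) - f (x + h *\<^sub>R w) - f (x + h *\<^sub>R v) + f x - h * h * ?b\<bar> < e * (h * h)"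
    using second_difference_quotient[OF S f e, of w v] by blast
  define h where "h = min d1 d2 / 2"
  have h: "0 < h" "h < d1" "h < d2" using d1(1) d2(1) by (auto simp: h_def min_def)
  have eq: "x + h *\<^sub>R w + h *\<^sub>R v = x + h *\<^sub>R v + h *\<^sub>R w" by simp
  have "\<bar>h * h * ?a - h * h * ?b\<bar> < 2 * e * (h * h)"
    using d1(2)[OF h(1,2)] d2(2)[OF h(1,3)] unfolding eq by linarith
  then have "h * h * \<bar>?a - ?b\<bar> < h * h * (2 * e)"
    by (simp add: right_diff_distrib[symmetric] abs_mult ac_simps)
  then have "\<bar>?a - ?b\<bar> < 2 * e" using h(1) by (simp add: mult_less_cancel_left)
  then show False by (simp add: e_def)
qed

lemma fd_inner:
  assumes "f differentiable (at x)"
  shows "fd (\<lambda>y. f y \<bullet> c) x v = fd f x v \<bullet> c"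
  using fd_eqI[OF bounded_linear.has_derivative[OF bounded_linear_inner_left has_derivative_fd[OF assms]], of c]
  by (rule fun_cong)

text \<open>Taken component by component, because the mean value theorem behind the real case has no
  equality form for vector values.\<close>

lemma fd_fd_commute:
  fixes f :: "'a::real_normed_vector \<Rightarrow> 'b::euclidean_space"
  assumes S: "open S" "x \<in> S" and f: "smooth_on S f"
  shows "fd (\<lambda>y. fd f y v) x w = fd (\<lambda>y. fd f y w) x v"
proof (rule euclidean_eqI)
  fix c :: 'b assume "c \<in> Basis"
  have "smooth_on S (\<lambda>y. f y \<bullet> c)" by (rule smooth_on_linear_comp[OF bounded_linear_inner_left S(1) f])
  then have *: "fd (\<lambda>y. fd (\<lambda>y. f y \<bullet> c) y v) x w = fd (\<lambda>y. fd (\<lambda>y. f y \<bullet> c) y w) x v"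
    using fd_fd_commute_real[OF S] unfolding smooth_on_def by blast
  have **: "fd (\<lambda>y. fd (\<lambda>y. f y \<bullet> c) y a) x b = fd (\<lambda>y. fd f y a) x b \<bullet> c" for a b
  proof -
    have "fd (\<lambda>y. fd (\<lambda>y. f y \<bullet> c) y a) x b = fd (\<lambda>y. fd f y a \<bullet> c) x b"
      using fd_cong_open[OF S, of "\<lambda>y. fd (\<lambda>y. f y \<bullet> c) y a" "\<lambda>y. fd f y a \<bullet> c"]
        fd_inner[OF smooth_on_differentiable[OF f]] by simp
    then show ?thesis using fd_inner[OF smooth_on_differentiable[OF smooth_on_fd[OF f] S(2)]] by simp
  qed
  show "fd (\<lambda>y. fd f y v) x w \<bullet> c = fd (\<lambda>y. fd f y w) x v \<bullet> c" using * ** by metis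
qed

text \<open>The product rule for a derivative evaluated in a moving direction. Iterated brackets,
  second derivatives of functions and the change of charts for derivatives of vector fields are all
  computed with it.\<close>

lemma fd_fd_apply_has_derivative:
  fixes f :: "'a::euclidean_space \<Rightarrow> 'b::euclidean_space"
  assumes S: "open S" "x \<in> S" and f: "smooth_on S f" and v: "(v has_derivative v') (at x)"
  shows "((\<lambda>y. fd f y (v y)) has_derivative (\<lambda>h. fd (\<lambda>y. fd f y (v x)) x h + fd f x (v' h))) (at x)"
proof -
  have df: "f differentiable (at y)" if "y \<in> S" for y using smooth_on_differentiable[OF f that] .
  have d2: "((\<lambda>y. fd f y b) has_derivative fd (\<lambda>y. fd f y b) x) (at x)" for b
    using has_derivative_fd smooth_on_differentiable[OF smooth_on_fd[OF f] S(2)] by blast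
  have "((\<lambda>y. \<Sum>b\<in>Basis. (v y \<bullet> b) *\<^sub>R fd f y b) has_derivative
      (\<lambda>h. \<Sum>b\<in>Basis. (v x \<bullet> b) *\<^sub>R fd (\<lambda>y. fd f y b) x h + (v' h \<bullet> b) *\<^sub>R fd f x b)) (at x)"
    by (intro has_derivative_sum has_derivative_scaleR
        bounded_linear.has_derivative[OF bounded_linear_inner_left] v d2)
  moreover have "(\<Sum>b\<in>Basis. (v x \<bullet> b) *\<^sub>R fd (\<lambda>y. fd f y b) x h + (v' h \<bullet> b) *\<^sub>R fd f x b)
      = fd (\<lambda>y. fd f y (v x)) x h + fd f x (v' h)" for h
  proof -
    \<comment> \<open>The same sum with the coefficients frozen at \<open>x\<close> identifies the
      first part as the second derivative in the constant direction \<open>v x\<close>.\<close>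
    have "((\<lambda>y. \<Sum>b\<in>Basis. (v x \<bullet> b) *\<^sub>R fd f y b) has_derivative
        (\<lambda>h. \<Sum>b\<in>Basis. (v x \<bullet> b) *\<^sub>R fd (\<lambda>y. fd f y b) x h)) (at x)"
      by (intro has_derivative_sum has_derivative_scaleR_right d2)
    then have "fd (\<lambda>y. \<Sum>b\<in>Basis. (v x \<bullet> b) *\<^sub>R fd f y b) x h
        = (\<Sum>b\<in>Basis. (v x \<bullet> b) *\<^sub>R fd (\<lambda>y. fd f y b) x h)" by (simp add: fd_eqI)
    moreover have "fd (\<lambda>y. \<Sum>b\<in>Basis. (v x \<bullet> b) *\<^sub>R fd f y b) x = fd (\<lambda>y. fd f y (v x)) x"
      by (rule fd_cong_open[OF S]) (simp add: fd_euclidean_sum[OF df, symmetric])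
    ultimately show ?thesis using fd_euclidean_sum[OF df[OF S(2)], of "v' h"] by (simp add: sum.distrib)
  qed
  ultimately have "((\<lambda>y. \<Sum>b\<in>Basis. (v y \<bullet> b) *\<^sub>R fd f y b) has_derivative
      (\<lambda>h. fd (\<lambda>y. fd f y (v x)) x h + fd f x (v' h))) (at x)" by (simp only:)
  then show ?thesis
    using has_derivative_cong_open[OF S, of "\<lambda>y. \<Sum>b\<in>Basis. (v y \<bullet> b) *\<^sub>R fd f y b" "\<lambda>y. fd f y (v y)"]
      fd_euclidean_sum[OF df] by simp
qed

section \<open>Smooth bump functions\<close>

text \<open>The derivatives of \<open>exp (- 1/t)\<close> stay in the linear span of this family.\<close>

definition flat :: "nat \<Rightarrow> real \<Rightarrow> real" where
  "flat n t = (if t \<le> 0 then 0 else exp (- (1 / t)) / t ^ n)"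

text \<open>For \<open>t > 0\<close> the substitution \<open>x = 1/t\<close> turns the expression
  into \<open>x ^ n / exp x\<close>; to the left of 0 it is constantly zero.\<close>

lemma flat_tendsto: "(flat n \<longlongrightarrow> 0) (at 0)"
proof (rule filterlim_split_at)
  show "(flat n \<longlongrightarrow> 0) (at_left 0)"
    by (rule tendsto_eventually) (auto simp: flat_def eventually_at_filter)
  have "((\<lambda>x. x ^ n / exp x) \<longlongrightarrow> (0::real)) at_top" by (rule tendsto_power_div_exp_0)
  moreover have "\<forall>\<^sub>F x in at_top. x ^ n / exp x = flat n (inverse x)"
    using eventually_gt_at_top[of 0] by eventually_elim (auto simp: flat_def exp_minus field_simps)
  ultimately have "((\<lambda>x. flat n (inverse x)) \<longlongrightarrow> 0) at_top" by (rule Lim_transform_eventually)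
  then show "(flat n \<longlongrightarrow> 0) (at_right 0)" by (simp add: filterlim_at_right_to_top)
qed

lemma flat_has_derivative:
  "(flat n has_real_derivative flat (n + 2) t - real n * flat (n + 1) t) (at t)"
proof (cases t "0::real" rule: linorder_cases)
  case less
  have "((\<lambda>t. 0) has_real_derivative 0) (at t)" by simp
  then have "(flat n has_real_derivative 0) (at t)"
    by (rule has_field_derivative_transform_within_open[of _ _ _ "{..<0}"]) (use less in \<open>auto simp: flat_def\<close>)
  then show ?thesis using less by (simp add: flat_def)
next
  case equal
  \<comment> \<open>The difference quotient of \<open>flat n\<close> at 0 is
    \<open>flat (Suc n)\<close>, which tends to 0.\<close>
  have "((\<lambda>h. (flat n (0 + h) - flat n 0) / h) \<longlongrightarrow> 0) (at 0)"
    by (rule Lim_transform_eventually[OF flat_tendsto[of "Suc n"]]) (auto simp: flat_def eventually_at_filter)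
  then show ?thesis using equal by (simp add: DERIV_def flat_def)
next
  case greater
  have "((\<lambda>t. exp (- (1 / t)) / t ^ n) has_real_derivative
      (exp (- (1 / t)) * (1 / t\<^sup>2) * t ^ n - exp (- (1 / t)) * (real n * t ^ (n - 1))) / (t ^ n * t ^ n)) (at t)"
    using greater by (auto intro!: derivative_eq_intros simp: power2_eq_square)
  moreover have "(exp (- (1 / t)) * (1 / t\<^sup>2) * t ^ n - exp (- (1 / t)) * (real n * t ^ (n - 1))) / (t ^ n * t ^ n)
      = exp (- (1 / t)) / t ^ (n + 2) - real n * (exp (- (1 / t)) / t ^ (n + 1))"
    using greater by (cases n) (auto simp: field_simps power2_eq_square)
  ultimately have "((\<lambda>t. exp (- (1 / t)) / t ^ n) has_real_derivative
      exp (- (1 / t)) / t ^ (n + 2) - real n * (exp (- (1 / t)) / t ^ (n + 1))) (at t)" by (simp only:)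
  then have "(flat n has_real_derivative exp (- (1 / t)) / t ^ (n + 2) - real n * (exp (- (1 / t)) / t ^ (n + 1))) (at t)"
    by (rule has_field_derivative_transform_within_open[of _ _ _ "{0<..}"]) (use greater in \<open>auto simp: flat_def\<close>)
  then show ?thesis using greater by (simp add: flat_def)
qed

lemma Ck_on_flat: "Ck_on k UNIV (flat n)"
proof (induction k arbitrary: n)
  case 0
  then show ?case by (simp add: continuous_on_eq_continuous_at DERIV_isCont[OF flat_has_derivative])
next
  case (Suc k)
  have d: "(flat n has_derivative (*) (flat (n + 2) t - real n * flat (n + 1) t)) (at t)" for t
    using flat_has_derivative by (simp add: has_field_derivative_def)
  have "Ck_on k UNIV (\<lambda>t. fd (flat n) t v)" for v
  proof (rule Ck_on_cong[OF open_UNIV])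
    show "Ck_on k UNIV (\<lambda>t. flat (n + 2) t * v + flat (n + 1) t * (- real n * v))"
      by (intro Ck_on_add Ck_on_bounded_linear_comp[OF bounded_linear_mult_left] Suc.IH open_UNIV)
    show "flat (n + 2) t * v + flat (n + 1) t * (- real n * v) = fd (flat n) t v" for t
      by (simp add: fd_eqI[OF d] algebra_simps)
  qed
  then show ?case using d by (auto intro: differentiableI)
qed

lemma smooth_bump:
  fixes x0 :: "'a::euclidean_space"
  assumes "0 < r"
  shows "\<exists>\<psi>::'a \<Rightarrow> real. smooth_on UNIV \<psi> \<and> 0 < \<psi> x0 \<and> (\<forall>x. x \<notin> cball x0 r \<longrightarrow> \<psi> x = 0)"
proof (intro exI conjI allI impI)
  \<comment> \<open>Positive inside the ball of radius \<open>r\<close> and nonpositive outside, so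
    \<open>flat 0\<close> cuts it off smoothly.\<close>
  let ?q = "\<lambda>x. r\<^sup>2 - (x - x0) \<bullet> (x - x0)"
  have "smooth_on UNIV ?q"
    by (intro smooth_on_diff smooth_on_bilinear[OF _ bounded_bilinear_inner] smooth_on_const
        smooth_on_linear[OF bounded_linear_ident] open_UNIV)
  moreover have "smooth_on UNIV (flat 0)" using Ck_on_flat by (simp add: smooth_on_def)
  ultimately show "smooth_on UNIV (\<lambda>x. flat 0 (?q x))"
    by (intro smooth_on_compose[of UNIV UNIV ?q "flat 0"]) auto
  show "0 < flat 0 (?q x0)" using assms by (simp add: flat_def)
  fix x assume "x \<notin> cball x0 r"
  then have "r < norm (x - x0)" by (simp add: dist_norm norm_minus_commute)
  then have "r\<^sup>2 \<le> (norm (x - x0))\<^sup>2" using assms by (intro power_mono) auto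
  then show "flat 0 (?q x) = 0" by (simp add: flat_def power2_norm_eq_inner)
qed

text \<open>Write \<open>m z\<close> for the linear map with columns \<open>n b z\<close>, so that
  \<open>m z (w z) = y z\<close>, and let \<open>P\<close> be a left inverse of \<open>m z0\<close>.
  With \<open>q z = P (y z - m z (w z0))\<close> one gets
  \<open>w z - w z0 - q z = P ((m z0 - m z) (w z - w z0))\<close>, which is small compared with
  \<open>w z - w z0\<close>. This first bounds the increment of \<open>w\<close> by twice
  \<open>q\<close>, without continuity of \<open>w\<close> being known beforehand, and then shows
  that \<open>w\<close> has the derivative of \<open>q\<close>.\<close>

lemma differentiable_linear_solve:
  fixes n :: "'e::euclidean_space \<Rightarrow> 'z::real_normed_vector \<Rightarrow> 'e"
  assumes n: "\<And>b. b \<in> Basis \<Longrightarrow> n b differentiable (at z0)"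
    and inj: "\<And>v. (\<Sum>b\<in>Basis. (v \<bullet> b) *\<^sub>R n b z0) = 0 \<Longrightarrow> v = 0"
    and y: "y differentiable (at z0)"
    and S: "open S" "z0 \<in> S" and eq: "\<And>z. z \<in> S \<Longrightarrow> (\<Sum>b\<in>Basis. (w z \<bullet> b) *\<^sub>R n b z) = y z"
  shows "w differentiable (at z0)"
proof -
  define m where "m z v = (\<Sum>b\<in>Basis. (v \<bullet> b) *\<^sub>R n b z)" for z v
  have lin: "linear (m z)" for z
    unfolding m_def linear_iff by (simp add: inner_add_left scaleR_add_left sum.distrib scaleR_sum_right)
  have "inj (m z0)" using linear_injective_0[OF lin] inj by (auto simp: m_def)
  then obtain P where P: "linear P" "P \<circ> m z0 = id" using linear_injective_left_inverse[OF lin] by blast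
  have Pm: "P (m z0 v) = v" for v using P(2) by (metis comp_apply id_apply)
  have bP: "bounded_linear P" using P(1) linear_conv_bounded_linear by blast
  define q where "q z = P (y z - m z (w z0))" for z
  have "((\<lambda>z. m z (w z0)) has_derivative (\<lambda>h. \<Sum>b\<in>Basis. (w z0 \<bullet> b) *\<^sub>R fd (n b) z0 h)) (at z0)"
    unfolding m_def
    by (intro has_derivative_sum bounded_linear.has_derivative[OF bounded_linear_scaleR_right] has_derivative_fd n)
  from bounded_linear.has_derivative[OF bP has_derivative_diff[OF has_derivative_fd[OF y] this]]
  obtain Q where Q: "(q has_derivative Q) (at z0)" unfolding q_def[abs_def] by blast
  have q0: "q z0 = 0" using eq[OF S(2)] linear_0[OF P(1)] by (simp add: q_def m_def)
  \<comment> \<open>Bounds the operator norm of \<open>P\<close> composed with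
    \<open>m z0 - m z\<close>, column by column.\<close>
  define e where "e z = onorm P * (\<Sum>b\<in>Basis. norm (n b z - n b z0))" for z
  have nc: "(n b \<longlongrightarrow> n b z0) (at z0)" if "b \<in> Basis" for b
    using differentiable_imp_continuous_within[OF n[OF that]] by (simp add: continuous_within)
  have "(e \<longlongrightarrow> onorm P * (\<Sum>b\<in>(Basis::'e set). norm (n b z0 - n b z0))) (at z0)"
    unfolding e_def by (intro tendsto_intros nc)
  then have e: "(e \<longlongrightarrow> 0) (at z0)" by simp
  have e0: "e z0 = 0" by (simp add: e_def)
  have e_pos: "0 \<le> e z" for z unfolding e_def by (intro mult_nonneg_nonneg onorm_pos_le bP sum_nonneg) auto
  have key: "norm (w z - w z0 - q z) \<le> e z * norm (w z - w z0)" if "z \<in> S" for z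
  proof -
    let ?d = "w z - w z0"
    have "m z ?d = y z - m z (w z0)" using linear_diff[OF lin] eq[OF that] by (simp add: m_def)
    then have "q z = P (m z ?d)" by (simp add: q_def)
    then have "?d - q z = P (m z0 ?d - m z ?d)" using Pm linear_diff[OF P(1)] by metis
    also have "m z0 ?d - m z ?d = (\<Sum>b\<in>Basis. (?d \<bullet> b) *\<^sub>R (n b z0 - n b z))"
      by (simp add: m_def sum_subtractf scaleR_diff_right)
    finally have "norm (?d - q z) \<le> onorm P * norm (\<Sum>b\<in>Basis. (?d \<bullet> b) *\<^sub>R (n b z0 - n b z))"
      using onorm[OF bP] by metis
    also have "norm (\<Sum>b\<in>Basis. (?d \<bullet> b) *\<^sub>R (n b z0 - n b z)) \<le> (\<Sum>b\<in>Basis. norm ?d * norm (n b z - n b z0))"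
    proof (rule sum_norm_le)
      fix b :: 'e assume b: "b \<in> Basis"
      show "norm ((?d \<bullet> b) *\<^sub>R (n b z0 - n b z)) \<le> norm ?d * norm (n b z - n b z0)"
        using mult_right_mono[OF Basis_le_norm[OF b, of ?d], of "norm (n b z - n b z0)"]
        by (simp add: norm_minus_commute[of "n b z0"])
    qed
    finally have "norm (?d - q z) \<le> onorm P * (\<Sum>b\<in>Basis. norm ?d * norm (n b z - n b z0))"
      using onorm_pos_le[OF bP] by (simp add: mult_left_mono)
    then show ?thesis by (simp add: e_def sum_distrib_left[symmetric] mult.commute mult.left_commute)
  qed
  have "(w has_derivative Q) (at z0)"
    unfolding has_derivative_at_alt
  proof (intro conjI allI impI)
    show bQ: "bounded_linear Q" using Q has_derivative_bounded_linear by blast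
    fix \<epsilon> :: real assume eps: "0 < \<epsilon>"
    define c where "c = onorm Q + 1"
    have c: "0 < c" using onorm_pos_le[OF bQ] by (simp add: c_def)
    \<comment> \<open>The bound 1 yields the Lipschitz estimate
      \<open>norm (q z) \<le> c * norm (z - z0)\<close>, the bound \<open>\<epsilon> / 2\<close> one
      half of the final error.\<close>
    obtain d1 where d1: "0 < d1" "\<And>z. norm (z - z0) < d1 \<Longrightarrow> norm (q z - q z0 - Q (z - z0)) \<le> min 1 (\<epsilon> / 2) * norm (z - z0)"
      using Q eps unfolding has_derivative_at_alt by (metis half_gt_zero min_less_iff_conj zero_less_one)
    \<comment> \<open>\<open>1 / 2\<close> lets the increment of \<open>w\<close> be absorbed, which
      bounds it by twice the norm of \<open>q z\<close>; with the Lipschitz constant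
      \<open>c\<close>, \<open>\<epsilon> / (4 * c)\<close> then gives the other half of the
      error.\<close>
    have "0 < min (1 / 2) (\<epsilon> / (4 * c))" using eps c by simp
    from tendstoD[OF e this] obtain d2 where d2: "0 < d2"
      "\<And>z. z \<noteq> z0 \<Longrightarrow> dist z z0 < d2 \<Longrightarrow> e z < min (1 / 2) (\<epsilon> / (4 * c))"
      using e_pos unfolding eventually_at by (auto simp: dist_real_def)
    obtain d3 where d3: "0 < d3" "ball z0 d3 \<subseteq> S" using S open_contains_ball by blast
    show "\<exists>d>0. \<forall>z. norm (z - z0) < d \<longrightarrow> norm (w z - w z0 - Q (z - z0)) \<le> \<epsilon> * norm (z - z0)"
    proof (intro exI[of _ "min d1 (min d2 d3)"] conjI allI impI)
      show "0 < min d1 (min d2 d3)" using d1(1) d2(1) d3(1) by simp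
      fix z assume z: "norm (z - z0) < min d1 (min d2 d3)"
      let ?d = "w z - w z0"
      have zS: "z \<in> S" using z d3(2) by (auto simp: dist_norm norm_minus_commute)
      have ez: "e z \<le> 1 / 2" "e z \<le> \<epsilon> / (4 * c)"
        using d2(2)[of z] z e0 eps c by (cases "z = z0"; auto simp: dist_norm)+
      have a: "norm (q z - Q (z - z0)) \<le> min 1 (\<epsilon> / 2) * norm (z - z0)" using d1(2)[of z] z q0 by simp
      have "norm (Q (z - z0)) \<le> onorm Q * norm (z - z0)" by (rule onorm[OF bQ])
      moreover have "norm (q z) \<le> norm (q z - Q (z - z0)) + norm (Q (z - z0))"
        using norm_triangle_ineq[of "q z - Q (z - z0)" "Q (z - z0)"] by simp
      moreover have "min 1 (\<epsilon> / 2) * norm (z - z0) \<le> 1 * norm (z - z0)" by (intro mult_right_mono) auto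
      ultimately have q: "norm (q z) \<le> c * norm (z - z0)" using a by (simp add: c_def algebra_simps)
      have k: "norm (?d - q z) \<le> e z * norm ?d" by (rule key[OF zS])
      have "e z * norm ?d \<le> 1 / 2 * norm ?d" using ez(1) by (intro mult_right_mono) auto
      moreover have "norm ?d \<le> norm (?d - q z) + norm (q z)"
        using norm_triangle_ineq[of "?d - q z" "q z"] by simp
      ultimately have dq: "norm ?d \<le> 2 * norm (q z)" using k by linarith
      have "e z * norm ?d \<le> \<epsilon> / (4 * c) * (2 * (c * norm (z - z0)))"
        using ez(2) dq q e_pos[of z] by (intro mult_mono) (auto intro: order_trans)
      also have "\<dots> = \<epsilon> / 2 * norm (z - z0)" using c by (simp add: field_simps)
      finally have "norm (?d - q z) \<le> \<epsilon> / 2 * norm (z - z0)" using k by linarith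
      moreover have "min 1 (\<epsilon> / 2) * norm (z - z0) \<le> \<epsilon> / 2 * norm (z - z0)"
        by (intro mult_right_mono) auto
      with a have "norm (q z - Q (z - z0)) \<le> \<epsilon> / 2 * norm (z - z0)" by (rule order_trans)
      moreover have "norm (?d - Q (z - z0)) \<le> norm (?d - q z) + norm (q z - Q (z - z0))"
        using norm_triangle_ineq[of "?d - q z" "q z - Q (z - z0)"] by simp
      ultimately show "norm (?d - Q (z - z0)) \<le> \<epsilon> * norm (z - z0)" by (simp add: field_simps)
    qed
  qed
  then show ?thesis by (rule differentiableI)
qed

section \<open>Connections over modules of sections\<close>

text \<open>Smooth fields are a subset of a function type, so the algebra below runs over carrier
  sets; zero and differences suffice for all group operations.\<close>

definition subgrp :: "'a::ab_group_add set \<Rightarrow> bool" where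
  "subgrp S \<longleftrightarrow> 0 \<in> S \<and> (\<forall>x\<in>S. \<forall>y\<in>S. x - y \<in> S)"

lemma subgrpD:
  assumes "subgrp S"
  shows subgrp_zero: "0 \<in> S" and subgrp_diff: "x \<in> S \<Longrightarrow> y \<in> S \<Longrightarrow> x - y \<in> S"
    and subgrp_uminus: "x \<in> S \<Longrightarrow> - x \<in> S" and subgrp_add: "x \<in> S \<Longrightarrow> y \<in> S \<Longrightarrow> x + y \<in> S"
proof -
  show "0 \<in> S" and d: "\<And>x y. x \<in> S \<Longrightarrow> y \<in> S \<Longrightarrow> x - y \<in> S" using assms by (auto simp: subgrp_def)
  show m: "\<And>x. x \<in> S \<Longrightarrow> - x \<in> S" using d[of 0] \<open>0 \<in> S\<close> by force
  show "x \<in> S \<Longrightarrow> y \<in> S \<Longrightarrow> x + y \<in> S" using d[of x "- y"] m by force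
qed

definition additive_on :: "'a::ab_group_add set \<Rightarrow> ('a \<Rightarrow> 'b::ab_group_add) \<Rightarrow> bool" where
  "additive_on S f \<longleftrightarrow> (\<forall>x\<in>S. \<forall>y\<in>S. f (x + y) = f x + f y)"

lemma additive_onD:
  assumes "subgrp S" "additive_on S f"
  shows additive_on_add: "x \<in> S \<Longrightarrow> y \<in> S \<Longrightarrow> f (x + y) = f x + f y"
    and additive_on_zero: "f 0 = 0" and additive_on_uminus: "x \<in> S \<Longrightarrow> f (- x) = - f x"
    and additive_on_diff: "x \<in> S \<Longrightarrow> y \<in> S \<Longrightarrow> f (x - y) = f x - f y"
proof -
  show a: "\<And>x y. x \<in> S \<Longrightarrow> y \<in> S \<Longrightarrow> f (x + y) = f x + f y" using assms(2) by (auto simp: additive_on_def)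
  show z: "f 0 = 0" using a[of 0 0] subgrp_zero[OF assms(1)] by simp
  show m: "\<And>x. x \<in> S \<Longrightarrow> f (- x) = - f x"
    using a z subgrp_uminus[OF assms(1)] by (metis add.right_inverse minus_unique)
  show "x \<in> S \<Longrightarrow> y \<in> S \<Longrightarrow> f (x - y) = f x - f y"
    using a[of x "- y"] m subgrp_uminus[OF assms(1)] by simp
qed

text \<open>
  \<open>VF\<close>, \<open>PF\<close>, \<open>FF\<close> stand for the vector fields, the sections of the pullback bundle and the functions
  on the slit bundle, \<open>br\<close>, \<open>rh\<close>, \<open>ga\<close>, \<open>et\<close> for the bracket, \<open>\<rho>\<close>, \<open>\<gamma>\<close>, \<open>\<eta>\<close>, and \<open>act A f\<close> for \<open>A \<cdot> f\<close>.
  Only additivity is used, never linearity over functions; in particular \<open>2 f\<close> is written \<open>f + f\<close>.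
\<close>

locale pullback_algebra =
  fixes VF :: "'v::ab_group_add set" and PF :: "'s::ab_group_add set" and FF :: "'f::ab_group_add set"
    and br :: "'v \<Rightarrow> 'v \<Rightarrow> 'v" and rh :: "'v \<Rightarrow> 's" and ga :: "'s \<Rightarrow> 'v" and et :: 's
    and act :: "'v \<Rightarrow> 'f \<Rightarrow> 'f" and g :: "'s \<Rightarrow> 's \<Rightarrow> 'f" and E :: 'f and G :: 'v
  assumes subgrps: "subgrp VF" "subgrp PF" "subgrp FF"
    and br_closed [simp]: "A \<in> VF \<Longrightarrow> B \<in> VF \<Longrightarrow> br A B \<in> VF"
    and br_additive: "B \<in> VF \<Longrightarrow> additive_on VF (\<lambda>A. br A B)"
    and br_anti: "A \<in> VF \<Longrightarrow> B \<in> VF \<Longrightarrow> br B A = - br A B"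
    and jacobi: "A \<in> VF \<Longrightarrow> B \<in> VF \<Longrightarrow> C \<in> VF \<Longrightarrow> br A (br B C) + br B (br C A) + br C (br A B) = 0"
    and rh_closed [simp]: "A \<in> VF \<Longrightarrow> rh A \<in> PF" and rh_additive: "additive_on VF rh"
    and ga_closed [simp]: "X \<in> PF \<Longrightarrow> ga X \<in> VF" and ga_additive: "additive_on PF ga"
    and et_closed [simp]: "et \<in> PF"
    and rh_ga [simp]: "X \<in> PF \<Longrightarrow> rh (ga X) = 0"
    and rh_eq_0: "A \<in> VF \<Longrightarrow> rh A = 0 \<Longrightarrow> \<exists>X\<in>PF. A = ga X"
    and rh_br_ga_ga: "X \<in> PF \<Longrightarrow> Y \<in> PF \<Longrightarrow> rh (br (ga X) (ga Y)) = 0"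
    and rh_br_ga: "X \<in> PF \<Longrightarrow> B \<in> VF \<Longrightarrow> rh B = et \<Longrightarrow> rh (br (ga X) B) = X"
    and act_closed [simp]: "A \<in> VF \<Longrightarrow> f \<in> FF \<Longrightarrow> act A f \<in> FF"
    and act_additive: "f \<in> FF \<Longrightarrow> additive_on VF (\<lambda>A. act A f)" "A \<in> VF \<Longrightarrow> additive_on FF (act A)"
    and act_br: "A \<in> VF \<Longrightarrow> B \<in> VF \<Longrightarrow> f \<in> FF \<Longrightarrow> act (br A B) f = act A (act B f) - act B (act A f)"
    and g_closed [simp]: "X \<in> PF \<Longrightarrow> Y \<in> PF \<Longrightarrow> g X Y \<in> FF"
    and g_sym: "X \<in> PF \<Longrightarrow> Y \<in> PF \<Longrightarrow> g X Y = g Y X"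
    and g_additive: "Y \<in> PF \<Longrightarrow> additive_on PF (\<lambda>X. g X Y)"
    and g_definite: "X \<in> PF \<Longrightarrow> g X X = 0 \<Longrightarrow> X = 0"
    and no_two_torsion: "(f::'f) + f = 0 \<Longrightarrow> f = 0"
    and E_closed [simp]: "E \<in> FF" and act_ga_E: "X \<in> PF \<Longrightarrow> act (ga X) E = g et X"
    and g_et_et: "g et et = E + E"
    and act_ga_g_et: "X \<in> PF \<Longrightarrow> B \<in> VF \<Longrightarrow>
        act (ga X) (g et (rh B)) = g X (rh B) + g et (rh (br (ga X) B))"
    and G_closed [simp]: "G \<in> VF"
    and spray: "A \<in> VF \<Longrightarrow> act G (g et (rh A)) - act A (g et (rh G)) - g et (rh (br G A)) = - act A E"
begin

lemmas closed [simp] =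
  subgrps[THEN subgrp_zero] subgrps[THEN subgrp_diff] subgrps[THEN subgrp_uminus] subgrps[THEN subgrp_add]

lemma br_additive2: "B \<in> VF \<Longrightarrow> additive_on VF (br B)"
  using br_additive[of B] br_anti[of _ B] unfolding additive_on_def by simp

lemma g_additive2: "Y \<in> PF \<Longrightarrow> additive_on PF (g Y)"
  using g_additive[of Y] g_sym[of Y] unfolding additive_on_def by simp

lemmas br_simps [simp] =
  additive_onD[OF subgrps(1) br_additive] additive_onD[OF subgrps(1) br_additive2]
lemmas rh_simps [simp] = additive_onD[OF subgrps(1) rh_additive]
lemmas ga_simps [simp] = additive_onD[OF subgrps(2) ga_additive]
lemmas act_simps [simp] =
  additive_onD[OF subgrps(1) act_additive(1)] additive_onD[OF subgrps(3) act_additive(2)]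
lemmas g_simps [simp] =
  additive_onD[OF subgrps(2) g_additive] additive_onD[OF subgrps(2) g_additive2]

lemma add_self_eq_0_iff: "(f::'f) + f = 0 \<longleftrightarrow> f = 0"
  by (rule iffI, rule no_two_torsion) simp_all

lemma g_nondegenerate:
  assumes "X \<in> PF" "\<And>Y. Y \<in> PF \<Longrightarrow> g X Y = 0"
  shows "X = 0"
  using assms g_definite by blast

lemma g_cancel:
  assumes "X \<in> PF" "Y \<in> PF" "\<And>Z. Z \<in> PF \<Longrightarrow> g X Z = g Y Z"
  shows "X = Y"
  using g_nondegenerate[of "X - Y"] assms by simp

text \<open>The spray equation is tested on vertical fields. By \<open>act_ga_g_et\<close> the
  derivative of \<open>g et (rh G)\<close> along \<open>ga X\<close> is \<open>g X (rh G)\<close>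
  plus a bracket term, and the latter cancels against the bracket term of the spray
  equation.\<close>

lemma rh_G: "rh G = et"
proof (rule g_cancel)
  fix X assume X: "X \<in> PF"
  have "act (ga X) (g et (rh G)) + g et (rh (br G (ga X))) = g et X"
    using spray[of "ga X"] X by (simp add: act_ga_E algebra_simps)
  then have "g X (rh G) = g et X"
    using act_ga_g_et[of X G] br_anti[of "ga X" G] X by simp
  then show "g (rh G) X = g et X" using g_sym X by simp
qed auto

text \<open>The spray turns the vertical lift of a section into a smooth vector field lying over the section.\<close>

definition lift :: "'s \<Rightarrow> 'v" where "lift X = br (ga X) G"

lemma lift_closed [simp]: "X \<in> PF \<Longrightarrow> lift X \<in> VF"
  and rh_lift [simp]: "X \<in> PF \<Longrightarrow> rh (lift X) = X"
  using rh_G by (auto simp: lift_def rh_br_ga)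

text \<open>
  The same algebra gives the uniqueness of the Chern connection and \<open>P(X, \<eta>) = 0\<close>. Setting some
  of the arguments to \<open>\<eta>\<close> first shows \<open>b(X, \<eta>) = 0\<close>; then \<open>g(b(X, Y), Z)\<close> is symmetric in the first two
  and antisymmetric in the last two arguments.
\<close>

lemma symmetric_form_eq_0:
  assumes b: "\<And>X Y. X \<in> PF \<Longrightarrow> Y \<in> PF \<Longrightarrow> b X Y \<in> PF"
    and sym: "\<And>X Y. X \<in> PF \<Longrightarrow> Y \<in> PF \<Longrightarrow> b X Y = b Y X"
    and T: "\<And>X Y. X \<in> PF \<Longrightarrow> Y \<in> PF \<Longrightarrow> T X Y \<in> PF"
    and T0: "\<And>Y. Y \<in> PF \<Longrightarrow> T 0 Y = 0"
    and Tsym: "\<And>X Y Z. X \<in> PF \<Longrightarrow> Y \<in> PF \<Longrightarrow> Z \<in> PF \<Longrightarrow> g (T X Y) Z = g (T X Z) Y"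
    and Teta: "\<And>X. X \<in> PF \<Longrightarrow> T X et = 0"
    and eq: "\<And>X Y Z. X \<in> PF \<Longrightarrow> Y \<in> PF \<Longrightarrow> Z \<in> PF \<Longrightarrow>
      g (b X Y) Z + g Y (b X Z) + g (T (b X et) Y) Z + g (T (b X et) Y) Z = 0"
    and X: "X \<in> PF" and Y: "Y \<in> PF"
  shows "b X Y = 0"
proof -
  define c where "c X Y Z = g (b X Y) Z" for X Y Z
  have cs: "c X Y Z = c Y X Z" if "X \<in> PF" "Y \<in> PF" for X Y Z using sym that by (simp add: c_def)
  have eq': "c X Y Z + c X Z Y + g (T (b X et) Y) Z + g (T (b X et) Y) Z = 0"
    if "X \<in> PF" "Y \<in> PF" "Z \<in> PF" for X Y Z
    using eq[OF that] g_sym[of Y "b X Z"] b that by (simp add: c_def)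
  have e1: "c X Y et = - c X et Y" if "X \<in> PF" "Y \<in> PF" for X Y
    using eq'[of X Y et] Tsym[of "b X et" Y et] Teta[of "b X et"] b that by (simp add: eq_neg_iff_add_eq_0)
  have e2: "c X et Y = c Y et X" if "X \<in> PF" "Y \<in> PF" for X Y
    using e1[of X Y] e1[of Y X] cs[of X Y et] that by (metis neg_equal_iff_equal)
  have e3: "c X et et = 0" if "X \<in> PF" for X
    using eq_neg_iff_add_eq_0[THEN iffD1, OF e1[of X et]] that by (simp add: add_self_eq_0_iff)
  have e4: "b et et = 0"
    using e2[of et] e3 b by (intro g_nondegenerate) (auto simp: c_def)
  \<comment> \<open>With \<open>et\<close> as first argument the T terms vanish by
    \<open>e4\<close>, and \<open>e2\<close> makes the two remaining terms equal.\<close>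
  have e5: "c X et Y = 0" if "X \<in> PF" "Y \<in> PF" for X Y
    using eq'[of et X Y] e4 T0 that cs[of et X Y] cs[of et Y X] e2[of X Y]
    by (simp add: c_def add_self_eq_0_iff)
  have bet: "b X et = 0" if "X \<in> PF" for X
    using e5 b that by (intro g_nondegenerate) (auto simp: c_def)
  have e6: "c X Y Z = - c X Z Y" if "X \<in> PF" "Y \<in> PF" "Z \<in> PF" for X Y Z
    using eq'[of X Y Z] bet T0 that by (simp add: eq_neg_iff_add_eq_0)
  \<comment> \<open>Six transpositions lead back to \<open>c X Y Z\<close>; three of them, in the
    last two arguments, change the sign, as in the uniqueness proof for the Levi-Civita
    connection.\<close>
  have "c X Y Z = 0" if Z: "Z \<in> PF" for Z
  proof -
    have "c X Y Z = - c Z X Y" by (simp only: e6[OF X Y Z] cs[OF X Z])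
    also have "\<dots> = c Y Z X" by (simp only: e6[OF Z X Y] cs[OF Z Y] minus_minus)
    also have "\<dots> = - c X Y Z" by (simp only: e6[OF Y Z X] cs[OF Y X])
    finally show ?thesis using eq_neg_iff_add_eq_0 add_self_eq_0_iff by blast
  qed
  then show ?thesis using X Y b by (intro g_nondegenerate) (auto simp: c_def)
qed

definition curv :: "('v \<Rightarrow> 's \<Rightarrow> 's) \<Rightarrow> 'v \<Rightarrow> 'v \<Rightarrow> 's \<Rightarrow> 's" where
  "curv D A B Z = - D A (D B Z) + D B (D A Z) + D (br A B) Z"

definition covt :: "('v \<Rightarrow> 's \<Rightarrow> 's) \<Rightarrow> 'v \<Rightarrow> ('s \<Rightarrow> 's \<Rightarrow> 's \<Rightarrow> 's) \<Rightarrow> 's \<Rightarrow> 's \<Rightarrow> 's \<Rightarrow> 's" where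
  "covt D A B X Y Z = D A (B X Y Z) - B (D A X) Y Z - B X (D A Y) Z - B X Y (D A Z)"

end

text \<open>\<open>D A et\<close> is K A, and the last two summands of \<open>metric\<close> are 2
  g(T(KA, Y), Z). T is an independent parameter, so that two connections with the same T can be
  compared in \<open>unique\<close>.\<close>

locale chern_algebra = pullback_algebra +
  fixes T :: "'b \<Rightarrow> 'b \<Rightarrow> 'b" and D :: "'a \<Rightarrow> 'b \<Rightarrow> 'b"
  assumes T_closed [simp]: "X \<in> PF \<Longrightarrow> Y \<in> PF \<Longrightarrow> T X Y \<in> PF"
    and T_additive: "Y \<in> PF \<Longrightarrow> additive_on PF (\<lambda>X. T X Y)" "Y \<in> PF \<Longrightarrow> additive_on PF (T Y)"
    and T_sym: "X \<in> PF \<Longrightarrow> Y \<in> PF \<Longrightarrow> Z \<in> PF \<Longrightarrow> g (T X Y) Z = g (T X Z) Y"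
    and T_et [simp]: "X \<in> PF \<Longrightarrow> T X et = 0"
    and D_closed [simp]: "A \<in> VF \<Longrightarrow> Y \<in> PF \<Longrightarrow> D A Y \<in> PF"
    and D_additive: "Y \<in> PF \<Longrightarrow> additive_on VF (\<lambda>A. D A Y)" "A \<in> VF \<Longrightarrow> additive_on PF (D A)"
    and torsion_free: "A \<in> VF \<Longrightarrow> B \<in> VF \<Longrightarrow> D A (rh B) - D B (rh A) = rh (br A B)"
    and metric: "A \<in> VF \<Longrightarrow> Y \<in> PF \<Longrightarrow> Z \<in> PF \<Longrightarrow>
      act A (g Y Z) = g (D A Y) Z + g Y (D A Z) + g (T (D A et) Y) Z + g (T (D A et) Y) Z"
begin

lemmas T_simps [simp] =
  additive_onD[OF subgrps(2) T_additive(1)] additive_onD[OF subgrps(2) T_additive(2)]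
lemmas D_simps [simp] =
  additive_onD[OF subgrps(1) D_additive(1)] additive_onD[OF subgrps(2) D_additive(2)]

text \<open>As \<open>rh G = et\<close> and \<open>rh (ga X) = 0\<close>, torsion-freeness for
  \<open>ga X\<close> and \<open>G\<close> reads K(\<open>ga X\<close>) =
  \<open>rh (br (ga X) G)\<close>, and the right side is \<open>X\<close>.\<close>

lemma K_ga [simp]: "X \<in> PF \<Longrightarrow> D (ga X) et = X"
  using torsion_free[of "ga X" G] rh_G rh_br_ga by simp

text \<open>The horizontal lift, as the smooth lift given by the spray minus its vertical part; by
  \<open>vf_eqI\<close> any other smooth lift would give the same field.\<close>

definition be :: "'b \<Rightarrow> 'a" where "be X = lift X - ga (D (lift X) et)"

lemma be_closed [simp]: "X \<in> PF \<Longrightarrow> be X \<in> VF"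
  and rh_be [simp]: "X \<in> PF \<Longrightarrow> rh (be X) = X"
  and K_be [simp]: "X \<in> PF \<Longrightarrow> D (be X) et = 0"
  by (auto simp: be_def)

text \<open>A difference with zero \<rho> has the form \<open>ga X\<close>, and K recovers
  \<open>X\<close>. Identities between vector fields are proved below by comparing these two
  components.\<close>

lemma vf_eqI:
  assumes "A \<in> VF" "B \<in> VF" "rh A = rh B" "D A et = D B et"
  shows "A = B"
proof -
  obtain X where X: "X \<in> PF" "A - B = ga X" using rh_eq_0[of "A - B"] assms by auto
  then have "X = D (A - B) et" by simp
  also have "\<dots> = 0" using assms by simp
  finally show ?thesis using X by simp
qed

lemma be_additive: "additive_on PF be"
  unfolding additive_on_def by (auto intro!: vf_eqI)

lemmas be_simps [simp] = additive_onD[OF subgrps(2) be_additive]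

lemma decompose: "A \<in> VF \<Longrightarrow> A = be (rh A) + ga (D A et)"
  by (rule vf_eqI) auto

section \<open>Curvature, the Bianchi identities and the structure equations\<close>

lemma curv_closed [simp]: "A \<in> VF \<Longrightarrow> B \<in> VF \<Longrightarrow> Z \<in> PF \<Longrightarrow> curv D A B Z \<in> PF"
  by (simp add: curv_def)

lemma curv_add1: "A \<in> VF \<Longrightarrow> A' \<in> VF \<Longrightarrow> B \<in> VF \<Longrightarrow> Z \<in> PF \<Longrightarrow>
    curv D (A + A') B Z = curv D A B Z + curv D A' B Z"
  by (simp add: curv_def)

lemma curv_anti: "A \<in> VF \<Longrightarrow> B \<in> VF \<Longrightarrow> Z \<in> PF \<Longrightarrow> curv D B A Z = - curv D A B Z"
  by (simp add: curv_def br_anti[of A B])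

lemma curv_add2: "A \<in> VF \<Longrightarrow> A' \<in> VF \<Longrightarrow> B \<in> VF \<Longrightarrow> Z \<in> PF \<Longrightarrow>
    curv D B (A + A') Z = curv D B A Z + curv D B A' Z"
  by (simp add: curv_def)

lemma curv_add3: "A \<in> VF \<Longrightarrow> B \<in> VF \<Longrightarrow> Z \<in> PF \<Longrightarrow> Y \<in> PF \<Longrightarrow>
    curv D A B (Z + Y) = curv D A B Z + curv D A B Y"
  by (simp add: curv_def)

lemma curv_additive: "B \<in> VF \<Longrightarrow> Z \<in> PF \<Longrightarrow> additive_on VF (\<lambda>A. curv D A B Z)"
  "B \<in> VF \<Longrightarrow> Z \<in> PF \<Longrightarrow> additive_on VF (\<lambda>A. curv D B A Z)"
  "A \<in> VF \<Longrightarrow> B \<in> VF \<Longrightarrow> additive_on PF (curv D A B)"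
  unfolding additive_on_def by (simp_all add: curv_add1 curv_add2 curv_add3)

lemmas curv_simps [simp] =
  additive_onD[OF subgrps(1) curv_additive(1)] additive_onD[OF subgrps(1) curv_additive(2)]
  additive_onD[OF subgrps(2) curv_additive(3)]

text \<open>Torsion-freeness used twice turns D_A(D_B \<rho>C - D_C \<rho>B) - D_[B,C] \<rho>A into
  \<rho>[A,[B,C]]. The cyclic sum of the curvatures is minus the cyclic sum of these, zero by
  Jacobi.\<close>

lemma bianchi1:
  assumes [simp]: "A \<in> VF" "B \<in> VF" "C \<in> VF"
  shows "curv D A B (rh C) + curv D B C (rh A) + curv D C A (rh B) = 0"
proof -
  have *: "D A (D B (rh C)) - D A (D C (rh B)) = D A (rh (br B C))" if "A \<in> VF" "B \<in> VF" "C \<in> VF" for A B C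
    using torsion_free[of B C] that additive_on_diff[OF subgrps(2) D_additive(2), of A "D B (rh C)" "D C (rh B)"]
    by simp
  have **: "D A (rh (br B C)) - D (br B C) (rh A) = rh (br A (br B C))"
    if "A \<in> VF" "B \<in> VF" "C \<in> VF" for A B C
    using torsion_free[of A "br B C"] that by simp
  have "curv D A B (rh C) + curv D B C (rh A) + curv D C A (rh B)
      = - (D A (rh (br B C)) - D (br B C) (rh A)) - (D B (rh (br C A)) - D (br C A) (rh B))
        - (D C (rh (br A B)) - D (br A B) (rh C))"
    unfolding *[symmetric, OF assms] *[symmetric, OF assms(2,3,1)] *[symmetric, OF assms(3,1,2)]
    by (simp add: curv_def)
  also have "\<dots> = - rh (br A (br B C) + br B (br C A) + br C (br A B))"
    by (simp add: **)
  finally show ?thesis by (simp only: jacobi[OF assms] rh_simps) simp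
qed

text \<open>As \<open>curv D A B\<close> is D_[A,B] minus the commutator of D_A and D_B, the triple
  products cancel by the Jacobi identity of operators, and the derivatives along double brackets by
  that of vector fields.\<close>

lemma bianchi2:
  assumes [simp]: "A \<in> VF" "B \<in> VF" "C \<in> VF" "W \<in> PF"
  shows "D A (curv D B C W) - curv D B C (D A W) + (D B (curv D C A W) - curv D C A (D B W))
      + (D C (curv D A B W) - curv D A B (D C W))
      = - (curv D A (br B C) W + curv D B (br C A) W + curv D C (br A B) W)"
proof -
  have "curv D A (br B C) W + curv D B (br C A) W + curv D C (br A B) W
      = - D A (D (br B C) W) + D (br B C) (D A W) - D B (D (br C A) W) + D (br C A) (D B W)
        - D C (D (br A B) W) + D (br A B) (D C W)
        + D (br A (br B C) + br B (br C A) + br C (br A B)) W"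
    by (simp add: curv_def)
  then show ?thesis by (simp add: jacobi[OF assms(1-3)]) (simp add: curv_def)
qed

abbreviation "R X Y Z \<equiv> curv D (be X) (be Y) Z"
abbreviation "P X Y Z \<equiv> curv D (be X) (ga Y) Z"
abbreviation "Rh X Y \<equiv> R X Y et"
abbreviation "Ph X Y \<equiv> P X Y et"

text \<open>Only the term containing \<open>rh (be Z)\<close> survives in the first Bianchi identity
  for \<open>ga X\<close>, \<open>ga Y\<close>, \<open>be Z\<close>. So the v-curvature S
  vanishes.\<close>

lemma curv_ga_ga [simp]:
  assumes "X \<in> PF" "Y \<in> PF" "Z \<in> PF" shows "curv D (ga X) (ga Y) Z = 0"
  using bianchi1[of "ga X" "ga Y" "be Z"] assms by simp

text \<open>In the first Bianchi identity for \<open>be X\<close>, \<open>ga Y\<close>,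
  \<open>be Z\<close> the R term acts on \<open>rh (ga Y) = 0\<close>.\<close>

lemma P_sym: "X \<in> PF \<Longrightarrow> Y \<in> PF \<Longrightarrow> Z \<in> PF \<Longrightarrow> P X Y Z = P Z Y X"
  using bianchi1[of "be X" "ga Y" "be Z"] curv_anti[of "be Z" "ga Y" X] by simp

lemma R_cyclic: "X \<in> PF \<Longrightarrow> Y \<in> PF \<Longrightarrow> Z \<in> PF \<Longrightarrow> R X Y Z + R Y Z X + R Z X Y = 0"
  using bianchi1[of "be X" "be Y" "be Z"] by simp

text \<open>\<open>et\<close> is parallel along horizontal lifts, so only the bracket term of the
  curvature is left: \<open>Rh\<close> is the vertical part of the bracket of two horizontal
  lifts.\<close>

lemma Rh_eq: "X \<in> PF \<Longrightarrow> Y \<in> PF \<Longrightarrow> Rh X Y = D (br (be X) (be Y)) et"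
  by (simp add: curv_def)

lemma K_br_be_ga: "X \<in> PF \<Longrightarrow> Y \<in> PF \<Longrightarrow> D (br (be X) (ga Y)) et = Ph X Y + D (be X) Y"
  by (simp add: curv_def)

lemma br_be_be:
  assumes [simp]: "X \<in> PF" "Y \<in> PF"
  shows "br (be X) (be Y) = be (D (be X) Y) - be (D (be Y) X) + ga (Rh X Y)"
proof -
  have "rh (br (be X) (be Y)) = D (be X) Y - D (be Y) X"
    using torsion_free[of "be X" "be Y"] by simp
  then show ?thesis using decompose[of "br (be X) (be Y)"] by (simp add: Rh_eq)
qed

lemma br_be_ga:
  assumes [simp]: "X \<in> PF" "Y \<in> PF"
  shows "br (be X) (ga Y) = - be (D (ga Y) X) + ga (Ph X Y) + ga (D (be X) Y)"
proof -
  have "rh (br (be X) (ga Y)) = - D (ga Y) X"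
    using torsion_free[of "be X" "ga Y"] by simp
  then show ?thesis using decompose[of "br (be X) (ga Y)"] K_br_be_ga[of X Y] by simp
qed

text \<open>The brackets in \<open>bianchi2\<close> are split by \<open>br_be_be\<close>: their
  horizontal parts complete the commutators of D with R to tensor derivatives, their vertical parts
  produce the P terms.\<close>

lemma R_bianchi2:
  assumes [simp]: "X \<in> PF" "Y \<in> PF" "Z \<in> PF" "W \<in> PF"
  shows "(covt D (be X) R Y Z W + P X (Rh Y Z) W) + (covt D (be Y) R Z X W + P Y (Rh Z X) W)
       + (covt D (be Z) R X Y W + P Z (Rh X Y) W) = 0"
proof -
  \<comment> \<open>A tensor derivative differentiates both slots of R, while the brackets enter in
    the second slot only; antisymmetry reconciles the two.\<close>
  have a: "R (D (be X) Y) Z W = - R Z (D (be X) Y) W" if "X \<in> PF" "Y \<in> PF" "Z \<in> PF" for X Y Z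
    using curv_anti[of "be (D (be X) Y)" "be Z" W] that by simp
  show ?thesis
    using bianchi2[of "be X" "be Y" "be Z" W]
    by (simp add: br_be_be covt_def a algebra_simps)
qed

text \<open>The same splitting with one vertical argument. The vertical part of
  [\<open>be Y\<close>, \<open>be Z\<close>] meets \<open>ga X\<close> in a v-curvature, which is
  zero.\<close>

lemma R_bianchi2_mixed:
  assumes [simp]: "X \<in> PF" "Y \<in> PF" "Z \<in> PF" "W \<in> PF"
  shows "covt D (ga X) R Y Z W + covt D (be Y) P Z X W - covt D (be Z) P Y X W
       - P Z (Ph Y X) W + P Y (Ph Z X) W = 0"
proof -
  have a: "R (D (ga X) Y) Z W = - R Z (D (ga X) Y) W"
    using curv_anti[of "be (D (ga X) Y)" "be Z" W] by simp
  have b: "curv D (ga X) B V = - curv D B (ga X) V" if "B \<in> VF" "V \<in> PF" for B V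
    using curv_anti[of "ga X" B V] that by simp
  have c: "br (ga X) (be Y) = be (D (ga X) Y) - ga (Ph Y X) - ga (D (be Y) X)"
    using br_be_ga[of Y X] br_anti[of "be Y" "ga X"] by simp
  show ?thesis
    using bianchi2[of "ga X" "be Y" "be Z" W]
    by (simp add: br_be_be br_be_ga c covt_def a b algebra_simps)
qed

section \<open>The Ricci identity and contractions with eta\<close>

text \<open>The right side is grouped so that each bracket is a metric defect of the form
  \<open>act A (g Y Z) - g (D A Y) Z - g Y (D A Z)\<close>, or a sum of two; \<open>metric\<close>
  then evaluates all of them at once.\<close>

lemma ricci:
  assumes [simp]: "A \<in> VF" "B \<in> VF" "Y \<in> PF" "Z \<in> PF"
  shows "g (curv D A B Y) Z + g Y (curv D A B Z) =
    act A (act B (g Y Z) - g (D B Y) Z - g Y (D B Z)) - act B (act A (g Y Z) - g (D A Y) Z - g Y (D A Z))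
    - (act B (g (D A Y) Z + g Y (D A Z)) - g (D B (D A Y)) Z - g (D A Y) (D B Z) - g (D B Y) (D A Z) - g Y (D B (D A Z)))
    + (act A (g (D B Y) Z + g Y (D B Z)) - g (D A (D B Y)) Z - g (D B Y) (D A Z) - g (D A Y) (D B Z) - g Y (D A (D B Z)))
    - (act (br A B) (g Y Z) - g (D (br A B) Y) Z - g Y (D (br A B) Z))"
  by (simp add: act_br curv_def algebra_simps)

text \<open>Horizontal lifts have K = 0, hence no metric defect; only their bracket contributes,
  with K equal to \<open>Rh X Y\<close>.\<close>

lemma R_metric:
  assumes [simp]: "X \<in> PF" "Y \<in> PF" "Z \<in> PF" "W \<in> PF"
  shows "g (R X Y Z) W = - g (R X Y W) Z - g (T (Rh X Y) Z) W - g (T (Rh X Y) Z) W"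
proof -
  have "g (R X Y Z) W + g (R X Y W) Z = - g (T (Rh X Y) Z) W - g (T (Rh X Y) Z) W"
    using ricci[of "be X" "be Y" Z W] g_sym[of Z "R X Y W"] by (simp add: metric Rh_eq)
  then show ?thesis by (simp add: eq_diff_eq[symmetric])
qed

text \<open>The metric defect vanishes when one of the two sections is \<open>et\<close>, by
  \<open>T_et\<close> and \<open>T_sym\<close>, so the curvature is skew against
  \<open>et\<close>.\<close>

lemma g_P_et:
  assumes [simp]: "X \<in> PF" "Y \<in> PF" "Z \<in> PF"
  shows "g (P X Y Z) et = - g Z (Ph X Y)"
proof -
  have [simp]: "g (T V U) et = 0" if "V \<in> PF" "U \<in> PF" for V U using T_sym[of V U et] that by simp
  show ?thesis using ricci[of "be X" "ga Y" Z et] by (simp add: metric eq_neg_iff_add_eq_0 algebra_simps)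
qed

text \<open>Skewness against \<open>et\<close> gives first g(\<open>Ph Z Y\<close>,
  \<open>et\<close>) = 0. By \<open>P_sym\<close> this is g(\<open>P et Y Z\<close>,
  \<open>et\<close>), which by skewness again is -g(\<open>Z\<close>,
  \<open>Ph et Y\<close>).\<close>

lemma Ph_et1:
  assumes [simp]: "Y \<in> PF" shows "Ph et Y = 0"
proof (rule g_nondegenerate)
  fix Z assume [simp]: "Z \<in> PF"
  have "g (Ph Z Y) et + g (Ph Z Y) et = 0"
    using g_P_et[of Z Y et] g_sym[of et "Ph Z Y"]
      eq_neg_iff_add_eq_0[of "g (Ph Z Y) et" "g (Ph Z Y) et"] by simp
  then have "g (P et Y Z) et = 0" using P_sym[of et Y Z] by (simp add: add_self_eq_0_iff)
  then show "g (Ph et Y) Z = 0" using g_P_et[of et Y Z] g_sym[of Z "Ph et Y"] by simp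
qed simp

lemma act_ga_g_et_D: "X \<in> PF \<Longrightarrow> Z \<in> PF \<Longrightarrow> act (ga X) (g et Z) = g X Z + g et (D (ga X) Z)"
  by (simp add: metric)

text \<open>
  Total symmetry of \<open>T\<close>: vertically, \<open>g\<close> is the derivative of the 1-form \<open>g(\<eta>, _)\<close> with respect to a
  connection that is flat and torsion-free there.
\<close>

lemma T_swap:
  assumes [simp]: "X \<in> PF" "Y \<in> PF" "Z \<in> PF"
  shows "g (T X Y) Z = g (T Y X) Z"
proof -
  have *: "act (ga X) (act (ga Y) (g et Z)) = g (D (ga X) Y) Z + g Y (D (ga X) Z)
      + g (T X Y) Z + g (T X Y) Z + g X (D (ga Y) Z) + g et (D (ga X) (D (ga Y) Z))"
    if [simp]: "X \<in> PF" "Y \<in> PF" for X Y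
    by (simp add: act_ga_g_et_D) (simp add: metric)
  let ?B = "br (ga X) (ga Y)"
  \<comment> \<open>Flatness of D in vertical directions, applied to \<open>et\<close>, computes the
    vertical component of the bracket, which has no other.\<close>
  have K: "D ?B et = D (ga X) Y - D (ga Y) X"
    using curv_ga_ga[of X Y et] by (simp add: curv_def add_eq_0_iff)
  have "?B = ga (D ?B et)" using decompose[of ?B] rh_br_ga_ga by simp
  then have "act ?B (g et Z) = act (ga (D ?B et)) (g et Z)" by simp
  then have "act ?B (g et Z) = g (D (ga X) Y - D (ga Y) X) Z + g et (D ?B Z)"
    using \<open>?B = ga (D ?B et)\<close> K by (simp add: act_ga_g_et_D)
  moreover have "D ?B Z = D (ga X) (D (ga Y) Z) - D (ga Y) (D (ga X) Z)"
    using curv_ga_ga[of X Y Z] by (simp add: curv_def algebra_simps)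
  ultimately have "(g (T X Y) Z - g (T Y X) Z) + (g (T X Y) Z - g (T Y X) Z) = 0"
    using act_br[of "ga X" "ga Y" "g et Z"] *[of X Y] *[of Y X] by (simp add: algebra_simps)
  then show ?thesis by (simp add: add_self_eq_0_iff)
qed

text \<open>The contraction of the Cartan tensor with \<eta>. It expresses homogeneity of g of
  degree 0 and is obtained here from the total symmetry of T.\<close>

lemma T_et1 [simp]: assumes "Y \<in> PF" shows "T et Y = 0"
  using T_swap[of et Y] assms by (intro g_nondegenerate) auto

text \<open>Neither \<open>be X\<close> nor \<open>ga et\<close> has a metric defect, the latter
  because K(\<open>ga et\<close>) = \<open>et\<close> and \<open>T et _ = 0\<close>. So the Ricci
  identity leaves only the bracket, with K equal to \<open>Ph X et\<close>, and \<open>P_sym\<close>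
  supplies the symmetry required for \<open>symmetric_form_eq_0\<close>.\<close>

lemma P_et2 [simp]:
  assumes "X \<in> PF" "Z \<in> PF" shows "P X et Z = 0"
proof (rule symmetric_form_eq_0[where b = "\<lambda>X Z. P X et Z" and T = T])
  fix X Y Z assume [simp]: "X \<in> PF" "Y \<in> PF" "Z \<in> PF"
  have "g (P X et Y) Z + g Y (P X et Z) = - g (T (D (br (be X) (ga et)) et) Y) Z - g (T (D (br (be X) (ga et)) et) Y) Z"
    using ricci[of "be X" "ga et" Y Z] by (simp add: metric algebra_simps)
  then show "g (P X et Y) Z + g Y (P X et Z) + g (T (Ph X et) Y) Z + g (T (Ph X et) Y) Z = 0"
    using K_br_be_ga[of X et] by simp
qed (use assms in \<open>auto simp: P_sym T_sym\<close>)

text \<open>\<open>et\<close> is parallel in horizontal directions, so the horizontal derivatives of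
  P with \<open>et\<close> in the second slot vanish together with P(_, \<eta>).\<close>

lemma R_ga_et:
  assumes [simp]: "Y \<in> PF" "Z \<in> PF" "W \<in> PF"
  shows "covt D (ga et) R Y Z W = 0"
  using R_bianchi2_mixed[of et Y Z W] by (simp add: covt_def)

section \<open>The canonical spray and the Barthel connection\<close>

text \<open>The spray equation is tested on the horizontal lift of V = K G. Horizontally 2 E =
  g(\<eta>, \<eta>) is constant, and torsion-freeness cancels the derivative of V along G; g(V, V) =
  0 remains.\<close>

lemma G_eq: "G = be et"
proof (rule vf_eqI)
  let ?V = "D G et"
  have "act (be ?V) E + act (be ?V) E = 0"
    using arg_cong[OF g_et_et, of "act (be ?V)"] by (simp add: metric)
  then have "act G (g et ?V) - act (be ?V) (g et et) - g et (rh (br G (be ?V))) = 0"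
    using spray[of "be ?V"] rh_G by (simp add: add_self_eq_0_iff)
  then have "g ?V ?V = 0"
    using torsion_free[of G "be ?V", symmetric] rh_G by (simp add: metric)
  then show "D G et = D (be et) et" using g_definite by simp
qed (use rh_G in auto)

text \<open>With \<open>G = be et\<close>, \<open>Ph et _ = 0\<close> reduces [\<gamma>\<rho>A, G]
  to \<beta>\<rho>A - \<gamma> D_G \<rho>A. The D_G terms cancel, and \<gamma>KA = A -
  \<beta>\<rho>A remains to be subtracted.\<close>

lemma barthel_eq:
  assumes [simp]: "A \<in> VF"
  shows "br (ga (rh A)) G - ga (rh (br A G)) = be (rh A) + be (rh A) - A"
proof -
  have "br (ga (rh A)) G = be (rh A) - ga (D G (rh A))"
    using br_be_ga[of et "rh A"] br_anti[of "be et" "ga (rh A)"] Ph_et1 G_eq by simp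
  moreover have "rh (br A G) = D A et - D G (rh A)" using torsion_free[of A G] rh_G by simp
  moreover have "ga (D A et) = A - be (rh A)"
    unfolding eq_diff_eq by (subst (3) decompose[OF assms]) (rule add.commute)
  ultimately show ?thesis by simp
qed

end

text \<open>By torsion-freeness the difference of the two connections is symmetric and so depends on
  A only through \<rho>A. Subtracting the two metric conditions gives the equation of
  \<open>symmetric_form_eq_0\<close>, where the difference of the two K is \<open>b\<close> at
  \<open>et\<close>.\<close>

lemma (in chern_algebra) unique:
  assumes "chern_algebra VF PF FF br rh ga et act g E G T D'" and A [simp]: "A \<in> VF" and Y [simp]: "Y \<in> PF"
  shows "D A Y = D' A Y"
proof -
  interpret D': chern_algebra VF PF FF br rh ga et act g E G T D' by fact
  define b where "b X Y = D (lift X) Y - D' (lift X) Y" for X Y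
  have tor: "D A (rh B) - D' A (rh B) = D B (rh A) - D' B (rh A)" if "A \<in> VF" "B \<in> VF" for A B
    using torsion_free[OF that] D'.torsion_free[OF that] by (simp add: algebra_simps)
  have b: "D A Y - D' A Y = b (rh A) Y" if [simp]: "A \<in> VF" "Y \<in> PF" for A Y
    using tor[of A "lift Y"] tor[of "lift Y" "lift (rh A)"] by (simp add: b_def)
  have "b X Y = 0" if "X \<in> PF" "Y \<in> PF" for X Y
  proof (rule symmetric_form_eq_0[where b = b and T = T])
    show "b X Y = b Y X" if "X \<in> PF" "Y \<in> PF" for X Y
      using tor[of "lift X" "lift Y"] that by (simp add: b_def)
    fix X Y Z assume [simp]: "X \<in> PF" "Y \<in> PF" "Z \<in> PF"
    show "g (b X Y) Z + g Y (b X Z) + g (T (b X et) Y) Z + g (T (b X et) Y) Z = 0"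
      using metric[of "lift X" Y Z] D'.metric[of "lift X" Y Z] by (simp add: b_def algebra_simps)
  qed (use that in \<open>auto simp: b_def T_sym\<close>)
  then show ?thesis using b[OF A Y] by simp
qed

text \<open>K \<gamma> = 1 is an axiom here and has to be proved for the actual connection. The
  conditions on Q and T can only be stated with \<open>hor\<close> and \<open>tor\<close> and
  therefore appear as hypotheses later.\<close>

locale cartan_algebra = pullback_algebra +
  fixes C :: "'a \<Rightarrow> 'b \<Rightarrow> 'b"
  assumes C_closed [simp]: "A \<in> VF \<Longrightarrow> Y \<in> PF \<Longrightarrow> C A Y \<in> PF"
    and C_additive: "Y \<in> PF \<Longrightarrow> additive_on VF (\<lambda>A. C A Y)" "A \<in> VF \<Longrightarrow> additive_on PF (C A)"
    and C_ga [simp]: "X \<in> PF \<Longrightarrow> C (ga X) et = X"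
    and C_metric: "A \<in> VF \<Longrightarrow> Y \<in> PF \<Longrightarrow> Z \<in> PF \<Longrightarrow> act A (g Y Z) = g (C A Y) Z + g Y (C A Z)"
begin

lemmas C_simps [simp] =
  additive_onD[OF subgrps(1) C_additive(1)] additive_onD[OF subgrps(2) C_additive(2)]

definition hor :: "'b \<Rightarrow> 'a" where "hor X = lift X - ga (C (lift X) et)"

definition tor :: "'b \<Rightarrow> 'b \<Rightarrow> 'b" where "tor X Y = C (ga X) Y - rh (br (ga X) (hor Y))"

lemma hor_closed [simp]: "X \<in> PF \<Longrightarrow> hor X \<in> VF"
  and rh_hor [simp]: "X \<in> PF \<Longrightarrow> rh (hor X) = X"
  and C_hor [simp]: "X \<in> PF \<Longrightarrow> C (hor X) et = 0"
  by (auto simp: hor_def)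

lemma eq_horI:
  assumes [simp]: "A \<in> VF" and "C A et = 0"
  shows "A = hor (rh A)"
proof -
  obtain X where X: "X \<in> PF" "A - hor (rh A) = ga X" using rh_eq_0[of "A - hor (rh A)"] by auto
  then have "X = C (A - hor (rh A)) et" by simp
  then have "X = 0" using assms by simp
  then show ?thesis using X by simp
qed

lemma hor_additive: "additive_on PF hor"
  unfolding additive_on_def
proof (intro ballI)
  fix X Y assume [simp]: "X \<in> PF" "Y \<in> PF"
  show "hor (X + Y) = hor X + hor Y" using eq_horI[of "hor X + hor Y"] by simp
qed

lemmas hor_simps [simp] = additive_onD[OF subgrps(2) hor_additive]

lemma hor_decompose:
  assumes [simp]: "A \<in> VF"
  shows "A = hor (rh A) + ga (C A et)"
  using eq_horI[of "A - ga (C A et)"] by (simp add: algebra_simps)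

text \<open>T(KA, _) vanishes for horizontal A and is the full torsion for A vertical, B horizontal,
  so subtracting it removes the torsion there; Q = 0 settles two horizontal arguments. As \<nabla>
  is metric and T(KA, _) is self-adjoint, the subtraction creates the defect 2 g(T(KA, Y),
  Z).\<close>

lemma chern_algebra:
  assumes Q: "\<And>X Y. X \<in> PF \<Longrightarrow> Y \<in> PF \<Longrightarrow> C (hor X) Y - C (hor Y) X = rh (br (hor X) (hor Y))"
    and tor_sym: "\<And>X Y Z. X \<in> PF \<Longrightarrow> Y \<in> PF \<Longrightarrow> Z \<in> PF \<Longrightarrow> g (tor X Y) Z = g (tor X Z) Y"
  shows "chern_algebra VF PF FF br rh ga et act g E G tor (\<lambda>A Y. C A Y - tor (C A et) Y)"
proof
  note [simp] = tor_def
  have tor_closed: "tor X Y \<in> PF" if "X \<in> PF" "Y \<in> PF" for X Y using that by simp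
  have tor_add: "additive_on PF (\<lambda>X. tor X Y)" "additive_on PF (tor Y)" if "Y \<in> PF" for Y
    using that by (auto simp: additive_on_def)
  show "X \<in> PF \<Longrightarrow> Y \<in> PF \<Longrightarrow> tor X Y \<in> PF" for X Y by (rule tor_closed)
  show "Y \<in> PF \<Longrightarrow> additive_on PF (\<lambda>X. tor X Y)" for Y by (rule tor_add)
  show "Y \<in> PF \<Longrightarrow> additive_on PF (tor Y)" for Y by (rule tor_add)
  show "X \<in> PF \<Longrightarrow> Y \<in> PF \<Longrightarrow> Z \<in> PF \<Longrightarrow> g (tor X Y) Z = g (tor X Z) Y" for X Y Z by (rule tor_sym)
  \<comment> \<open>K \<gamma> = 1 enters here: \<open>C (ga X) et\<close> and
    \<open>rh (br (ga X) (hor et))\<close> are both \<open>X\<close>.\<close>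
  show et: "tor X et = 0" if "X \<in> PF" for X using that by (simp add: rh_br_ga)
  show "A \<in> VF \<Longrightarrow> Y \<in> PF \<Longrightarrow> C A Y - tor (C A et) Y \<in> PF" for A Y by simp
  show "Y \<in> PF \<Longrightarrow> additive_on VF (\<lambda>A. C A Y - tor (C A et) Y)" for Y by (auto simp: additive_on_def)
  show "A \<in> VF \<Longrightarrow> additive_on PF (\<lambda>Y. C A Y - tor (C A et) Y)" for A by (auto simp: additive_on_def)
  fix A assume A [simp]: "A \<in> VF"
  show "C A (rh B) - tor (C A et) (rh B) - (C B (rh A) - tor (C B et) (rh A)) = rh (br A B)"
    if B [simp]: "B \<in> VF" for B
  proof -
    define a b k l where ab: "a = rh A" "b = rh B" "k = C A et" "l = C B et"
    have [simp]: "a \<in> PF" "b \<in> PF" "k \<in> PF" "l \<in> PF" by (simp_all add: ab)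
    have AB: "A = hor a + ga k" "B = hor b + ga l" unfolding ab by (rule hor_decompose[OF A], rule hor_decompose[OF B])
    have "C A b - tor k b - (C B a - tor l a)
        = C (hor a) b - C (hor b) a + rh (br (ga k) (hor b)) - rh (br (ga l) (hor a))"
      unfolding AB by simp
    also have "\<dots> = rh (br A B)"
      unfolding AB using br_anti[of "hor a" "ga l"] by (simp add: Q rh_br_ga_ga)
    finally show ?thesis by (simp only: ab)
  qed
  fix Y Z assume [simp]: "Y \<in> PF" "Z \<in> PF"
  define k where "k = C A et"
  have [simp]: "k \<in> PF" by (simp add: k_def)
  have K: "k - tor k et = k" using et[of k] by (simp del: tor_def)
  have "act A (g Y Z) = g (C A Y) Z + g Y (C A Z)" by (rule C_metric) auto
  moreover have "g Y (tor k Z) = g (tor k Y) Z"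
    using g_sym[of Y "tor k Z"] tor_sym[of k Z Y] tor_closed[of k Z] by (simp del: tor_def)
  ultimately show "act A (g Y Z) = g (C A Y - tor (C A et) Y) Z + g Y (C A Z - tor (C A et) Z)
      + g (tor (C A et - tor (C A et) et) Y) Z + g (tor (C A et - tor (C A et) et) Y) Z"
    unfolding k_def[symmetric] K by (simp add: tor_closed del: tor_def)
qed

end

locale cartan_chern_algebra = cartan_algebra + chern_algebra where T = tor +
  assumes C_Q: "X \<in> PF \<Longrightarrow> Y \<in> PF \<Longrightarrow> C (hor X) Y - C (hor Y) X = rh (br (hor X) (hor Y))"
begin

lemma D_eq: "A \<in> VF \<Longrightarrow> Y \<in> PF \<Longrightarrow> D A Y = C A Y - tor (C A et) Y"
  using unique[OF chern_algebra[OF C_Q T_sym]] by simp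

lemma K_eq: "A \<in> VF \<Longrightarrow> D A et = C A et"
  by (simp add: D_eq)

lemma hor_eq: "X \<in> PF \<Longrightarrow> hor X = be X"
  by (simp add: hor_def be_def K_eq)

lemma curv_C_be_be: "X \<in> PF \<Longrightarrow> Y \<in> PF \<Longrightarrow> curv C (be X) (be Y) et = Rh X Y"
  by (simp add: curv_def K_eq[symmetric])

text \<open>The inner derivative of \<open>et\<close> along \<open>ga Y\<close> is \<open>Y\<close>
  for both connections, and the outer one along the horizontal \<open>be X\<close> agrees because
  T(K _, _) vanishes there.\<close>

lemma curv_C_be_ga: "X \<in> PF \<Longrightarrow> Y \<in> PF \<Longrightarrow> curv C (be X) (ga Y) et = Ph X Y"
  by (simp add: curv_def K_eq[symmetric] D_eq[of "be X" Y])

end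

section \<open>Manifolds given by atlases\<close>

text \<open>The chart conditions alone, so that the slit bundle, whose charts come from those of M,
  can be shown to be an instance too.\<close>

locale smooth_atlas =
  fixes N :: "('a, 'i, 'e::euclidean_space) atlas"
  assumes inj: "i \<in> chart_ids N \<Longrightarrow> inj_on (chart_map N i) (chart_dom N i)"
    and open_image: "i \<in> chart_ids N \<Longrightarrow> open (chart_image N i)"
    and open_overlap: "i \<in> chart_ids N \<Longrightarrow> j \<in> chart_ids N \<Longrightarrow>
        open (chart_map N i ` (chart_dom N i \<inter> chart_dom N j))"
    and smooth_transition: "i \<in> chart_ids N \<Longrightarrow> j \<in> chart_ids N \<Longrightarrow>
        smooth_on (chart_map N i ` (chart_dom N i \<inter> chart_dom N j)) (chart_map N j \<circ> chart_inv N i)"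
begin

definition overlap :: "'i \<Rightarrow> 'i \<Rightarrow> 'e set" where
  "overlap i j = chart_map N i ` (chart_dom N i \<inter> chart_dom N j)"

definition trans :: "'i \<Rightarrow> 'i \<Rightarrow> 'e \<Rightarrow> 'e" where
  "trans i j x = chart_map N j (chart_inv N i x)"

lemma trans_alt: "chart_map N j \<circ> chart_inv N i = trans i j"
  by (auto simp: trans_def)

abbreviation loc :: "'i \<Rightarrow> ('a \<Rightarrow> 'i \<Rightarrow> 'b) \<Rightarrow> 'e \<Rightarrow> 'b" where
  "loc i A \<equiv> \<lambda>x. A (chart_inv N i x) i"

lemma charts_at_iff: "i \<in> charts_at N p \<longleftrightarrow> i \<in> chart_ids N \<and> p \<in> chart_dom N i"
  by (auto simp: charts_at_def)

lemma charts_atD: "i \<in> charts_at N p \<Longrightarrow> i \<in> chart_ids N" "i \<in> charts_at N p \<Longrightarrow> p \<in> chart_dom N i"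
  by (auto simp: charts_at_iff)

lemma points_iff: "p \<in> points N \<longleftrightarrow> (\<exists>i. i \<in> charts_at N p)"
  by (auto simp: points_def charts_at_iff)

lemma inv_map [simp]: "i \<in> charts_at N p \<Longrightarrow> chart_inv N i (chart_map N i p) = p"
  using inj by (auto simp: charts_at_iff chart_inv_def)

lemma map_in_image: "i \<in> charts_at N p \<Longrightarrow> chart_map N i p \<in> chart_image N i"
  by (auto simp: charts_at_iff chart_image_def)

lemma charts_at_inv: "i \<in> chart_ids N \<Longrightarrow> x \<in> chart_image N i \<Longrightarrow> i \<in> charts_at N (chart_inv N i x)"
  by (auto simp: charts_at_iff chart_image_def chart_inv_def inv_into_into)

lemma inv_in_points: "i \<in> chart_ids N \<Longrightarrow> x \<in> chart_image N i \<Longrightarrow> chart_inv N i x \<in> points N"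
  using charts_at_inv points_iff by blast

lemma map_inv: "i \<in> chart_ids N \<Longrightarrow> x \<in> chart_image N i \<Longrightarrow> chart_map N i (chart_inv N i x) = x"
  by (auto simp: chart_image_def chart_inv_def f_inv_into_f)

lemma overlap_iff:
  "i \<in> chart_ids N \<Longrightarrow> j \<in> chart_ids N \<Longrightarrow>
     x \<in> overlap i j \<longleftrightarrow> x \<in> chart_image N i \<and> j \<in> charts_at N (chart_inv N i x)"
  using inv_map map_inv charts_at_inv unfolding overlap_def chart_image_def charts_at_iff by fastforce

lemma open_ov: "i \<in> chart_ids N \<Longrightarrow> j \<in> chart_ids N \<Longrightarrow> open (overlap i j)"
  using open_overlap by (simp add: overlap_def)

lemma smooth_trans: "i \<in> chart_ids N \<Longrightarrow> j \<in> chart_ids N \<Longrightarrow> smooth_on (overlap i j) (trans i j)"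
  using smooth_transition by (simp add: overlap_def trans_alt)

lemma map_in_overlap: "i \<in> charts_at N p \<Longrightarrow> j \<in> charts_at N p \<Longrightarrow> chart_map N i p \<in> overlap i j"
  by (auto simp: overlap_def charts_at_iff)

lemma trans_map: "i \<in> charts_at N p \<Longrightarrow> trans i j (chart_map N i p) = chart_map N j p"
  by (simp add: trans_def)

lemma inv_trans:
  "i \<in> chart_ids N \<Longrightarrow> j \<in> chart_ids N \<Longrightarrow> x \<in> overlap i j \<Longrightarrow> chart_inv N j (trans i j x) = chart_inv N i x"
  by (simp add: trans_def overlap_iff)

lemma trans_in_overlap:
  "i \<in> chart_ids N \<Longrightarrow> j \<in> chart_ids N \<Longrightarrow> x \<in> overlap i j \<Longrightarrow> trans i j x \<in> overlap j i"
  using inv_trans by (auto simp: overlap_iff charts_at_inv map_in_image trans_def)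

lemma overlap_subset: "overlap i j \<subseteq> chart_image N i"
  by (auto simp: overlap_def chart_image_def)

lemma trans_differentiable:
  "i \<in> charts_at N p \<Longrightarrow> j \<in> charts_at N p \<Longrightarrow> trans i j differentiable (at (chart_map N i p))"
  using smooth_on_differentiable[OF smooth_trans map_in_overlap] charts_atD by blast

lemma linear_fd_trans:
  "i \<in> charts_at N p \<Longrightarrow> j \<in> charts_at N p \<Longrightarrow> linear (fd (trans i j) (chart_map N i p))"
  using linear_frechet_derivative trans_differentiable by blast

lemma fd_trans_self:
  assumes "i \<in> charts_at N p" shows "fd (trans i i) (chart_map N i p) v = v"
proof -
  have "fd (trans i i) (chart_map N i p) = fd (\<lambda>x. x) (chart_map N i p)"
    using assms open_image charts_atD map_in_image by (intro fd_cong_open[of "chart_image N i"]) (auto simp: trans_def map_inv)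
  then show ?thesis by simp
qed

lemma fd_trans_compose:
  assumes "i \<in> charts_at N p" "j \<in> charts_at N p" "k \<in> charts_at N p"
  shows "fd (trans j k) (chart_map N j p) (fd (trans i j) (chart_map N i p) v) = fd (trans i k) (chart_map N i p) v"
proof -
  let ?x = "chart_map N i p"
  let ?S = "overlap i j \<inter> overlap i k"
  have "((\<lambda>x. trans j k (trans i j x)) has_derivative (\<lambda>v. fd (trans j k) (trans i j ?x) (fd (trans i j) ?x v))) (at ?x)"
    using diff_chain_at[OF has_derivative_fd[OF trans_differentiable[OF assms(1,2)]], of "trans j k"]
      has_derivative_fd[OF trans_differentiable[OF assms(2,3)]] trans_map[OF assms(1)] by (simp add: o_def)
  moreover have "fd (\<lambda>x. trans j k (trans i j x)) ?x = fd (trans i k) ?x"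
    using assms charts_atD map_in_overlap inv_trans
    by (intro fd_cong_open[of ?S]) (auto simp: open_ov trans_def[of j k] trans_def[of i k])
  ultimately show ?thesis using fd_eqI trans_map[OF assms(1)] by metis
qed

section \<open>Tangent vectors and their components\<close>

lemma tangent_space_iff: "a \<in> tangent_space N p \<longleftrightarrow> (\<forall>i. i \<notin> charts_at N p \<longrightarrow> a i = 0) \<and>
    (\<forall>i\<in>charts_at N p. \<forall>j\<in>charts_at N p. a j = fd (trans i j) (chart_map N i p) (a i))"
  by (simp add: tangent_space_def trans_alt)

lemma tangent_component:
  "a \<in> tangent_space N p \<Longrightarrow> i \<in> charts_at N p \<Longrightarrow> j \<in> charts_at N p \<Longrightarrow>
     a j = fd (trans i j) (chart_map N i p) (a i)"
  unfolding tangent_space_iff by blast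

lemma tangent_outside: "a \<in> tangent_space N p \<Longrightarrow> i \<notin> charts_at N p \<Longrightarrow> a i = 0"
  unfolding tangent_space_iff by blast

text \<open>The inverse of evaluation at the index \<open>i\<close>: it transports a chart vector to
  all charts around \<open>p\<close>.\<close>

definition tvec :: "'i \<Rightarrow> 'a \<Rightarrow> 'e \<Rightarrow> 'i \<Rightarrow> 'e" where
  "tvec i p v = (\<lambda>j. if j \<in> charts_at N p then fd (trans i j) (chart_map N i p) v else 0)"

lemma tvec_in: "i \<in> charts_at N p \<Longrightarrow> tvec i p v \<in> tangent_space N p"
  unfolding tangent_space_iff by (auto simp: tvec_def fd_trans_compose)

lemma tvec_self [simp]: "i \<in> charts_at N p \<Longrightarrow> tvec i p v i = v"
  by (simp add: tvec_def fd_trans_self)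

lemma tangent_eqI:
  assumes "a \<in> tangent_space N p" "b \<in> tangent_space N p" "i \<in> charts_at N p" "a i = b i"
  shows "a = b"
proof
  fix j show "a j = b j"
  proof (cases "j \<in> charts_at N p")
    case True
    show ?thesis
      unfolding tangent_component[OF assms(1,3) True] tangent_component[OF assms(2,3) True] assms(4) ..
  qed (simp add: tangent_outside[OF assms(1)] tangent_outside[OF assms(2)])
qed

lemma tvec_eq: "a \<in> tangent_space N p \<Longrightarrow> i \<in> charts_at N p \<Longrightarrow> tvec i p (a i) = a"
  by (rule tangent_eqI[OF tvec_in]) auto

lemma tangent_spaceI:
  assumes "i \<in> charts_at N p" "\<And>j. j \<in> charts_at N p \<Longrightarrow> a j = fd (trans i j) (chart_map N i p) (a i)"
    "\<And>j. j \<notin> charts_at N p \<Longrightarrow> a j = 0"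
  shows "a \<in> tangent_space N p"
proof -
  have "a j = tvec i p (a i) j" for j
    using assms(2)[of j] assms(3)[of j] unfolding tvec_def by argo
  then have "a = tvec i p (a i)" by blast
  then show ?thesis using tvec_in assms(1) by metis
qed

lemma tangent_zero: "0 \<in> tangent_space N p"
  and tangent_add: "a \<in> tangent_space N p \<Longrightarrow> b \<in> tangent_space N p \<Longrightarrow> a + b \<in> tangent_space N p"
  and tangent_scale: "a \<in> tangent_space N p \<Longrightarrow> r \<odot> a \<in> tangent_space N p"
proof -
  show "0 \<in> tangent_space N p"
    unfolding tangent_space_iff by (auto simp: linear_0[OF linear_fd_trans])
  have *: "a j = fd (trans i j) (chart_map N i p) (a i)"
    if "a \<in> tangent_space N p" "i \<in> charts_at N p" "j \<in> charts_at N p" for a i j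
    using tangent_component that by blast
  show "a + b \<in> tangent_space N p" if a: "a \<in> tangent_space N p" and b: "b \<in> tangent_space N p"
    unfolding tangent_space_iff
  proof (intro conjI allI impI ballI)
    fix i j assume i: "i \<in> charts_at N p" and j: "j \<in> charts_at N p"
    show "(a + b) j = fd (trans i j) (chart_map N i p) ((a + b) i)"
      by (simp only: plus_fun_apply linear_add[OF linear_fd_trans[OF i j]] *[OF a i j] *[OF b i j])
  qed (simp add: tangent_outside[OF a] tangent_outside[OF b])
  show "r \<odot> a \<in> tangent_space N p" if a: "a \<in> tangent_space N p"
    unfolding tangent_space_iff vscale_def
  proof (intro conjI allI impI ballI)
    fix i j assume i: "i \<in> charts_at N p" and j: "j \<in> charts_at N p"
    show "r *\<^sub>R a j = fd (trans i j) (chart_map N i p) (r *\<^sub>R a i)"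
      by (simp only: linear_scale[OF linear_fd_trans[OF i j]] *[OF a i j])
  qed (simp add: tangent_outside[OF a])
qed

lemma tangent_uminus: "a \<in> tangent_space N p \<Longrightarrow> - a \<in> tangent_space N p"
  using tangent_scale[of a p "-1"] by (simp add: vscale_def fun_Compl_def)

lemma tangent_diff: "a \<in> tangent_space N p \<Longrightarrow> b \<in> tangent_space N p \<Longrightarrow> a - b \<in> tangent_space N p"
  using tangent_add[of a p "- b"] tangent_uminus[of b p] by simp

lemma vector_fieldD:
  assumes "vector_field N A"
  shows "p \<in> points N \<Longrightarrow> A p \<in> tangent_space N p"
    and "i \<in> chart_ids N \<Longrightarrow> smooth_on (chart_image N i) (loc i A)"
    and "i \<in> charts_at N p \<Longrightarrow> loc i A differentiable (at (chart_map N i p))"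
  using assms smooth_on_differentiable[of "chart_image N i" "loc i A"] charts_atD map_in_image
  unfolding vector_field_def by blast+

lemma loc_trans:
  assumes "\<forall>p\<in>points N. A p \<in> tangent_space N p" "i \<in> chart_ids N" "j \<in> chart_ids N" "x \<in> overlap i j"
  shows "loc j A (trans i j x) = fd (trans i j) x (loc i A x)"
proof -
  let ?p = "chart_inv N i x"
  have i: "i \<in> charts_at N ?p" and j: "j \<in> charts_at N ?p"
    using assms by (simp_all add: overlap_iff charts_at_inv)
  have "x \<in> chart_image N i" using overlap_subset assms(4) by blast
  then have x: "chart_map N i ?p = x" by (rule map_inv[OF assms(2)])
  have "?p \<in> points N" using i points_iff by blast
  then have "A ?p j = fd (trans i j) (chart_map N i ?p) (A ?p i)"
    by (intro tangent_component[OF _ i j] assms(1)[rule_format])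
  then show ?thesis by (simp only: inv_trans[OF assms(2-4)] x)
qed

section \<open>Derivatives of functions\<close>

lemma some_chart: "p \<in> points N \<Longrightarrow> some_chart N p \<in> charts_at N p"
  unfolding some_chart_def points_iff by (rule someI_ex)

text \<open>\<open>dfun\<close> is defined through an arbitrarily selected chart; the chain rule
  along the transition from that chart, together with the transformation law of \<open>a\<close>,
  gives the same value in every chart.\<close>

lemma dfun_chart:
  assumes i: "i \<in> charts_at N p" and a: "a \<in> tangent_space N p"
    and f: "(\<lambda>x. f (chart_inv N i x)) differentiable (at (chart_map N i p))"
  shows "dfun N f p a = fd (\<lambda>x. f (chart_inv N i x)) (chart_map N i p) (a i)"
proof -
  define k where "k = some_chart N p"
  have k: "k \<in> charts_at N p" unfolding k_def using some_chart i points_iff by blast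
  let ?x = "chart_map N k p"
  note ids = charts_atD(1)[OF i] charts_atD(1)[OF k]
  have "((\<lambda>x. f (chart_inv N i (trans k i x))) has_derivative
      (\<lambda>v. fd (\<lambda>x. f (chart_inv N i x)) (trans k i ?x) (fd (trans k i) ?x v))) (at ?x)"
    using diff_chain_at[OF has_derivative_fd[OF trans_differentiable[OF k i]], of "\<lambda>x. f (chart_inv N i x)"]
      has_derivative_fd[OF f] trans_map[OF k] by (simp add: o_def)
  moreover have "fd (\<lambda>x. f (chart_inv N i (trans k i x))) ?x = fd (f \<circ> chart_inv N k) ?x"
    using ids map_in_overlap[OF k i] by (intro fd_cong_open[of "overlap k i"]) (auto simp: open_ov inv_trans)
  ultimately have "fd (f \<circ> chart_inv N k) ?x v = fd (\<lambda>x. f (chart_inv N i x)) (chart_map N i p) (fd (trans k i) ?x v)" for v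
    using fd_eqI trans_map[OF k] by metis
  then show ?thesis using tangent_component[OF a k i] by (simp add: dfun_def k_def Let_def)
qed

lemma smooth_functionD:
  assumes "smooth_function N f"
  shows "i \<in> chart_ids N \<Longrightarrow> smooth_on (chart_image N i) (\<lambda>x. f (chart_inv N i x))"
    and "i \<in> charts_at N p \<Longrightarrow> (\<lambda>x. f (chart_inv N i x)) differentiable (at (chart_map N i p))"
  using assms smooth_on_differentiable[of "chart_image N i" "\<lambda>x. f (chart_inv N i x)"] charts_atD map_in_image
  unfolding smooth_function_def o_def by blast+

lemma smooth_functionI:
  "(\<And>i. i \<in> chart_ids N \<Longrightarrow> smooth_on (chart_image N i) (\<lambda>x. f (chart_inv N i x))) \<Longrightarrow> smooth_function N f"
  unfolding smooth_function_def o_def by blast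

lemma dfun_cong:
  assumes "\<And>q. q \<in> points N \<Longrightarrow> f q = f' q" "p \<in> points N"
  shows "dfun N f p a = dfun N f' p a"
proof -
  let ?i = "some_chart N p"
  have i: "?i \<in> charts_at N p" using some_chart assms(2) .
  have "fd (f \<circ> chart_inv N ?i) (chart_map N ?i p) = fd (f' \<circ> chart_inv N ?i) (chart_map N ?i p)"
    using i open_image map_in_image charts_atD assms(1) inv_in_points
    by (intro fd_cong_open[of "chart_image N ?i"]) auto
  then show ?thesis by (simp add: dfun_def Let_def)
qed

lemma dfun_add_vector:
  assumes "smooth_function N f" "p \<in> points N" "a \<in> tangent_space N p" "b \<in> tangent_space N p"
  shows "dfun N f p (a + b) = dfun N f p a + dfun N f p b"
proof -
  obtain i where i: "i \<in> charts_at N p" using assms(2) points_iff by blast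
  note d = smooth_functionD(2)[OF assms(1) i]
  show ?thesis using linear_add[OF linear_frechet_derivative[OF d]]
    by (simp add: dfun_chart[OF i _ d] assms tangent_add)
qed

lemma dfun_add_fun:
  assumes "smooth_function N f" "smooth_function N f'" "p \<in> points N" "a \<in> tangent_space N p"
  shows "dfun N (\<lambda>q. f q + f' q) p a = dfun N f p a + dfun N f' p a"
proof -
  obtain i where i: "i \<in> charts_at N p" using assms(3) points_iff by blast
  note d = smooth_functionD(2)[OF assms(1) i] smooth_functionD(2)[OF assms(2) i]
  note h = has_derivative_add[OF has_derivative_fd[OF d(1)] has_derivative_fd[OF d(2)]]
  show ?thesis
    using fd_eqI[OF h] dfun_chart[OF i assms(4) d(1)] dfun_chart[OF i assms(4) d(2)]
      dfun_chart[OF i assms(4) differentiableI[OF h]] by simp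
qed

lemma smooth_dfun:
  assumes "smooth_function N f" "vector_field N A"
  shows "smooth_function N (\<lambda>p. dfun N f p (A p))"
proof (rule smooth_functionI)
  fix i assume i: "i \<in> chart_ids N"
  note oi = open_image[OF i]
  show "smooth_on (chart_image N i) (\<lambda>x. dfun N f (chart_inv N i x) (A (chart_inv N i x)))"
  proof (rule smooth_on_cong[OF oi])
    show "smooth_on (chart_image N i) (\<lambda>x. fd (\<lambda>x. f (chart_inv N i x)) x (loc i A x))"
      using smooth_on_fd_apply[OF oi oi, of "\<lambda>x. x"] smooth_functionD(1)[OF assms(1) i]
        vector_fieldD(2)[OF assms(2) i] smooth_on_linear[OF bounded_linear_ident oi] by simp
    fix x assume x: "x \<in> chart_image N i"
    note c = charts_at_inv[OF i x]
    show "fd (\<lambda>x. f (chart_inv N i x)) x (loc i A x) = dfun N f (chart_inv N i x) (A (chart_inv N i x))"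
      using dfun_chart[OF c _ smooth_functionD(2)[OF assms(1) c], of "A (chart_inv N i x)"]
        vector_fieldD(1)[OF assms(2)] inv_in_points[OF i x] by (simp add: map_inv[OF i x])
  qed
qed

section \<open>The Lie bracket in charts\<close>

lemma bracket_chart:
  "i \<in> charts_at N p \<Longrightarrow> bracket N A B p i =
     fd (loc i B) (chart_map N i p) (A p i) - fd (loc i A) (chart_map N i p) (B p i)"
  by (simp add: bracket_def)

lemma loc_bracket:
  "i \<in> chart_ids N \<Longrightarrow> x \<in> chart_image N i \<Longrightarrow>
     loc i (bracket N A B) x = fd (loc i B) x (loc i A x) - fd (loc i A) x (loc i B x)"
  using bracket_chart[OF charts_at_inv] map_inv by simp

lemma smooth_loc_fd:
  assumes "i \<in> chart_ids N" "smooth_on (chart_image N i) f" "smooth_on (chart_image N i) v"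
  shows "smooth_on (chart_image N i) (\<lambda>x. fd f x (v x))"
  using smooth_on_fd_apply[OF open_image[OF assms(1)] open_image[OF assms(1)] _ assms(2)
      smooth_on_linear[OF bounded_linear_ident open_image[OF assms(1)]] assms(3)] by simp

text \<open>The transformation law of B differentiated along A. The first summand, a second
  derivative of the transition map, is what makes the derivative of a vector field
  chart-dependent.\<close>

lemma fd_loc_trans:
  assumes A: "vector_field N A" and B: "vector_field N B" and i: "i \<in> charts_at N p" and j: "j \<in> charts_at N p"
  shows "fd (loc j B) (chart_map N j p) (A p j)
    = fd (\<lambda>x. fd (trans i j) x (B p i)) (chart_map N i p) (A p i)
      + fd (trans i j) (chart_map N i p) (fd (loc i B) (chart_map N i p) (A p i))"
proof -
  let ?x = "chart_map N i p"
  note ids = charts_atD(1)[OF i] charts_atD(1)[OF j]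
  have p: "p \<in> points N" using i points_iff by blast
  have "((\<lambda>x. loc j B (trans i j x)) has_derivative (\<lambda>v. fd (loc j B) (trans i j ?x) (fd (trans i j) ?x v))) (at ?x)"
    using diff_chain_at[OF has_derivative_fd[OF trans_differentiable[OF i j]], of "loc j B"]
      has_derivative_fd[OF vector_fieldD(3)[OF B j]] trans_map[OF i] by (simp add: o_def)
  then have "fd (\<lambda>x. loc j B (trans i j x)) ?x (A p i) = fd (loc j B) (chart_map N j p) (A p j)"
    using tangent_component[OF vector_fieldD(1)[OF A p] i j] trans_map[OF i] by (simp add: fd_eqI)
  moreover have "fd (\<lambda>x. loc j B (trans i j x)) ?x = fd (\<lambda>x. fd (trans i j) x (loc i B x)) ?x"
    using ids map_in_overlap[OF i j] vector_fieldD(1)[OF B]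
    by (intro fd_cong_open[of "overlap i j"]) (auto simp: open_ov loc_trans)
  moreover have "fd (\<lambda>x. fd (trans i j) x (loc i B x)) ?x
      = (\<lambda>h. fd (\<lambda>x. fd (trans i j) x (loc i B ?x)) ?x h + fd (trans i j) ?x (fd (loc i B) ?x h))"
    using fd_fd_apply_has_derivative[OF open_ov[OF ids] map_in_overlap[OF i j] smooth_trans[OF ids]
        has_derivative_fd[OF vector_fieldD(3)[OF B i]]] by (rule fd_eqI)
  ultimately show ?thesis using i by simp
qed

lemma bracket_vector_field:
  assumes A: "vector_field N A" and B: "vector_field N B"
  shows "vector_field N (bracket N A B)"
  unfolding vector_field_def
proof (intro conjI ballI)
  fix p assume p: "p \<in> points N"
  then obtain i where i: "i \<in> charts_at N p" using points_iff by blast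
  show "bracket N A B p \<in> tangent_space N p"
  proof (rule tangent_spaceI[OF i])
    fix j assume j: "j \<in> charts_at N p"
    note ids = charts_atD(1)[OF i] charts_atD(1)[OF j]
    \<comment> \<open>The chart-dependent term is symmetric in A and B and drops out of the
      bracket.\<close>
    have "fd (\<lambda>x. fd (trans i j) x (B p i)) (chart_map N i p) (A p i)
        = fd (\<lambda>x. fd (trans i j) x (A p i)) (chart_map N i p) (B p i)"
      by (rule fd_fd_commute[OF open_ov[OF ids] map_in_overlap[OF i j] smooth_trans[OF ids]])
    then show "bracket N A B p j = fd (trans i j) (chart_map N i p) (bracket N A B p i)"
      using fd_loc_trans[OF A B i j] fd_loc_trans[OF B A i j]
      by (simp add: bracket_chart i j linear_diff[OF linear_fd_trans[OF i j]])
  qed (simp add: bracket_def)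
next
  fix i assume i: "i \<in> chart_ids N"
  note oi = open_image[OF i]
  show "smooth_on (chart_image N i) (loc i (bracket N A B))"
    by (rule smooth_on_cong[OF oi, of "\<lambda>x. fd (loc i B) x (loc i A x) - fd (loc i A) x (loc i B x)"])
      (intro smooth_on_diff oi smooth_loc_fd i vector_fieldD(2) A B,
        simp add: loc_bracket[OF i])
qed

lemma bracket_cong:
  assumes "\<And>q. q \<in> points N \<Longrightarrow> A q = A' q" "\<And>q. q \<in> points N \<Longrightarrow> B q = B' q"
  shows "bracket N A B p = bracket N A' B' p"
proof
  fix i
  show "bracket N A B p i = bracket N A' B' p i"
  proof (cases "i \<in> charts_at N p")
    case True
    have *: "fd (loc i A) (chart_map N i p) = fd (loc i A') (chart_map N i p)"
      if "\<And>q. q \<in> points N \<Longrightarrow> A q = A' q" for A A' :: "'a \<Rightarrow> 'i \<Rightarrow> 'e"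
      using True open_image map_in_image charts_atD that inv_in_points
      by (intro fd_cong_open[of "chart_image N i"]) auto
    have "p \<in> points N" using True points_iff by blast
    then show ?thesis
      by (simp only: bracket_chart[OF True] *[of A A', OF assms(1)] *[of B B', OF assms(2)] assms)
  qed (simp add: bracket_def)
qed

lemma bracket_add1:
  assumes "vector_field N A" "vector_field N A'" "vector_field N B"
  shows "bracket N (A + A') B = bracket N A B + bracket N A' B"
proof (intro ext)
  fix p i
  show "bracket N (A + A') B p i = (bracket N A B + bracket N A' B) p i"
  proof (cases "i \<in> charts_at N p")
    case True
    note d = vector_fieldD(3)[OF assms(1) True] vector_fieldD(3)[OF assms(2) True] vector_fieldD(3)[OF assms(3) True]
    have "fd (loc i (A + A')) (chart_map N i p) v = fd (loc i A) (chart_map N i p) v + fd (loc i A') (chart_map N i p) v" for v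
      using fd_eqI[OF has_derivative_add[OF has_derivative_fd[OF d(1)] has_derivative_fd[OF d(2)]]] by simp
    then show ?thesis using linear_add[OF linear_frechet_derivative[OF d(3)]] True by (simp add: bracket_chart)
  qed (simp add: bracket_def)
qed

lemma bracket_anti: "bracket N B A = - bracket N A B"
  by (intro ext) (simp add: bracket_def)

text \<open>In a chart each double bracket consists of second derivatives and of compositions of
  first derivatives. Over the cyclic sum the compositions cancel identically, the second derivatives
  by their symmetry.\<close>

lemma bracket_jacobi:
  assumes A: "vector_field N A" and B: "vector_field N B" and C: "vector_field N C"
  shows "bracket N A (bracket N B C) + bracket N B (bracket N C A) + bracket N C (bracket N A B) = 0"
proof (intro ext)
  fix p i
  show "(bracket N A (bracket N B C) + bracket N B (bracket N C A) + bracket N C (bracket N A B)) p i = (0::'a \<Rightarrow> 'i \<Rightarrow> 'e) p i"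
  proof (cases "i \<in> charts_at N p")
    case True
    let ?x = "chart_map N i p"
    note i = charts_atD(1)[OF True]
    note oi = open_image[OF i] and x = map_in_image[OF True]
    have *: "bracket N A (bracket N B C) p i
        = (fd (\<lambda>x. fd (loc i C) x (B p i)) ?x (A p i) + fd (loc i C) ?x (fd (loc i B) ?x (A p i)))
        - (fd (\<lambda>x. fd (loc i B) x (C p i)) ?x (A p i) + fd (loc i B) ?x (fd (loc i C) ?x (A p i)))
        - (fd (loc i A) ?x (fd (loc i C) ?x (B p i)) - fd (loc i A) ?x (fd (loc i B) ?x (C p i)))"
      if A: "vector_field N A" and B: "vector_field N B" and C: "vector_field N C" for A B C
    proof -
      note d = fd_fd_apply_has_derivative[OF oi x vector_fieldD(2)[OF _ i] has_derivative_fd[OF vector_fieldD(3)[OF _ True]]]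
      have "fd (loc i (bracket N B C)) ?x = fd (\<lambda>x. fd (loc i C) x (loc i B x) - fd (loc i B) x (loc i C x)) ?x"
        by (rule fd_cong_open[OF oi x]) (simp add: loc_bracket[OF i])
      also have "\<dots> = (\<lambda>h. (fd (\<lambda>x. fd (loc i C) x (loc i B ?x)) ?x h + fd (loc i C) ?x (fd (loc i B) ?x h))
         - (fd (\<lambda>x. fd (loc i B) x (loc i C ?x)) ?x h + fd (loc i B) ?x (fd (loc i C) ?x h)))"
        by (rule fd_eqI[OF has_derivative_diff[OF d[OF C B] d[OF B C]]])
      finally show ?thesis
        using True linear_diff[OF linear_frechet_derivative[OF vector_fieldD(3)[OF A True]]]
        by (simp add: bracket_chart)
    qed
    have s: "fd (\<lambda>x. fd (loc i A) x v) ?x w = fd (\<lambda>x. fd (loc i A) x w) ?x v" if "vector_field N A" for A v w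
      by (rule fd_fd_commute[OF oi x vector_fieldD(2)[OF that i]])
    show ?thesis
      using s[OF A, of "B p i" "C p i"] s[OF B, of "A p i" "C p i"] s[OF C, of "A p i" "B p i"]
      by (simp add: *[OF A B C] *[OF B C A] *[OF C A B])
  qed (simp add: bracket_def)
qed

lemma dfun_bracket:
  assumes A: "vector_field N A" and B: "vector_field N B" and f: "smooth_function N f" and p: "p \<in> points N"
  shows "dfun N f p (bracket N A B p)
    = dfun N (\<lambda>q. dfun N f q (B q)) p (A p) - dfun N (\<lambda>q. dfun N f q (A q)) p (B p)"
proof -
  obtain i where i: "i \<in> charts_at N p" using p points_iff by blast
  let ?x = "chart_map N i p" and ?f = "\<lambda>x. f (chart_inv N i x)"
  note ids = charts_atD(1)[OF i]
  note oi = open_image[OF ids] and x = map_in_image[OF i]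
  have *: "dfun N (\<lambda>q. dfun N f q (B q)) p (A p) = fd (\<lambda>x. fd ?f x (B p i)) ?x (A p i) + fd ?f ?x (fd (loc i B) ?x (A p i))"
    if A: "vector_field N A" and B: "vector_field N B" for A B
  proof -
    have "dfun N (\<lambda>q. dfun N f q (B q)) p (A p) = fd (\<lambda>x. dfun N f (chart_inv N i x) (B (chart_inv N i x))) ?x (A p i)"
      by (rule dfun_chart[OF i vector_fieldD(1)[OF A p] smooth_functionD(2)[OF smooth_dfun[OF f B] i]])
    also have "fd (\<lambda>x. dfun N f (chart_inv N i x) (B (chart_inv N i x))) ?x = fd (\<lambda>x. fd ?f x (loc i B x)) ?x"
    proof (rule fd_cong_open[OF oi x])
      fix y assume y: "y \<in> chart_image N i"
      note c = charts_at_inv[OF ids y]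
      show "dfun N f (chart_inv N i y) (B (chart_inv N i y)) = fd ?f y (loc i B y)"
        using dfun_chart[OF c vector_fieldD(1)[OF B inv_in_points[OF ids y]] smooth_functionD(2)[OF f c]]
        by (simp add: map_inv[OF ids y])
    qed
    also have "\<dots> = (\<lambda>h. fd (\<lambda>x. fd ?f x (loc i B ?x)) ?x h + fd ?f ?x (fd (loc i B) ?x h))"
      by (rule fd_eqI[OF fd_fd_apply_has_derivative[OF oi x smooth_functionD(1)[OF f ids] has_derivative_fd[OF vector_fieldD(3)[OF B i]]]])
    finally show ?thesis using i by simp
  qed
  have "fd (\<lambda>x. fd ?f x (B p i)) ?x (A p i) = fd (\<lambda>x. fd ?f x (A p i)) ?x (B p i)"
    by (rule fd_fd_commute[OF oi x smooth_functionD(1)[OF f ids]])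
  moreover have "dfun N f p (bracket N A B p) = fd ?f ?x (bracket N A B p i)"
    by (rule dfun_chart[OF i vector_fieldD(1)[OF bracket_vector_field[OF A B] p] smooth_functionD(2)[OF f i]])
  ultimately show ?thesis
    using linear_diff[OF linear_frechet_derivative[OF smooth_functionD(2)[OF f i]]]
    by (simp add: *[OF A B] *[OF B A] bracket_chart i)
qed

lemma vector_field_diff: "vector_field N A \<Longrightarrow> vector_field N B \<Longrightarrow> vector_field N (A - B)"
  unfolding vector_field_def using open_image by (auto intro: tangent_diff smooth_on_diff)

lemma vector_field_cong:
  assumes "vector_field N A" "\<And>p. p \<in> points N \<Longrightarrow> A p = B p"
  shows "vector_field N B"
  unfolding vector_field_def
proof (intro conjI ballI)
  fix i assume i: "i \<in> chart_ids N"
  show "smooth_on (chart_image N i) (loc i B)"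
    using smooth_on_cong[OF open_image[OF i] vector_fieldD(2)[OF assms(1) i]] assms(2) inv_in_points[OF i] by simp
qed (use assms vector_fieldD(1) in metis)

end

section \<open>The slit tangent bundle\<close>

lemma slit_simps [simp]:
  "chart_ids (slit M) = chart_ids M"
  "chart_dom (slit M) i = {(p, y). p \<in> chart_dom M i \<and> y \<in> tangent_space M p \<and> y \<noteq> 0}"
  "chart_map (slit M) i u = (chart_map M i (fst u), snd u i)"
  by (auto simp: slit_def split_beta)

lemma vscale_apply [simp]: "(r \<odot> a) i = r *\<^sub>R a i"
  by (simp add: vscale_def)

locale slit_bundle = base: smooth_atlas M for M :: "('a, 'i, 'e::euclidean_space) atlas"
begin

lemma slit_points_iff: "u \<in> points (slit M) \<longleftrightarrow> fst u \<in> points M \<and> snd u \<in> tangent_space M (fst u) \<and> snd u \<noteq> 0"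
  by (cases u) (auto simp: points_def)

lemma charts_at_slit: "u \<in> points (slit M) \<Longrightarrow> charts_at (slit M) u = charts_at M (fst u)"
  by (cases u) (auto simp: charts_at_def points_def)

lemma charts_at_slit_outside: "u \<notin> points (slit M) \<Longrightarrow> charts_at (slit M) u = {}"
  by (auto simp: charts_at_def points_def)

lemma tangent_component_nonzero:
  assumes "y \<in> tangent_space M p" "y \<noteq> 0" "i \<in> charts_at M p"
  shows "y i \<noteq> 0"
proof
  assume "y i = 0"
  then have "y = 0" by (intro base.tangent_eqI[OF assms(1) base.tangent_zero assms(3)]) simp
  then show False using assms(2) by simp
qed

lemma slit_inj:
  assumes i: "i \<in> chart_ids M" shows "inj_on (chart_map (slit M) i) (chart_dom (slit M) i)"
proof (rule inj_onI)
  fix u w assume u: "u \<in> chart_dom (slit M) i" and w: "w \<in> chart_dom (slit M) i"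
    and eq: "chart_map (slit M) i u = chart_map (slit M) i w"
  have "fst u \<in> chart_dom M i" "fst w \<in> chart_dom M i" "chart_map M i (fst u) = chart_map M i (fst w)"
    using u w eq by (auto simp: split_beta)
  then have f: "fst u = fst w" using base.inj[OF i] by (auto dest: inj_onD)
  have "snd u = snd w"
    using u w eq i f by (intro base.tangent_eqI[of _ "fst u" _ i]) (auto simp: base.charts_at_iff split_beta)
  then show "u = w" using f by (simp add: prod_eq_iff)
qed

lemma lift_in_slit_dom:
  assumes "i \<in> charts_at M p" "v \<noteq> 0"
  shows "(p, base.tvec i p v) \<in> chart_dom (slit M) i" "(p, base.tvec i p v) \<in> points (slit M)"
proof -
  have "base.tvec i p v \<noteq> 0" using base.tvec_self[OF assms(1), of v] assms(2) by (metis zero_fun_apply)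
  then show "(p, base.tvec i p v) \<in> chart_dom (slit M) i"
    using assms base.tvec_in[OF assms(1)] by (auto simp: base.charts_at_iff)
  then show "(p, base.tvec i p v) \<in> points (slit M)"
    using base.charts_atD(1)[OF assms(1)] unfolding points_def by auto
qed

lemma slit_image:
  assumes i: "i \<in> chart_ids M"
  shows "chart_image (slit M) i = chart_image M i \<times> (UNIV - {0})"
proof (rule set_eqI, rule iffI)
  fix z :: "'e \<times> 'e" assume "z \<in> chart_image (slit M) i"
  then obtain u where u: "u \<in> chart_dom (slit M) i" "z = chart_map (slit M) i u" by (auto simp: chart_image_def)
  then have "i \<in> charts_at M (fst u)" using i by (auto simp: base.charts_at_iff)
  then show "z \<in> chart_image M i \<times> (UNIV - {0})"
    using u tangent_component_nonzero[of "snd u" "fst u" i] by (auto simp: base.map_in_image split_beta)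
next
  fix z :: "'e \<times> 'e" assume z: "z \<in> chart_image M i \<times> (UNIV - {0})"
  define p where "p = chart_inv M i (fst z)"
  have p: "i \<in> charts_at M p" "chart_map M i p = fst z"
    using base.charts_at_inv[OF i] base.map_inv[OF i] z by (auto simp: p_def)
  have "chart_map (slit M) i (p, base.tvec i p (snd z)) = z" using p by simp
  then show "z \<in> chart_image (slit M) i"
    unfolding chart_image_def using lift_in_slit_dom(1)[OF p(1), of "snd z"] z by (metis DiffE SigmaE image_eqI insertI1 snd_conv)
qed

lemma slit_inv:
  assumes i: "i \<in> chart_ids M" and z: "z \<in> chart_image (slit M) i"
  shows "chart_inv (slit M) i z = (chart_inv M i (fst z), base.tvec i (chart_inv M i (fst z)) (snd z))"
proof -
  define p where "p = chart_inv M i (fst z)"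
  have p: "i \<in> charts_at M p" "chart_map M i p = fst z" "snd z \<noteq> 0"
    using base.charts_at_inv[OF i] base.map_inv[OF i] z slit_image[OF i] by (auto simp: p_def)
  have "chart_map (slit M) i (p, base.tvec i p (snd z)) = z" using p by simp
  then show ?thesis unfolding chart_inv_def
    using inv_into_f_eq[OF slit_inj[OF i] lift_in_slit_dom(1)[OF p(1,3)]] by (simp add: p_def chart_inv_def)
qed

lemma slit_overlap:
  assumes i: "i \<in> chart_ids M" and j: "j \<in> chart_ids M"
  shows "chart_map (slit M) i ` (chart_dom (slit M) i \<inter> chart_dom (slit M) j) = base.overlap i j \<times> (UNIV - {0})"
proof (rule set_eqI, rule iffI)
  fix z :: "'e \<times> 'e" assume "z \<in> chart_map (slit M) i ` (chart_dom (slit M) i \<inter> chart_dom (slit M) j)"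
  then obtain u where u: "u \<in> chart_dom (slit M) i" "u \<in> chart_dom (slit M) j" "z = chart_map (slit M) i u" by auto
  then have "i \<in> charts_at M (fst u)" "j \<in> charts_at M (fst u)" using i j by (auto simp: base.charts_at_iff)
  then show "z \<in> base.overlap i j \<times> (UNIV - {0})"
    using u tangent_component_nonzero[of "snd u" "fst u" i] by (auto simp: base.map_in_overlap split_beta)
next
  fix z :: "'e \<times> 'e" assume z: "z \<in> base.overlap i j \<times> (UNIV - {0})"
  define p where "p = chart_inv M i (fst z)"
  have x: "fst z \<in> chart_image M i" "j \<in> charts_at M p" "snd z \<noteq> 0"
    using z i j by (auto simp: base.overlap_iff p_def)
  have p: "i \<in> charts_at M p" "chart_map M i p = fst z"
    using base.charts_at_inv[OF i] base.map_inv[OF i] x by (auto simp: p_def)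
  let ?u = "(p, base.tvec i p (snd z))"
  have u: "chart_map (slit M) i ?u = z" using p by simp
  have "?u \<in> chart_dom (slit M) i" by (rule lift_in_slit_dom(1)[OF p(1) x(3)])
  moreover then have "?u \<in> chart_dom (slit M) j" using x(2) by (auto simp: base.charts_at_iff)
  ultimately show "z \<in> chart_map (slit M) i ` (chart_dom (slit M) i \<inter> chart_dom (slit M) j)"
    by (intro image_eqI[where f = "chart_map (slit M) i" and x = ?u, OF u[symmetric]] IntI)
qed

lemma slit_trans:
  assumes i: "i \<in> chart_ids M" and j: "j \<in> chart_ids M" and z: "z \<in> base.overlap i j \<times> (UNIV - {0})"
  shows "chart_map (slit M) j (chart_inv (slit M) i z) = (base.trans i j (fst z), fd (base.trans i j) (fst z) (snd z))"
proof -
  have o: "fst z \<in> base.overlap i j" using z by auto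
  then have x: "fst z \<in> chart_image M i" "j \<in> charts_at M (chart_inv M i (fst z))"
    unfolding base.overlap_iff[OF i j] by simp_all
  then have "z \<in> chart_image (slit M) i"
    unfolding slit_image[OF i] using z by (simp add: mem_Times_iff)
  then have "chart_map (slit M) j (chart_inv (slit M) i z)
      = (chart_map M j (chart_inv M i (fst z)), base.tvec i (chart_inv M i (fst z)) (snd z) j)"
    by (simp only: slit_inv[OF i] slit_simps(3) fst_conv snd_conv)
  also have "\<dots> = (base.trans i j (fst z), fd (base.trans i j) (fst z) (snd z))"
    by (simp only: base.tvec_def x(2) if_True base.map_inv[OF i x(1)] base.trans_def)
  finally show ?thesis .
qed

lemma smooth_slit_trans:
  assumes i: "i \<in> chart_ids M" and j: "j \<in> chart_ids M"
  shows "smooth_on (base.overlap i j \<times> (UNIV - {0})) (\<lambda>z. (base.trans i j (fst z), fd (base.trans i j) (fst z) (snd z)))"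
proof -
  note o = base.open_ov[OF i j]
  have S: "open (base.overlap i j \<times> (UNIV - {0::'e}))" by (intro open_Times o) auto
  note lin = smooth_on_linear[OF bounded_linear_fst S] smooth_on_linear[OF bounded_linear_snd S]
  show ?thesis
    by (intro smooth_on_Pair S smooth_on_compose[OF S o _ base.smooth_trans[OF i j]]
        smooth_on_fd_apply[OF S o _ base.smooth_trans[OF i j]] lin) auto
qed

end

sublocale slit_bundle \<subseteq> slit: smooth_atlas "slit M"
proof
  fix i assume "i \<in> chart_ids (slit M)"
  then have i: "i \<in> chart_ids M" by simp
  show "inj_on (chart_map (slit M) i) (chart_dom (slit M) i)" by (rule slit_inj[OF i])
  show "open (chart_image (slit M) i)"
    unfolding slit_image[OF i] by (intro open_Times base.open_image[OF i] open_delete open_UNIV)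
  fix j assume "j \<in> chart_ids (slit M)"
  then have j: "j \<in> chart_ids M" by simp
  note o = base.open_ov[OF i j]
  have S: "open (base.overlap i j \<times> (UNIV - {0::'e}))" by (intro open_Times o) auto
  then show "open (chart_map (slit M) i ` (chart_dom (slit M) i \<inter> chart_dom (slit M) j))"
    unfolding slit_overlap[OF i j] .
  show "smooth_on (chart_map (slit M) i ` (chart_dom (slit M) i \<inter> chart_dom (slit M) j))
     (chart_map (slit M) j \<circ> chart_inv (slit M) i)"
    unfolding slit_overlap[OF i j]
    by (rule smooth_on_cong[OF S smooth_slit_trans[OF i j]]) (simp only: slit_trans[OF i j] o_apply)
qed

context slit_bundle
begin

lemma slit_overlap_eq: "i \<in> chart_ids M \<Longrightarrow> j \<in> chart_ids M \<Longrightarrow> slit.overlap i j = base.overlap i j \<times> (UNIV - {0})"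
  using slit_overlap by (simp only: slit.overlap_def)

lemma slit_trans_eq:
  "i \<in> chart_ids M \<Longrightarrow> j \<in> chart_ids M \<Longrightarrow> z \<in> slit.overlap i j \<Longrightarrow>
     slit.trans i j z = (base.trans i j (fst z), fd (base.trans i j) (fst z) (snd z))"
  using slit_trans slit_overlap_eq by (simp only: slit.trans_def)

lemma fst_fd_slit_trans:
  assumes u: "u \<in> points (slit M)" and i: "i \<in> charts_at M (fst u)" and j: "j \<in> charts_at M (fst u)"
  shows "fst (fd (slit.trans i j) (chart_map (slit M) i u) a) = fd (base.trans i j) (chart_map M i (fst u)) (fst a)"
proof -
  let ?z = "chart_map (slit M) i u"
  note ids = base.charts_atD(1)[OF i] base.charts_atD(1)[OF j]
  have i': "i \<in> charts_at (slit M) u" "j \<in> charts_at (slit M) u" using i j charts_at_slit[OF u] by auto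
  have o: "open (slit.overlap i j)" using slit.open_ov ids by simp
  have "fd (\<lambda>z. fst (slit.trans i j z)) ?z = fd (\<lambda>z. base.trans i j (fst z)) ?z"
    by (rule fd_cong_open[OF o slit.map_in_overlap[OF i']]) (simp only: slit_trans_eq[OF ids] fst_conv)
  moreover have "fd (\<lambda>z. fst (slit.trans i j z)) ?z = (\<lambda>a. fst (fd (slit.trans i j) ?z a))"
    by (rule fd_eqI[OF has_derivative_fst[OF has_derivative_fd[OF slit.trans_differentiable[OF i']]]])
  moreover have "((\<lambda>z. base.trans i j (fst z)) has_derivative (\<lambda>a. fd (base.trans i j) (chart_map M i (fst u)) (fst a))) (at ?z)"
    by (rule has_derivative_compose[OF bounded_linear_imp_has_derivative[OF bounded_linear_fst]])
      (simp add: has_derivative_fd[OF base.trans_differentiable[OF i j]])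
  then have "fd (\<lambda>z. base.trans i j (fst z)) ?z = (\<lambda>a. fd (base.trans i j) (chart_map M i (fst u)) (fst a))"
    by (rule fd_eqI)
  ultimately have "(\<lambda>a. fst (fd (slit.trans i j) ?z a)) = (\<lambda>a. fd (base.trans i j) (chart_map M i (fst u)) (fst a))"
    by (simp only:)
  from fun_cong[OF this] show ?thesis .
qed

text \<open>On a fibre the transition of the slit bundle is a linear map, which is its own
  derivative.\<close>

lemma fd_slit_trans_vertical:
  assumes u: "u \<in> points (slit M)" and i: "i \<in> charts_at M (fst u)" and j: "j \<in> charts_at M (fst u)"
  shows "fd (slit.trans i j) (chart_map (slit M) i u) (0, b) = (0, fd (base.trans i j) (chart_map M i (fst u)) b)"
proof -
  let ?x = "chart_map M i (fst u)" and ?y = "snd u i"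
  note ids = base.charts_atD(1)[OF i] base.charts_atD(1)[OF j]
  have i': "i \<in> charts_at (slit M) u" "j \<in> charts_at (slit M) u" using i j charts_at_slit[OF u] by auto
  have y: "?y \<in> UNIV - {0}" using tangent_component_nonzero u i slit_points_iff by blast
  have lin: "(fd (base.trans i j) ?x has_derivative fd (base.trans i j) ?x) (at v)" for v
    by (rule linear_imp_has_derivative[OF base.linear_fd_trans[OF i j]])
  have "(slit.trans i j has_derivative fd (slit.trans i j) (?x, ?y)) (at (?x, ?y))"
    using has_derivative_fd[OF slit.trans_differentiable[OF i']] by (simp only: slit_simps(3))
  then have "((\<lambda>w. slit.trans i j (?x, w)) has_derivative (\<lambda>b. fd (slit.trans i j) (?x, ?y) (0, b))) (at ?y)"
    by (rule has_derivative_compose[OF has_derivative_Pair[OF has_derivative_const has_derivative_ident]])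
  then have "fd (\<lambda>w. slit.trans i j (?x, w)) ?y = (\<lambda>b. fd (slit.trans i j) (?x, ?y) (0, b))" by (rule fd_eqI)
  moreover have "fd (\<lambda>w. slit.trans i j (?x, w)) ?y = fd (\<lambda>w. (base.trans i j ?x, fd (base.trans i j) ?x w)) ?y"
  proof (rule fd_cong_open[OF open_delete[OF open_UNIV] y])
    fix w :: 'e assume "w \<in> UNIV - {0}"
    then have "(?x, w) \<in> slit.overlap i j" using base.map_in_overlap[OF i j] slit_overlap_eq[OF ids] by simp
    then show "slit.trans i j (?x, w) = (base.trans i j ?x, fd (base.trans i j) ?x w)"
      by (simp only: slit_trans_eq[OF ids] fst_conv snd_conv)
  qed
  moreover have "fd (\<lambda>w. (base.trans i j ?x, fd (base.trans i j) ?x w)) ?y = (\<lambda>b. (0, fd (base.trans i j) ?x b))"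
    by (rule fd_eqI[OF has_derivative_Pair[OF has_derivative_const lin]])
  ultimately have "(\<lambda>b. fd (slit.trans i j) (?x, ?y) (0, b)) = (\<lambda>b. (0, fd (base.trans i j) ?x b))"
    by (simp only:)
  from fun_cong[OF this] show ?thesis by (simp only: slit_simps(3))
qed

section \<open>The maps gamma and rho in charts\<close>

lemma gam_apply:
  assumes u: "u \<in> points (slit M)" and i: "i \<in> charts_at M (fst u)"
  shows "gam M u v i = (0, v i)"
proof -
  have "i \<in> charts_at (slit M) u" using charts_at_slit[OF u] i by simp
  moreover have "(fst u, snd u + 0 \<odot> v) = u" by (simp add: vscale_def prod_eq_iff plus_fun_def)
  moreover have "((\<lambda>t. (chart_map M i (fst u), snd u i + t *\<^sub>R v i)) has_vector_derivative (0, v i)) (at 0)"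
    by (auto intro!: derivative_eq_intros has_vector_derivative_Pair)
  then have "vector_derivative (\<lambda>t. (chart_map M i (fst u), snd u i + t *\<^sub>R v i)) (at 0) = (0, v i)"
    by (rule vector_derivative_at)
  ultimately show ?thesis by (simp add: gam_def velocity_at_0_def o_def)
qed

lemma gam_outside:
  assumes "u \<notin> points (slit M) \<or> i \<notin> charts_at M (fst u)" shows "gam M u v i = 0"
proof -
  have "i \<notin> charts_at (slit M) u" using charts_at_slit charts_at_slit_outside assms by blast
  moreover have "(fst u, snd u + 0 \<odot> v) = u" by (simp add: vscale_def prod_eq_iff plus_fun_def)
  ultimately show ?thesis by (simp add: gam_def velocity_at_0_def)
qed

lemma gam_tangent:
  assumes u: "u \<in> points (slit M)" and v: "v \<in> tangent_space M (fst u)"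
  shows "gam M u v \<in> tangent_space (slit M) u"
proof -
  obtain i where i: "i \<in> charts_at M (fst u)" using u slit_points_iff base.points_iff by blast
  show ?thesis
  proof (rule slit.tangent_spaceI)
    show "i \<in> charts_at (slit M) u" using i charts_at_slit[OF u] by simp
    fix j
    show "gam M u v j = fd (slit.trans i j) (chart_map (slit M) i u) (gam M u v i)" if "j \<in> charts_at (slit M) u"
    proof -
      have j: "j \<in> charts_at M (fst u)" using that charts_at_slit[OF u] by simp
      show ?thesis
        unfolding gam_apply[OF u i] gam_apply[OF u j] fd_slit_trans_vertical[OF u i j]
        using base.tangent_component[OF v i j] by simp
    qed
    show "gam M u v j = 0" if "j \<notin> charts_at (slit M) u" using that gam_outside charts_at_slit[OF u] by simp
  qed
qed

text \<open>\<open>a\<close> may be any family of components, tangent or not. This matters for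
  brackets with horizontal lifts that are not yet known to be vector fields.\<close>

lemma rho_some_chart:
  assumes u: "u \<in> points (slit M)"
  shows "rho M u a = base.tvec (some_chart (slit M) u) (fst u) (fst (a (some_chart (slit M) u)))"
proof -
  define i where "i = some_chart (slit M) u"
  have i': "i \<in> charts_at (slit M) u" unfolding i_def by (rule slit.some_chart[OF u])
  then have i: "i \<in> charts_at M (fst u)" using charts_at_slit[OF u] by simp
  let ?z = "chart_map (slit M) i u"
  have *: "fd (chart_map M j \<circ> fst \<circ> chart_inv (slit M) i) ?z b = fd (base.trans i j) (chart_map M i (fst u)) (fst b)"
    if j: "j \<in> charts_at M (fst u)" for j b
  proof -
    note ids = base.charts_atD(1)[OF i]
    have "fd (chart_map M j \<circ> fst \<circ> chart_inv (slit M) i) ?z = fd (\<lambda>z. base.trans i j (fst z)) ?z"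
      using slit.map_in_image[OF i'] slit.open_image ids
      by (intro fd_cong_open[of "chart_image (slit M) i"]) (auto simp: slit_inv base.trans_def)
    moreover have "((\<lambda>z. base.trans i j (fst z)) has_derivative (\<lambda>a. fd (base.trans i j) (chart_map M i (fst u)) (fst a))) (at ?z)"
      by (rule has_derivative_compose[OF bounded_linear_imp_has_derivative[OF bounded_linear_fst]])
        (simp add: has_derivative_fd[OF base.trans_differentiable[OF i j]])
    ultimately show ?thesis by (simp add: fd_eqI)
  qed
  show ?thesis unfolding rho_def dmap_def Let_def i_def[symmetric] base.tvec_def
    by (intro ext if_cong refl *)
qed

lemma rho_apply:
  assumes u: "u \<in> points (slit M)" and a: "a \<in> tangent_space (slit M) u" and j: "j \<in> charts_at M (fst u)"
  shows "rho M u a j = fst (a j)"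
proof -
  define i where "i = some_chart (slit M) u"
  have i': "i \<in> charts_at (slit M) u" unfolding i_def by (rule slit.some_chart[OF u])
  then have i: "i \<in> charts_at M (fst u)" using charts_at_slit[OF u] by simp
  have j': "j \<in> charts_at (slit M) u" using charts_at_slit[OF u] j by simp
  have "fst (a j) = fd (base.trans i j) (chart_map M i (fst u)) (fst (a i))"
    unfolding slit.tangent_component[OF a i' j'] by (rule fst_fd_slit_trans[OF u i j])
  moreover have "rho M u a j = fd (base.trans i j) (chart_map M i (fst u)) (fst (a i))"
    unfolding rho_some_chart[OF u, of a] i_def[symmetric] base.tvec_def by (simp only: j if_True)
  ultimately show ?thesis by simp
qed

lemma rho_tangent:
  assumes u: "u \<in> points (slit M)" shows "rho M u a \<in> tangent_space M (fst u)"
  unfolding rho_some_chart[OF u] using slit.some_chart[OF u] charts_at_slit[OF u] by (auto intro: base.tvec_in)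

lemma tangent_fieldI:
  assumes "u \<in> points (slit M)" "a \<in> tangent_space M (fst u)" "b \<in> tangent_space M (fst u)"
    "\<And>i. i \<in> charts_at M (fst u) \<Longrightarrow> a i = b i"
  shows "a = b"
proof -
  obtain i where i: "i \<in> charts_at M (fst u)" using assms(1) slit_points_iff base.points_iff by blast
  show ?thesis by (rule base.tangent_eqI[OF assms(2,3) i assms(4)[OF i]])
qed

lemma rho_add:
  assumes "u \<in> points (slit M)" "a \<in> tangent_space (slit M) u" "b \<in> tangent_space (slit M) u"
  shows "rho M u (a + b) = rho M u a + rho M u b"
  using assms by (intro tangent_fieldI) (auto simp: rho_apply rho_tangent slit.tangent_add intro: base.tangent_add)

lemma gam_add: "gam M u (a + b) = gam M u a + gam M u b"
proof
  fix i show "gam M u (a + b) i = (gam M u a + gam M u b) i"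
    by (cases "u \<in> points (slit M) \<and> i \<in> charts_at M (fst u)") (auto simp: gam_apply gam_outside)
qed

lemma rho_gam:
  assumes "u \<in> points (slit M)" "v \<in> tangent_space M (fst u)"
  shows "rho M u (gam M u v) = 0"
  using assms by (intro tangent_fieldI[OF _ rho_tangent base.tangent_zero]) (auto simp: rho_apply gam_tangent gam_apply)

lemma vertical_eq_gam:
  assumes u: "u \<in> points (slit M)" and a: "a \<in> tangent_space (slit M) u" and r: "rho M u a = 0"
  shows "(\<lambda>i. snd (a i)) \<in> tangent_space M (fst u)" "a = gam M u (\<lambda>i. snd (a i))"
proof -
  have f: "fst (a i) = 0" if "i \<in> charts_at M (fst u)" for i using rho_apply[OF u a that] r by simp
  show "a = gam M u (\<lambda>i. snd (a i))"
  proof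
    fix i show "a i = gam M u (\<lambda>i. snd (a i)) i"
      using gam_apply[OF u] gam_outside f slit.tangent_outside[OF a] charts_at_slit[OF u]
      by (cases "i \<in> charts_at M (fst u)") (auto simp: prod_eq_iff)
  qed
  obtain i where i: "i \<in> charts_at M (fst u)" using u slit_points_iff base.points_iff by blast
  show "(\<lambda>i. snd (a i)) \<in> tangent_space M (fst u)"
  proof (rule base.tangent_spaceI[OF i])
    fix j
    show "snd (a j) = fd (base.trans i j) (chart_map M i (fst u)) (snd (a i))" if j: "j \<in> charts_at M (fst u)"
    proof -
      have "a j = fd (slit.trans i j) (chart_map (slit M) i u) (a i)"
        using slit.tangent_component[OF a] i j charts_at_slit[OF u] by blast
      also have "a i = (0, snd (a i))" using f[OF i] by (simp add: prod_eq_iff)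
      finally show ?thesis by (simp only: fd_slit_trans_vertical[OF u i j] snd_conv)
    qed
    show "snd (a j) = 0" if "j \<notin> charts_at M (fst u)"
      using slit.tangent_outside[OF a] charts_at_slit[OF u] that by simp
  qed
qed

lemma gam_inj:
  assumes u: "u \<in> points (slit M)" and v: "v \<in> tangent_space M (fst u)" and g: "gam M u v = 0"
  shows "v = 0"
proof (rule tangent_fieldI[OF u v base.tangent_zero])
  fix i assume "i \<in> charts_at M (fst u)"
  then show "v i = 0 i" using gam_apply[OF u, of i v] g by (simp add: zero_prod_def)
qed

section \<open>Sections of the pullback bundle\<close>

lemma pi_vector_fieldD:
  assumes "pi_vector_field M X"
  shows "u \<in> points (slit M) \<Longrightarrow> X u \<in> tangent_space M (fst u)"
    and "i \<in> chart_ids M \<Longrightarrow> smooth_on (chart_image (slit M) i) (slit.loc i X)"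
    and "u \<in> points (slit M) \<Longrightarrow> i \<in> charts_at M (fst u) \<Longrightarrow> slit.loc i X differentiable (at (chart_map (slit M) i u))"
proof -
  show "u \<in> points (slit M) \<Longrightarrow> X u \<in> tangent_space M (fst u)"
    and s: "\<And>i. i \<in> chart_ids M \<Longrightarrow> smooth_on (chart_image (slit M) i) (slit.loc i X)"
    using assms unfolding pi_vector_field_def by blast+
  assume u: "u \<in> points (slit M)" and i: "i \<in> charts_at M (fst u)"
  then have "chart_map (slit M) i u \<in> chart_image (slit M) i" using slit.map_in_image charts_at_slit by blast
  then show "slit.loc i X differentiable (at (chart_map (slit M) i u))"
    using smooth_on_differentiable[OF s] base.charts_atD(1)[OF i] by blast
qed

lemma slit_open: "i \<in> chart_ids M \<Longrightarrow> open (chart_image (slit M) i)"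
  using slit.open_image by simp

lemma slit_inv_points: "i \<in> chart_ids M \<Longrightarrow> z \<in> chart_image (slit M) i \<Longrightarrow> chart_inv (slit M) i z \<in> points (slit M)"
  using slit.inv_in_points by simp

lemma slit_inv_charts: "i \<in> chart_ids M \<Longrightarrow> z \<in> chart_image (slit M) i \<Longrightarrow> i \<in> charts_at M (fst (chart_inv (slit M) i z))"
  using slit.charts_at_inv[of i z] charts_at_slit[OF slit_inv_points] by simp

lemma pi_vector_field_cong:
  assumes "pi_vector_field M X" "\<And>u. u \<in> points (slit M) \<Longrightarrow> X u = Y u"
  shows "pi_vector_field M Y"
  unfolding pi_vector_field_def
proof (intro conjI ballI)
  fix i assume i: "i \<in> chart_ids M"
  show "smooth_on (chart_image (slit M) i) (slit.loc i Y)"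
    using smooth_on_cong[OF slit_open[OF i] pi_vector_fieldD(2)[OF assms(1) i]] assms(2) slit_inv_points[OF i] by simp
qed (use assms pi_vector_fieldD(1) in metis)

lemma pi_vector_field_diff: "pi_vector_field M X \<Longrightarrow> pi_vector_field M Y \<Longrightarrow> pi_vector_field M (X - Y)"
  unfolding pi_vector_field_def using slit_open by (auto intro: base.tangent_diff smooth_on_diff)

lemma pi_vector_field_zero: "pi_vector_field M 0"
  unfolding pi_vector_field_def by (auto simp: base.tangent_zero smooth_on_const)

lemma eta_loc: "i \<in> chart_ids M \<Longrightarrow> z \<in> chart_image (slit M) i \<Longrightarrow> eta (chart_inv (slit M) i z) i = snd z"
  using slit.map_inv[of i z] by (simp add: eta_def) (metis snd_conv)

lemma pi_vector_field_eta: "pi_vector_field M eta"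
  unfolding pi_vector_field_def
proof (intro conjI ballI)
  fix i assume i: "i \<in> chart_ids M"
  show "smooth_on (chart_image (slit M) i) (slit.loc i eta)"
    by (rule smooth_on_cong[OF slit_open[OF i] smooth_on_linear[OF bounded_linear_snd slit_open[OF i]]])
      (simp add: eta_loc[OF i])
qed (simp add: eta_def slit_points_iff)

lemma vector_field_gam:
  assumes X: "pi_vector_field M X" shows "vector_field (slit M) (gam M \<star> X)"
  unfolding vector_field_def bundle_map_app_def
proof (intro conjI ballI)
  fix u assume "u \<in> points (slit M)"
  then show "gam M u (X u) \<in> tangent_space (slit M) u" using gam_tangent pi_vector_fieldD(1)[OF X] by blast
next
  fix i assume "i \<in> chart_ids (slit M)"
  then have i: "i \<in> chart_ids M" by simp
  show "smooth_on (chart_image (slit M) i) (\<lambda>z. gam M (chart_inv (slit M) i z) (X (chart_inv (slit M) i z)) i)"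
    by (rule smooth_on_cong[OF slit_open[OF i] smooth_on_Pair[OF slit_open[OF i] smooth_on_const pi_vector_fieldD(2)[OF X i]]])
      (simp add: gam_apply slit_inv_points[OF i] slit_inv_charts[OF i])
qed

lemma pi_vector_field_rho:
  assumes A: "vector_field (slit M) A" shows "pi_vector_field M (rho M \<star> A)"
  unfolding pi_vector_field_def bundle_map_app_def
proof (intro conjI ballI)
  fix u assume "u \<in> points (slit M)"
  then show "rho M u (A u) \<in> tangent_space M (fst u)" by (rule rho_tangent)
next
  fix i assume i: "i \<in> chart_ids M"
  have i': "i \<in> chart_ids (slit M)" using i by simp
  show "smooth_on (chart_image (slit M) i) (\<lambda>z. rho M (chart_inv (slit M) i z) (A (chart_inv (slit M) i z)) i)"
    by (rule smooth_on_cong[OF slit_open[OF i] smooth_on_fst[OF slit_open[OF i] slit.vector_fieldD(2)[OF A i']]])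
      (simp add: rho_apply slit_inv_points[OF i] slit_inv_charts[OF i] slit.vector_fieldD(1)[OF A])
qed

text \<open>\<open>B\<close> need not be smooth, so that this applies to a horizontal lift before its smoothness is known.\<close>

lemma fst_bracket_gam:
  assumes u: "u \<in> points (slit M)" and i: "i \<in> charts_at M (fst u)" and X: "pi_vector_field M X"
    and B: "slit.loc i B differentiable (at (chart_map (slit M) i u))"
    and Y: "\<And>w. w \<in> points (slit M) \<Longrightarrow> i \<in> charts_at M (fst w) \<Longrightarrow> fst (B w i) = Y w i"
  shows "fst (bracket (slit M) (gam M \<star> X) B u i) = fd (slit.loc i Y) (chart_map (slit M) i u) (0, X u i)"
proof -
  let ?z = "chart_map (slit M) i u"
  have i': "i \<in> charts_at (slit M) u" using i charts_at_slit[OF u] by simp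
  note id = base.charts_atD(1)[OF i] and z = slit.map_in_image[OF i']
  have "fd (\<lambda>z. fst (slit.loc i (gam M \<star> X) z)) ?z = fd (\<lambda>z. 0) ?z"
    by (rule fd_cong_open[OF slit_open[OF id] z])
      (simp add: bundle_map_app_def gam_apply slit_inv_points[OF id] slit_inv_charts[OF id])
  then have 1: "fst (fd (slit.loc i (gam M \<star> X)) ?z a) = 0" for a
    using fd_eqI[OF has_derivative_fst[OF has_derivative_fd[OF slit.vector_fieldD(3)[OF vector_field_gam[OF X] i']]]]
    by (metis frechet_derivative_const)
  have "fd (\<lambda>z. fst (slit.loc i B z)) ?z = fd (slit.loc i Y) ?z"
    by (rule fd_cong_open[OF slit_open[OF id] z]) (simp add: Y slit_inv_points[OF id] slit_inv_charts[OF id])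
  then have 2: "fst (fd (slit.loc i B) ?z a) = fd (slit.loc i Y) ?z a" for a
    using fd_eqI[OF has_derivative_fst[OF has_derivative_fd[OF B]]] by metis
  show ?thesis
    unfolding slit.bracket_chart[OF i'] fst_diff 1 2 by (simp add: bundle_map_app_def gam_apply[OF u i])
qed

lemma rho_bracket_gam_gam:
  assumes u: "u \<in> points (slit M)" and X: "pi_vector_field M X" and Y: "pi_vector_field M Y"
  shows "rho M u (bracket (slit M) (gam M \<star> X) (gam M \<star> Y) u) = 0"
proof (rule tangent_fieldI[OF u rho_tangent[OF u] base.tangent_zero])
  fix i assume i: "i \<in> charts_at M (fst u)"
  have i': "i \<in> charts_at (slit M) u" using i charts_at_slit[OF u] by simp
  have t: "bracket (slit M) (gam M \<star> X) (gam M \<star> Y) u \<in> tangent_space (slit M) u"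
    using slit.vector_fieldD(1)[OF slit.bracket_vector_field u] vector_field_gam X Y by blast
  have "fst (bracket (slit M) (gam M \<star> X) (gam M \<star> Y) u i) = 0"
    using fst_bracket_gam[where B = "gam M \<star> Y" and Y = "\<lambda>_ _. 0", OF u i X slit.vector_fieldD(3)[OF vector_field_gam[OF Y] i']]
    by (simp add: bundle_map_app_def gam_apply)
  then show "rho M u (bracket (slit M) (gam M \<star> X) (gam M \<star> Y) u) i = 0 i"
    by (simp add: rho_apply[OF u t i])
qed

text \<open>In a chart \<eta> is the second coordinate, so its derivative in the vertical direction
  of X is X.\<close>

lemma rho_bracket_gam:
  assumes u: "u \<in> points (slit M)" and X: "pi_vector_field M X"
    and B: "\<And>i. i \<in> charts_at M (fst u) \<Longrightarrow> slit.loc i B differentiable (at (chart_map (slit M) i u))"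
    and eta: "\<And>w i. w \<in> points (slit M) \<Longrightarrow> i \<in> charts_at M (fst w) \<Longrightarrow> fst (B w i) = eta w i"
  shows "rho M u (bracket (slit M) (gam M \<star> X) B u) = X u"
proof -
  define i where "i = some_chart (slit M) u"
  have i': "i \<in> charts_at (slit M) u" unfolding i_def by (rule slit.some_chart[OF u])
  then have i: "i \<in> charts_at M (fst u)" using charts_at_slit[OF u] by simp
  let ?z = "chart_map (slit M) i u"
  note id = base.charts_atD(1)[OF i]
  have "rho M u (bracket (slit M) (gam M \<star> X) B u) i = fst (bracket (slit M) (gam M \<star> X) B u i)"
    unfolding rho_some_chart[OF u] i_def[symmetric] by (rule base.tvec_self[OF i])
  also have "\<dots> = fd (slit.loc i eta) ?z (0, X u i)"
    by (rule fst_bracket_gam[where B = B and Y = eta, OF u i X B[OF i] eta])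
  also have "fd (slit.loc i eta) ?z = fd snd ?z"
    by (rule fd_cong_open[OF slit_open[OF id] slit.map_in_image[OF i']]) (simp add: eta_loc[OF id])
  also have "fd (snd :: 'e \<times> 'e \<Rightarrow> 'e) ?z = snd"
    by (rule fd_eqI[OF bounded_linear_imp_has_derivative[OF bounded_linear_snd]])
  finally have "rho M u (bracket (slit M) (gam M \<star> X) B u) i = X u i" by simp
  then show ?thesis by (rule base.tangent_eqI[OF rho_tangent[OF u] pi_vector_fieldD(1)[OF X u] i])
qed

end

section \<open>The Finsler metric\<close>

lemma has_real_derivative_line:
  assumes "f differentiable (at z)"
  shows "((\<lambda>t. f (z + t *\<^sub>R h)) has_real_derivative fd f z h) (at 0)"
proof -
  have "((\<lambda>t. z + t *\<^sub>R h) has_derivative (\<lambda>t. t *\<^sub>R h)) (at 0)"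
    by (auto intro!: derivative_eq_intros)
  moreover have "(f has_derivative fd f z) (at (z + 0 *\<^sub>R h))" using has_derivative_fd[OF assms] by simp
  ultimately have "((\<lambda>t. f (z + t *\<^sub>R h)) has_derivative (\<lambda>t. fd f z (t *\<^sub>R h))) (at 0)"
    by (rule has_derivative_compose)
  then show ?thesis
    by (simp add: has_field_derivative_def linear_scale[OF linear_frechet_derivative[OF assms]] mult_commute_abs)
qed

lemma eventually_nonzero_line:
  fixes y :: "'a::real_normed_vector"
  assumes "y \<noteq> 0" shows "\<forall>\<^sub>F t in nhds 0. y + t *\<^sub>R h \<noteq> 0"
proof -
  have "open {t. y + t *\<^sub>R h \<noteq> 0}" by (intro open_Collect_neq continuous_intros)
  from eventually_nhds_in_open[OF this, of 0] show ?thesis using assms by simp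
qed

locale finsler =
  fixes M :: "('a, 'i, 'e::euclidean_space) atlas" and L :: "('a, 'i, 'e) tvec \<Rightarrow> real"
  assumes finsler: "finsler_manifold M L"

lemma (in finsler) manifold: "smooth_manifold M"
  using finsler unfolding finsler_manifold_def by (elim conjE)

sublocale finsler \<subseteq> slit_bundle M
proof
  note m = manifold[unfolded smooth_manifold_def]
  fix i assume i: "i \<in> chart_ids M"
  show "inj_on (chart_map M i) (chart_dom M i)" "open (chart_image M i)"
    using conjunct1[OF m] i by simp_all
  fix j assume j: "j \<in> chart_ids M"
  show "open (chart_map M i ` (chart_dom M i \<inter> chart_dom M j))"
    "smooth_on (chart_map M i ` (chart_dom M i \<inter> chart_dom M j)) (chart_map M j \<circ> chart_inv M i)"
    using conjunct1[OF conjunct2[OF m]] i j by simp_all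
qed

context finsler
begin

definition eloc :: "'i \<Rightarrow> 'e \<times> 'e \<Rightarrow> real" where
  "eloc i z = energy L (chart_inv (slit M) i z)"

definition hess :: "'i \<Rightarrow> 'e \<times> 'e \<Rightarrow> 'e \<Rightarrow> 'e \<Rightarrow> real" where
  "hess i z v w = fd (\<lambda>z. fd (eloc i) z (0, w)) z (0, v)"

lemma smooth_eloc:
  assumes i: "i \<in> chart_ids M" shows "smooth_on (chart_image (slit M) i) (eloc i)"
proof -
  have i': "i \<in> chart_ids (slit M)" using i by simp
  have "smooth_function (slit M) L" using finsler unfolding finsler_manifold_def by blast
  note l = slit.smooth_functionD(1)[OF this i']
  have "smooth_on (chart_image (slit M) i) (\<lambda>z. L (chart_inv (slit M) i z) * L (chart_inv (slit M) i z) * (1 / 2))"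
    by (intro smooth_on_bilinear[OF slit_open[OF i] bounded_bilinear_mult] l smooth_on_const)
  then show ?thesis
    by (rule smooth_on_cong[OF slit_open[OF i]]) (simp add: eloc_def energy_def power2_eq_square)
qed

lemma smooth_energy: "smooth_function (slit M) (energy L)"
  using smooth_eloc unfolding smooth_function_def by (simp add: o_def eloc_def[abs_def])

lemma eloc_differentiable:
  assumes "i \<in> chart_ids M" "z \<in> chart_image (slit M) i"
  shows "eloc i differentiable (at z)" "(\<lambda>z. fd (eloc i) z w) differentiable (at z)"
  using smooth_on_differentiable[OF smooth_eloc assms(2)]
    smooth_on_differentiable[OF smooth_on_fd[OF smooth_eloc] assms(2)] assms(1) by blast+

lemma energy_chart:
  assumes "p \<in> points M" "i \<in> charts_at M p" "y \<in> tangent_space M p" "y i \<noteq> 0"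
  shows "energy L (p, y) = eloc i (chart_map M i p, y i)"
    and "(p, y) \<in> points (slit M)"
proof -
  have "y \<noteq> 0" using assms(4) by auto
  then show u: "(p, y) \<in> points (slit M)" using assms by (simp add: slit_points_iff)
  have "chart_inv (slit M) i (chart_map (slit M) i (p, y)) = (p, y)"
    using assms(2) charts_at_slit[OF u] by (intro slit.inv_map) simp
  then show "energy L (p, y) = eloc i (chart_map M i p, y i)" by (simp add: eloc_def)
qed

lemma slit_chart_data:
  assumes u: "u \<in> points (slit M)" and i: "i \<in> charts_at M (fst u)"
  shows "i \<in> chart_ids M" "(chart_map M i (fst u), snd u i) \<in> chart_image (slit M) i" "snd u i \<noteq> 0"
    "chart_map M i (fst u) \<in> chart_image M i" "i \<in> charts_at (slit M) u"
proof -
  show id: "i \<in> chart_ids M" by (rule base.charts_atD(1)[OF i])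
  show i': "i \<in> charts_at (slit M) u" using i charts_at_slit[OF u] by simp
  show "(chart_map M i (fst u), snd u i) \<in> chart_image (slit M) i" using slit.map_in_image[OF i'] by simp
  then show "snd u i \<noteq> 0" "chart_map M i (fst u) \<in> chart_image M i" using slit_image[OF id] by auto
qed

text \<open>The metric is defined by iterated one-variable derivatives along lines through
  \<open>snd u\<close>. For small parameters these lines avoid the zero vector, where E need not be
  smooth, so E may be replaced by its chart expression before differentiating.\<close>

lemma finsler_metric_chart:
  assumes u: "u \<in> points (slit M)" and i: "i \<in> charts_at M (fst u)"
    and v: "v \<in> tangent_space M (fst u)" and w: "w \<in> tangent_space M (fst u)"
  shows "finsler_metric L u v w = hess i (chart_map M i (fst u), snd u i) (v i) (w i)"
proof -
  note d = slit_chart_data[OF u i]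
  let ?x = "chart_map M i (fst u)" and ?y = "snd u i"
  have p: "fst u \<in> points M" "snd u \<in> tangent_space M (fst u)" using u slit_points_iff by auto
  have inner: "deriv (\<lambda>t. energy L (fst u, snd u + s \<odot> v + t \<odot> w)) 0 = fd (eloc i) (?x, ?y + s *\<^sub>R v i) (0, w i)"
    if s: "?y + s *\<^sub>R v i \<noteq> 0" for s
  proof -
    have "\<forall>\<^sub>F t in nhds 0. energy L (fst u, snd u + s \<odot> v + t \<odot> w) = eloc i ((?x, ?y + s *\<^sub>R v i) + t *\<^sub>R (0, w i))"
      using eventually_nonzero_line[OF s, of "w i"]
    proof eventually_elim
      case (elim t)
      have "energy L (fst u, snd u + s \<odot> v + t \<odot> w) = eloc i (?x, (snd u + s \<odot> v + t \<odot> w) i)"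
        using elim by (intro energy_chart p i base.tangent_add base.tangent_scale v w) simp
      then show ?case by simp
    qed
    then have "deriv (\<lambda>t. energy L (fst u, snd u + s \<odot> v + t \<odot> w)) 0
        = deriv (\<lambda>t. eloc i ((?x, ?y + s *\<^sub>R v i) + t *\<^sub>R (0, w i))) 0"
      by (rule deriv_cong_ev) simp
    moreover have "(?x, ?y + s *\<^sub>R v i) \<in> chart_image (slit M) i" using d s slit_image[OF d(1)] by simp
    ultimately show ?thesis
      using DERIV_imp_deriv[OF has_real_derivative_line[OF eloc_differentiable(1)[OF d(1)]]] by metis
  qed
  have "\<forall>\<^sub>F s in nhds 0. deriv (\<lambda>t. energy L (fst u, snd u + s \<odot> v + t \<odot> w)) 0
      = fd (eloc i) ((?x, ?y) + s *\<^sub>R (0, v i)) (0, w i)"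
    using eventually_nonzero_line[OF d(3), of "v i"] by eventually_elim (simp add: inner)
  then have "finsler_metric L u v w = deriv (\<lambda>s. fd (eloc i) ((?x, ?y) + s *\<^sub>R (0, v i)) (0, w i)) 0"
    unfolding finsler_metric_def by (rule deriv_cong_ev) simp
  then show ?thesis
    using DERIV_imp_deriv[OF has_real_derivative_line[OF eloc_differentiable(2)[OF d(1,2)]]]
    unfolding hess_def by metis
qed

lemma hess_sym:
  assumes "i \<in> chart_ids M" "z \<in> chart_image (slit M) i" shows "hess i z v w = hess i z w v"
  unfolding hess_def by (rule fd_fd_commute[OF slit_open[OF assms(1)] assms(2) smooth_eloc[OF assms(1)]])

lemma linear_hess:
  assumes "i \<in> chart_ids M" "z \<in> chart_image (slit M) i"
  shows "linear (\<lambda>v. hess i z v w)" "linear (hess i z v)"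
proof -
  show l: "linear (\<lambda>v. hess i z v w)" for w
  proof -
    have "linear (\<lambda>v. fd (\<lambda>z. fd (eloc i) z (0, w)) z (0, v))"
      using linear_compose[OF _ linear_frechet_derivative[OF eloc_differentiable(2)[OF assms]], of "\<lambda>v. (0, v)"]
      by (simp add: o_def linear_iff)
    then show ?thesis by (simp only: hess_def)
  qed
  have "hess i z v = (\<lambda>w. hess i z w v)" by (rule ext) (rule hess_sym[OF assms])
  then show "linear (hess i z v)" using l[of v] by (simp only:)
qed

lemma finsler_metric_sym:
  assumes u: "u \<in> points (slit M)" and v: "v \<in> tangent_space M (fst u)" and w: "w \<in> tangent_space M (fst u)"
  shows "finsler_metric L u v w = finsler_metric L u w v"
proof -
  obtain i where i: "i \<in> charts_at M (fst u)" using u slit_points_iff base.points_iff by blast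
  show ?thesis
    unfolding finsler_metric_chart[OF u i v w] finsler_metric_chart[OF u i w v]
    by (rule hess_sym[OF slit_chart_data(1,2)[OF u i]])
qed

lemma finsler_metric_add:
  assumes u: "u \<in> points (slit M)" and v: "v \<in> tangent_space M (fst u)" and v': "v' \<in> tangent_space M (fst u)"
    and w: "w \<in> tangent_space M (fst u)"
  shows "finsler_metric L u (v + v') w = finsler_metric L u v w + finsler_metric L u v' w"
proof -
  obtain i where i: "i \<in> charts_at M (fst u)" using u slit_points_iff base.points_iff by blast
  show ?thesis
    unfolding finsler_metric_chart[OF u i base.tangent_add[OF v v'] w] finsler_metric_chart[OF u i v w]
      finsler_metric_chart[OF u i v' w] plus_fun_apply
    by (rule linear_add[OF linear_hess(1)[OF slit_chart_data(1,2)[OF u i]]])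
qed

lemma finsler_metric_definite:
  "u \<in> points (slit M) \<Longrightarrow> v \<in> tangent_space M (fst u) \<Longrightarrow> finsler_metric L u v v = 0 \<Longrightarrow> v = 0"
  using finsler unfolding finsler_manifold_def by fastforce

lemma smooth_finsler_metric:
  assumes Y: "pi_vector_field M Y" and Z: "pi_vector_field M Z"
  shows "smooth_function (slit M) (\<lambda>u. finsler_metric L u (Y u) (Z u))"
proof (rule slit.smooth_functionI)
  fix i assume "i \<in> chart_ids (slit M)"
  then have i: "i \<in> chart_ids M" and i': "i \<in> chart_ids (slit M)" by simp_all
  note o = slit_open[OF i]
  \<comment> \<open>The outer direction of the Hessian may vary with \<open>z\<close>, the inner one
    is kept constant; the second section is brought in through its components in the basis.\<close>
  have "smooth_on (chart_image (slit M) i) (\<lambda>z. hess i z (slit.loc i Y z) b)" for b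
    unfolding hess_def
    by (intro slit.smooth_loc_fd[OF i'] smooth_on_fd smooth_eloc[OF i] smooth_on_Pair[OF o]
        smooth_on_const pi_vector_fieldD(2)[OF Y i])
  then have "smooth_on (chart_image (slit M) i) (\<lambda>z. \<Sum>b\<in>Basis. (slit.loc i Z z \<bullet> b) * hess i z (slit.loc i Y z) b)"
    by (intro smooth_on_sum[OF o] smooth_on_bilinear[OF o bounded_bilinear_mult]
        smooth_on_linear_comp[OF bounded_linear_inner_left o] pi_vector_fieldD(2)[OF Z i])
  then show "smooth_on (chart_image (slit M) i)
      (\<lambda>z. finsler_metric L (chart_inv (slit M) i z) (Y (chart_inv (slit M) i z)) (Z (chart_inv (slit M) i z)))"
  proof (rule smooth_on_cong[OF o])
    fix z assume z: "z \<in> chart_image (slit M) i"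
    let ?u = "chart_inv (slit M) i z"
    note u = slit_inv_points[OF i z] and c = slit_inv_charts[OF i z]
    have m: "(chart_map M i (fst ?u), snd ?u i) = z" using slit.map_inv[OF i' z] by simp
    have eq: "hess i z v w = (\<Sum>b\<in>Basis. (w \<bullet> b) * hess i z v b)" for v w
    proof -
      have "hess i z v w = hess i z v (\<Sum>b\<in>Basis. (w \<bullet> b) *\<^sub>R b)" by (simp add: euclidean_representation)
      then show ?thesis
        by (simp only: linear_sum[OF linear_hess(2)[OF i z]] linear_scale[OF linear_hess(2)[OF i z]] real_scaleR_def)
    qed
    show "(\<Sum>b\<in>Basis. (slit.loc i Z z \<bullet> b) * hess i z (slit.loc i Y z) b) = finsler_metric L ?u (Y ?u) (Z ?u)"
      unfolding finsler_metric_chart[OF u c pi_vector_fieldD(1)[OF Y u] pi_vector_fieldD(1)[OF Z u]] m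
      by (rule eq[symmetric])
  qed
qed

section \<open>Homogeneity and Euler's relations\<close>

lemma L_homogeneous:
  assumes "p \<in> points M" "y \<in> tangent_space M p" "0 < r"
  shows "L (p, r \<odot> y) = r * L (p, y)"
proof -
  have h: "\<forall>(p, y)\<in>tangent_bundle M. \<forall>r>0. L (p, r \<odot> y) = r * L (p, y)"
    using finsler unfolding finsler_manifold_def by (elim conjE)
  have "(p, y) \<in> tangent_bundle M" using assms by (simp add: tangent_bundle_def)
  from bspec[OF h this] show ?thesis using assms(3) by simp
qed

lemma eloc_homogeneous:
  assumes i: "i \<in> chart_ids M" and z: "(x, y) \<in> chart_image (slit M) i" and r: "0 < r"
  shows "eloc i (x, r *\<^sub>R y) = r\<^sup>2 * eloc i (x, y)"
proof -
  let ?u = "chart_inv (slit M) i (x, y)"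
  note u = slit_inv_points[OF i z] and c = slit_inv_charts[OF i z]
  have m: "chart_map M i (fst ?u) = x" "snd ?u i = y" using slit.map_inv[of i "(x, y)"] i z by auto
  have t: "fst ?u \<in> points M" "snd ?u \<in> tangent_space M (fst ?u)" using u slit_points_iff by auto
  have y: "r *\<^sub>R y \<noteq> 0" using z slit_image[OF i] r by auto
  have "energy L (fst ?u, r \<odot> snd ?u) = eloc i (x, r *\<^sub>R y)"
    using energy_chart(1)[OF t(1) c base.tangent_scale[OF t(2)], of r] y m by simp
  moreover have "L (fst ?u, r \<odot> snd ?u) = r * L ?u"
    using L_homogeneous[OF t r] by simp
  ultimately show ?thesis unfolding eloc_def[of i "(x, y)"] energy_def by (simp add: power_mult_distrib)
qed

lemma fd_vertical:
  assumes "f differentiable (at (x, y))"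
  shows "((\<lambda>w. f (x, w)) has_derivative (\<lambda>b. fd f (x, y) (0, b))) (at y)"
  by (rule has_derivative_compose[OF has_derivative_Pair[OF has_derivative_const has_derivative_ident] has_derivative_fd[OF assms]])

lemma fd_eloc_homogeneous:
  assumes i: "i \<in> chart_ids M" and z: "(x, y) \<in> chart_image (slit M) i" and r: "0 < r"
  shows "fd (eloc i) (x, r *\<^sub>R y) (0, w) = r * fd (eloc i) (x, y) (0, w)"
proof -
  have x: "x \<in> chart_image M i" and y: "y \<in> UNIV - {0}" using z slit_image[OF i] by auto
  have rz: "(x, r *\<^sub>R y) \<in> chart_image (slit M) i" using x y r slit_image[OF i] by auto
  have lin: "linear (fd (eloc i) (x, r *\<^sub>R y))" using linear_frechet_derivative eloc_differentiable(1)[OF i rz] by blast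
  have "((\<lambda>w. eloc i (x, r *\<^sub>R w)) has_derivative (\<lambda>w. fd (eloc i) (x, r *\<^sub>R y) (0, r *\<^sub>R w))) (at y)"
    by (rule has_derivative_compose[OF has_derivative_scaleR_right[OF has_derivative_ident] fd_vertical[OF eloc_differentiable(1)[OF i rz]]])
  then have 1: "fd (\<lambda>w. eloc i (x, r *\<^sub>R w)) y = (\<lambda>w. fd (eloc i) (x, r *\<^sub>R y) (0, r *\<^sub>R w))" by (rule fd_eqI)
  have "((\<lambda>w. r\<^sup>2 * eloc i (x, w)) has_derivative (\<lambda>w. r\<^sup>2 * fd (eloc i) (x, y) (0, w))) (at y)"
    by (rule has_derivative_mult_right[OF fd_vertical[OF eloc_differentiable(1)[OF i z]]])
  then have 2: "fd (\<lambda>w. r\<^sup>2 * eloc i (x, w)) y = (\<lambda>w. r\<^sup>2 * fd (eloc i) (x, y) (0, w))" by (rule fd_eqI)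
  have "fd (\<lambda>w. eloc i (x, r *\<^sub>R w)) y = fd (\<lambda>w. r\<^sup>2 * eloc i (x, w)) y"
    by (rule fd_cong_open[OF open_delete[OF open_UNIV] y]) (use x slit_image[OF i] r in \<open>auto intro!: eloc_homogeneous[OF i]\<close>)
  then have "fd (eloc i) (x, r *\<^sub>R y) (0, r *\<^sub>R w) = r\<^sup>2 * fd (eloc i) (x, y) (0, w)"
    unfolding 1 2 by (rule fun_cong)
  moreover have "fd (eloc i) (x, r *\<^sub>R y) (0, r *\<^sub>R w) = r * fd (eloc i) (x, r *\<^sub>R y) (0, w)"
    using linear_scale[OF lin, of r "(0, w)"] by simp
  ultimately show ?thesis using r by (simp add: power2_eq_square)
qed

lemma line_scale: "(x, y) + s *\<^sub>R (0, y) = (x, (1 + s) *\<^sub>R y)"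
  by (simp add: algebra_simps)

lemma eventually_positive: "\<forall>\<^sub>F s in nhds 0. 0 < 1 + (s::real)"
  by (rule eventually_mono[OF eventually_nhds_in_open[of "{-1<..}"]]) auto

text \<open>Differentiation of E(x, (1 + s) y) = (1 + s)^2 E(x, y) at s = 0.\<close>

lemma euler_energy:
  assumes i: "i \<in> chart_ids M" and z: "(x, y) \<in> chart_image (slit M) i"
  shows "fd (eloc i) (x, y) (0, y) = 2 * eloc i (x, y)"
proof -
  have "\<forall>\<^sub>F s in nhds 0. eloc i ((x, y) + s *\<^sub>R (0, y)) = (1 + s)\<^sup>2 * eloc i (x, y)"
    using eventually_positive by eventually_elim (simp only: line_scale eloc_homogeneous[OF i z])
  then have "deriv (\<lambda>s. eloc i ((x, y) + s *\<^sub>R (0, y))) 0 = deriv (\<lambda>s. (1 + s)\<^sup>2 * eloc i (x, y)) 0"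
    by (rule deriv_cong_ev) simp
  moreover have "((\<lambda>s. (1 + s)\<^sup>2 * eloc i (x, y)) has_real_derivative 2 * eloc i (x, y)) (at 0)"
    by (auto intro!: derivative_eq_intros)
  ultimately show ?thesis
    using DERIV_imp_deriv[OF has_real_derivative_line[OF eloc_differentiable(1)[OF i z]]] DERIV_imp_deriv by metis
qed

text \<open>Euler's relation for the fibre derivative of E, which is homogeneous of degree 1. It
  identifies g(\<eta>, v) with the derivative of E along \<gamma>v.\<close>

lemma euler_hess:
  assumes i: "i \<in> chart_ids M" and z: "(x, y) \<in> chart_image (slit M) i"
  shows "hess i (x, y) y w = fd (eloc i) (x, y) (0, w)"
proof -
  have "\<forall>\<^sub>F s in nhds 0. fd (eloc i) ((x, y) + s *\<^sub>R (0, y)) (0, w) = (1 + s) * fd (eloc i) (x, y) (0, w)"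
    using eventually_positive by eventually_elim (simp only: line_scale fd_eloc_homogeneous[OF i z])
  then have "deriv (\<lambda>s. fd (eloc i) ((x, y) + s *\<^sub>R (0, y)) (0, w)) 0 = deriv (\<lambda>s. (1 + s) * fd (eloc i) (x, y) (0, w)) 0"
    by (rule deriv_cong_ev) simp
  moreover have "((\<lambda>s. (1 + s) * fd (eloc i) (x, y) (0, w)) has_real_derivative fd (eloc i) (x, y) (0, w)) (at 0)"
    by (auto intro!: derivative_eq_intros)
  ultimately show ?thesis
    using DERIV_imp_deriv[OF has_real_derivative_line[OF eloc_differentiable(2)[OF i z]]] DERIV_imp_deriv
    unfolding hess_def by metis
qed

lemma finsler_metric_eta:
  assumes u: "u \<in> points (slit M)" and i: "i \<in> charts_at M (fst u)" and v: "v \<in> tangent_space M (fst u)"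
  shows "finsler_metric L u (eta u) v = fd (eloc i) (chart_map M i (fst u), snd u i) (0, v i)"
proof -
  have e: "eta u \<in> tangent_space M (fst u)" using pi_vector_fieldD(1)[OF pi_vector_field_eta u] .
  show ?thesis
    unfolding finsler_metric_chart[OF u i e v] using euler_hess[OF slit_chart_data(1,2)[OF u i]] by (simp add: eta_def)
qed

lemma dfun_chart_slit:
  assumes u: "u \<in> points (slit M)" and i: "i \<in> charts_at M (fst u)" and a: "a \<in> tangent_space (slit M) u"
    and f: "smooth_function (slit M) f"
  shows "dfun (slit M) f u a = fd (\<lambda>z. f (chart_inv (slit M) i z)) (chart_map M i (fst u), snd u i) (a i)"
proof -
  note d = slit_chart_data[OF u i]
  show ?thesis using slit.dfun_chart[OF d(5) a slit.smooth_functionD(2)[OF f d(5)]] by simp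
qed

lemma dfun_energy_gam:
  assumes u: "u \<in> points (slit M)" and v: "v \<in> tangent_space M (fst u)"
  shows "dfun (slit M) (energy L) u (gam M u v) = finsler_metric L u (eta u) v"
proof -
  obtain i where i: "i \<in> charts_at M (fst u)" using u slit_points_iff base.points_iff by blast
  show ?thesis
    using dfun_chart_slit[OF u i gam_tangent[OF u v] smooth_energy] finsler_metric_eta[OF u i v]
    by (simp add: gam_apply[OF u i] eloc_def[abs_def])
qed

lemma finsler_metric_eta_eta:
  assumes u: "u \<in> points (slit M)"
  shows "finsler_metric L u (eta u) (eta u) = energy L u + energy L u"
proof -
  obtain i where i: "i \<in> charts_at M (fst u)" using u slit_points_iff base.points_iff by blast
  note d = slit_chart_data[OF u i]
  have e: "eta u \<in> tangent_space M (fst u)" using pi_vector_fieldD(1)[OF pi_vector_field_eta u] .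
  have "eloc i (chart_map M i (fst u), snd u i) = energy L u"
    using slit.inv_map[OF d(5)] by (simp add: eloc_def)
  then show ?thesis
    using euler_energy[OF d(1,2)] finsler_metric_eta[OF u i e] by (simp add: eta_def)
qed

text \<open>Since g(\<eta>, Y) is the derivative of E along \<gamma>Y, its derivative along
  \<gamma>X is the Hessian g(X, Y) plus g(\<eta>, _) of the vertical derivative of the components of
  Y. The latter is \<rho>[\<gamma>X, B] for every B over Y. As B is only asked to be differentiable
  at \<open>u\<close>, a horizontal lift of the Cartan connection qualifies.\<close>

lemma dfun_gam_metric_eta:
  assumes u: "u \<in> points (slit M)" and X: "pi_vector_field M X" and Y: "pi_vector_field M Y"
    and B: "\<And>i. i \<in> charts_at M (fst u) \<Longrightarrow> slit.loc i B differentiable (at (chart_map (slit M) i u))"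
    and BY: "\<And>w i. w \<in> points (slit M) \<Longrightarrow> i \<in> charts_at M (fst w) \<Longrightarrow> fst (B w i) = Y w i"
  shows "dfun (slit M) (\<lambda>w. finsler_metric L w (eta w) (Y w)) u (gam M u (X u))
    = finsler_metric L u (X u) (Y u)
      + finsler_metric L u (eta u) (rho M u (bracket (slit M) (gam M \<star> X) B u))"
proof -
  define i where "i = some_chart (slit M) u"
  have i': "i \<in> charts_at (slit M) u" unfolding i_def by (rule slit.some_chart[OF u])
  then have i: "i \<in> charts_at M (fst u)" using charts_at_slit[OF u] by simp
  note d = slit_chart_data[OF u i]
  let ?z = "(chart_map M i (fst u), snd u i)"
  note o = slit_open[OF d(1)]
  note tX = pi_vector_fieldD(1)[OF X u] and tY = pi_vector_fieldD(1)[OF Y u]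
  have inv: "chart_inv (slit M) i ?z = u" using slit.inv_map[OF d(5)] by simp
  have "rho M u (bracket (slit M) (gam M \<star> X) B u) i = fst (bracket (slit M) (gam M \<star> X) B u i)"
    unfolding rho_some_chart[OF u] i_def[symmetric] by (rule base.tvec_self[OF i])
  also have "\<dots> = fd (slit.loc i Y) ?z (0, X u i)"
    using fst_bracket_gam[where B = B and Y = Y, OF u i X B[OF i] BY] by simp
  finally have rh: "rho M u (bracket (slit M) (gam M \<star> X) B u) i = fd (slit.loc i Y) ?z (0, X u i)" .
  have dY: "((\<lambda>z. (0::'e, slit.loc i Y z)) has_derivative (\<lambda>h. (0, fd (slit.loc i Y) ?z h))) (at ?z)"
    using has_derivative_Pair[OF has_derivative_const has_derivative_fd[OF pi_vector_fieldD(3)[OF Y u i]]] by simp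
  have "dfun (slit M) (\<lambda>w. finsler_metric L w (eta w) (Y w)) u (gam M u (X u))
      = fd (\<lambda>z. finsler_metric L (chart_inv (slit M) i z) (eta (chart_inv (slit M) i z)) (Y (chart_inv (slit M) i z))) ?z (0, X u i)"
    using dfun_chart_slit[OF u i gam_tangent[OF u tX] smooth_finsler_metric[OF pi_vector_field_eta Y]]
    by (simp add: gam_apply[OF u i])
  also have "fd (\<lambda>z. finsler_metric L (chart_inv (slit M) i z) (eta (chart_inv (slit M) i z)) (Y (chart_inv (slit M) i z))) ?z
      = fd (\<lambda>z. fd (eloc i) z (0, slit.loc i Y z)) ?z"
  proof (rule fd_cong_open[OF o d(2)])
    fix z assume z: "z \<in> chart_image (slit M) i"
    note w = slit_inv_points[OF d(1) z] and c = slit_inv_charts[OF d(1) z]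
    have "(chart_map M i (fst (chart_inv (slit M) i z)), snd (chart_inv (slit M) i z) i) = z"
      using slit.map_inv[of i z] d(1) z by simp
    then show "finsler_metric L (chart_inv (slit M) i z) (eta (chart_inv (slit M) i z)) (Y (chart_inv (slit M) i z))
        = fd (eloc i) z (0, slit.loc i Y z)"
      by (simp only: finsler_metric_eta[OF w c pi_vector_fieldD(1)[OF Y w]])
  qed
  also have "\<dots> = (\<lambda>h. fd (\<lambda>z. fd (eloc i) z (0, slit.loc i Y ?z)) ?z h + fd (eloc i) ?z (0, fd (slit.loc i Y) ?z h))"
    by (rule fd_eqI[OF fd_fd_apply_has_derivative[OF o d(2) smooth_eloc[OF d(1)] dY]])
  finally show ?thesis
    unfolding finsler_metric_chart[OF u i tX tY] finsler_metric_eta[OF u i rho_tangent[OF u]] rh hess_def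
    by (simp only: inv)
qed

end

section \<open>Local frames and horizontal lifts\<close>

context smooth_atlas
begin

lemma tvec_add: "i \<in> charts_at N p \<Longrightarrow> tvec i p (v + w) = tvec i p v + tvec i p w"
  by (rule tangent_eqI[OF tvec_in tangent_add[OF tvec_in tvec_in]]) auto

lemma tvec_scale: "i \<in> charts_at N p \<Longrightarrow> tvec i p (r *\<^sub>R v) = r \<odot> tvec i p v"
  by (rule tangent_eqI[OF tvec_in tangent_scale[OF tvec_in]]) (auto simp: vscale_def)

text \<open>Tested on the generating sets of the topology: in chart \<open>j\<close> their preimages
  are preimages under transition maps, hence open.\<close>

lemma continuous_chart_inv:
  assumes j: "j \<in> chart_ids N"
  shows "continuous_map (top_of_set (chart_image N j)) (manifold_topology N) (chart_inv N j)"
  unfolding manifold_topology_def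
proof (rule continuous_on_generated_topo)
  fix U assume "U \<in> {{p \<in> chart_dom N i. chart_map N i p \<in> U} | i U. i \<in> chart_ids N \<and> open U}"
  then obtain i V where i: "i \<in> chart_ids N" and V: "open V" and U: "U = {p \<in> chart_dom N i. chart_map N i p \<in> V}" by blast
  have "chart_inv N j -` U \<inter> topspace (top_of_set (chart_image N j)) = overlap j i \<inter> trans j i -` V"
    using i j by (auto simp: U overlap_iff charts_at_iff trans_def)
  moreover have "continuous_on (overlap j i) (trans j i)"
    using smooth_trans[OF j i] unfolding smooth_on_def by (metis Ck_on.simps(1))
  then have "open (overlap j i \<inter> trans j i -` V)"
    using continuous_on_open_vimage[OF open_ov[OF j i]] V by (metis Int_commute)
  ultimately have "open (chart_inv N j -` U \<inter> topspace (top_of_set (chart_image N j)))" by simp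
  then show "openin (top_of_set (chart_image N j)) (chart_inv N j -` U \<inter> topspace (top_of_set (chart_image N j)))"
    by (rule open_openin_trans[OF open_image[OF j]]) auto
next
  show "chart_inv N j ` topspace (top_of_set (chart_image N j))
    \<subseteq> \<Union> {{p \<in> chart_dom N i. chart_map N i p \<in> U} | i U. i \<in> chart_ids N \<and> open U}"
  proof
    fix p assume "p \<in> chart_inv N j ` topspace (top_of_set (chart_image N j))"
    then have "p \<in> {p \<in> chart_dom N j. chart_map N j p \<in> UNIV}"
      using charts_at_inv[OF j] by (auto simp: charts_at_iff)
    then show "p \<in> \<Union> {{p \<in> chart_dom N i. chart_map N i p \<in> U} | i U. i \<in> chart_ids N \<and> open U}"
      using j open_UNIV by blast
  qed
qed

text \<open>
  A chart-constant vector field cut off by a bump function. The Hausdorff property makes its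
  support closed, so that it is smooth in all charts.
\<close>

lemma local_frame:
  assumes H: "Hausdorff_space (manifold_topology N)" and i: "i \<in> charts_at N p"
  shows "\<exists>\<psi>::'e \<Rightarrow> real. smooth_on UNIV \<psi> \<and> 0 < \<psi> (chart_map N i p) \<and>
    (\<forall>b. \<exists>X. vector_field N X \<and> (\<forall>q. i \<in> charts_at N q \<longrightarrow> X q i = \<psi> (chart_map N i q) *\<^sub>R b))"
proof -
  note id = charts_atD(1)[OF i]
  let ?x0 = "chart_map N i p"
  obtain r where r: "0 < r" "cball ?x0 r \<subseteq> chart_image N i"
    using open_image[OF id] map_in_image[OF i] open_contains_cball by blast
  obtain \<psi> :: "'e \<Rightarrow> real" where \<psi>: "smooth_on UNIV \<psi>" "0 < \<psi> ?x0" "\<And>x. x \<notin> cball ?x0 r \<Longrightarrow> \<psi> x = 0"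
    using smooth_bump[OF r(1)] by blast
  let ?K = "chart_inv N i ` cball ?x0 r"
  have "compactin (top_of_set (chart_image N i)) (cball ?x0 r)"
    using r(2) by (simp add: compactin_subtopology)
  then have "compactin (manifold_topology N) ?K" by (rule image_compactin[OF _ continuous_chart_inv[OF id]])
  then have K: "closedin (manifold_topology N) ?K" by (rule compactin_imp_closedin[OF H])
  have "\<exists>X. vector_field N X \<and> (\<forall>q. i \<in> charts_at N q \<longrightarrow> X q i = \<psi> (chart_map N i q) *\<^sub>R b)" for b
  proof -
    let ?X = "\<lambda>q. if i \<in> charts_at N q then tvec i q (\<psi> (chart_map N i q) *\<^sub>R b) else 0"
    have "?X q i = \<psi> (chart_map N i q) *\<^sub>R b" if "i \<in> charts_at N q" for q using that by simp
    moreover have "vector_field N ?X"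
      unfolding vector_field_def
    proof (intro conjI ballI)
      fix q show "?X q \<in> tangent_space N q" by (simp add: tvec_in tangent_zero)
    next
      fix j assume j: "j \<in> chart_ids N"
      \<comment> \<open>Chart \<open>j\<close> is covered by its overlap with chart
        \<open>i\<close>, where the field is the transported bump, and by the part off the compact
        set \<open>?K\<close>, where the field is zero.\<close>
      let ?O = "{x \<in> chart_image N j. chart_inv N j x \<in> topspace (manifold_topology N) - ?K}"
      have "openin (manifold_topology N) (topspace (manifold_topology N) - ?K)" using K by blast
      from openin_continuous_map_preimage[OF continuous_chart_inv[OF j] this]
      have "openin (top_of_set (chart_image N j)) ?O" by simp
      then have O: "open ?O" using open_image[OF j] openin_open_trans by blast
      note oo = open_ov[OF j id]
      have st: "trans j i ` overlap j i \<subseteq> overlap i j" using trans_in_overlap[OF j id] by blast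
      have "smooth_on (overlap j i) (\<lambda>x. \<psi> (trans j i x) *\<^sub>R b)"
        by (intro smooth_on_linear_comp[OF bounded_linear_scaleR_left oo]
            smooth_on_compose[OF oo open_UNIV _ \<psi>(1) smooth_trans[OF j id]]) simp
      from smooth_on_fd_apply[OF oo open_ov[OF id j] st smooth_trans[OF id j] smooth_trans[OF j id] this]
      have "smooth_on (overlap j i) (loc j ?X)"
      proof (rule smooth_on_cong[OF oo])
        fix x assume x: "x \<in> overlap j i"
        have c: "i \<in> charts_at N (chart_inv N j x)" "j \<in> charts_at N (chart_inv N j x)"
          using x unfolding overlap_iff[OF j id] by (auto intro: charts_at_inv[OF j])
        show "fd (trans i j) (trans j i x) (\<psi> (trans j i x) *\<^sub>R b) = loc j ?X x"
          using c by (simp add: tvec_def trans_def[of j i])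
      qed
      moreover have "smooth_on ?O (loc j ?X)"
      proof (rule smooth_on_cong[OF O smooth_on_const[of _ 0]])
        fix x assume x: "x \<in> ?O"
        let ?q = "chart_inv N j x"
        show "0 = loc j ?X x"
        proof (cases "i \<in> charts_at N ?q")
          case True
          have "chart_map N i ?q \<notin> cball ?x0 r"
            using x inv_map[OF True] by (metis (no_types, lifting) DiffE image_eqI mem_Collect_eq)
          then have "tvec i ?q (\<psi> (chart_map N i ?q) *\<^sub>R b) = tvec i ?q (0 *\<^sub>R b)" by (simp add: \<psi>(3))
          then show ?thesis using tvec_scale[OF True, of 0 b] by (simp add: vscale_def)
        qed simp
      qed
      ultimately have "smooth_on (overlap j i \<union> ?O) (loc j ?X)" by (rule smooth_on_Un[OF oo O])
      moreover have "chart_image N j \<subseteq> overlap j i \<union> ?O"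
      proof
        fix x assume x: "x \<in> chart_image N j"
        have t: "chart_inv N j x \<in> topspace (manifold_topology N)"
          using continuous_map_image_subset_topspace[OF continuous_chart_inv[OF j]] x by auto
        have "x \<in> overlap j i" if "chart_inv N j x \<in> ?K"
        proof -
          obtain y where y: "y \<in> cball ?x0 r" "chart_inv N j x = chart_inv N i y" using \<open>chart_inv N j x \<in> ?K\<close> by blast
          then have "i \<in> charts_at N (chart_inv N j x)" using charts_at_inv[OF id] r(2) by (metis subsetD)
          then show ?thesis using x overlap_iff[OF j id] by blast
        qed
        then show "x \<in> overlap j i \<union> ?O" using x t by blast
      qed
      ultimately show "smooth_on (chart_image N j) (loc j ?X)" by (rule smooth_on_subset)
    qed
    ultimately show ?thesis by blast
  qed
  then show ?thesis using \<psi>(1,2) by blast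
qed

end

context slit_bundle
begin

lemma pullback_pi_vector_field:
  assumes X: "vector_field M X" shows "pi_vector_field M (\<lambda>u. X (fst u))"
  unfolding pi_vector_field_def
proof (intro conjI ballI)
  fix u assume "u \<in> points (slit M)"
  then show "X (fst u) \<in> tangent_space M (fst u)" using base.vector_fieldD(1)[OF X] slit_points_iff by blast
next
  fix i assume i: "i \<in> chart_ids M"
  have "smooth_on (chart_image (slit M) i) (\<lambda>z. base.loc i X (fst z))"
    using slit_image[OF i]
    by (intro smooth_on_compose[OF slit_open[OF i] base.open_image[OF i] _ base.vector_fieldD(2)[OF X i]]
        smooth_on_linear[OF bounded_linear_fst slit_open[OF i]]) auto
  then show "smooth_on (chart_image (slit M) i) (\<lambda>z. X (fst (chart_inv (slit M) i z)) i)"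
    by (rule smooth_on_cong[OF slit_open[OF i]]) (simp add: slit_inv[OF i])
qed

lemma gam_scale: "gam M u (r \<odot> v) = r \<odot> gam M u v"
proof
  fix i show "gam M u (r \<odot> v) i = (r \<odot> gam M u v) i"
    by (cases "u \<in> points (slit M) \<and> i \<in> charts_at M (fst u)") (auto simp: gam_apply gam_outside)
qed

section \<open>Linear and regular connections\<close>

lemma linear_connectionD:
  assumes "linear_connection M D"
  shows "vector_field (slit M) A \<Longrightarrow> pi_vector_field M Y \<Longrightarrow> pi_vector_field M (cov D A Y)"
    and "u \<in> points (slit M) \<Longrightarrow> a \<in> tangent_space (slit M) u \<Longrightarrow> pi_vector_field M Y \<Longrightarrow>
      D u a Y \<in> tangent_space M (fst u)"
    and "u \<in> points (slit M) \<Longrightarrow> a \<in> tangent_space (slit M) u \<Longrightarrow> b \<in> tangent_space (slit M) u \<Longrightarrow>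
      pi_vector_field M Y \<Longrightarrow> D u (a + b) Y = D u a Y + D u b Y"
    and "u \<in> points (slit M) \<Longrightarrow> a \<in> tangent_space (slit M) u \<Longrightarrow> pi_vector_field M Y \<Longrightarrow>
      D u (r \<odot> a) Y = r \<odot> D u a Y"
    and "u \<in> points (slit M) \<Longrightarrow> a \<in> tangent_space (slit M) u \<Longrightarrow> pi_vector_field M Y \<Longrightarrow>
      pi_vector_field M Z \<Longrightarrow> D u a (Y + Z) = D u a Y + D u a Z"
    and "u \<in> points (slit M) \<Longrightarrow> a \<in> tangent_space (slit M) u \<Longrightarrow> pi_vector_field M Y \<Longrightarrow>
      smooth_function (slit M) f \<Longrightarrow>
      D u a (\<lambda>w. f w \<odot> Y w) = dfun (slit M) f u a \<odot> Y u + f u \<odot> D u a Y"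
  using assms unfolding linear_connection_def by blast+

text \<open>
  A section vanishing on the slit bundle is its own product with the function that is 0 there and
  1 elsewhere, so the values of \<open>Y\<close> off the slit bundle do not matter.
\<close>

lemma connection_cong:
  assumes D: "linear_connection M D" and u: "u \<in> points (slit M)" and a: "a \<in> tangent_space (slit M) u"
    and Y: "pi_vector_field M Y" and eq: "\<And>w. w \<in> points (slit M) \<Longrightarrow> Y w = Y' w"
  shows "D u a Y = D u a Y'"
proof -
  have Y': "pi_vector_field M Y'" by (rule pi_vector_field_cong[OF Y eq])
  define Z where "Z = Y' - Y"
  have Z: "pi_vector_field M Z" unfolding Z_def by (rule pi_vector_field_diff[OF Y' Y])
  define f :: "('a, 'i, 'e) tvec \<Rightarrow> real" where "f w = (if w \<in> points (slit M) then 0 else 1)" for w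
  have f: "smooth_function (slit M) f"
  proof (rule slit.smooth_functionI)
    fix i assume i: "i \<in> chart_ids (slit M)"
    show "smooth_on (chart_image (slit M) i) (\<lambda>z. f (chart_inv (slit M) i z))"
      by (rule smooth_on_cong[OF slit.open_image[OF i] smooth_on_const[of _ 0]]) (simp add: f_def slit.inv_in_points[OF i])
  qed
  have "(\<lambda>w. f w \<odot> Z w) = Z" by (intro ext) (simp add: f_def Z_def eq vscale_def)
  moreover have "D u a (\<lambda>w. f w \<odot> Z w) = dfun (slit M) f u a \<odot> Z u + f u \<odot> D u a Z"
    by (rule linear_connectionD(6)[OF D u a Z f])
  moreover have "Z u = 0" "f u = 0" using u by (simp_all add: Z_def eq f_def)
  ultimately have "D u a Z = 0" by (simp add: vscale_def zero_fun_def)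
  moreover have "D u a (Y + Z) = D u a Y + D u a Z" by (rule linear_connectionD(5)[OF D u a Y Z])
  ultimately show ?thesis by (simp add: Z_def)
qed

lemma Kmap_add:
  "linear_connection M D \<Longrightarrow> u \<in> points (slit M) \<Longrightarrow> a \<in> tangent_space (slit M) u \<Longrightarrow>
    b \<in> tangent_space (slit M) u \<Longrightarrow> Kmap D u (a + b) = Kmap D u a + Kmap D u b"
  unfolding Kmap_def by (rule linear_connectionD(3)[OF _ _ _ _ pi_vector_field_eta])

lemma Kmap_diff:
  assumes "linear_connection M D" "u \<in> points (slit M)" "a \<in> tangent_space (slit M) u" "b \<in> tangent_space (slit M) u"
  shows "Kmap D u (a - b) = Kmap D u a - Kmap D u b"
  using Kmap_add[OF assms(1,2) slit.tangent_diff[OF assms(3,4)] assms(4)] by (simp add: eq_diff_eq)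

lemma rho_diff:
  assumes "u \<in> points (slit M)" "a \<in> tangent_space (slit M) u" "b \<in> tangent_space (slit M) u"
  shows "rho M u (a - b) = rho M u a - rho M u b"
  using rho_add[OF assms(1) slit.tangent_diff[OF assms(2,3)] assms(3)] by (simp add: eq_diff_eq)

lemma rho_surj:
  assumes u: "u \<in> points (slit M)" and v: "v \<in> tangent_space M (fst u)"
  shows "\<exists>a\<in>tangent_space (slit M) u. rho M u a = v"
proof -
  obtain i where i: "i \<in> charts_at M (fst u)" using u slit_points_iff base.points_iff by blast
  then have i': "i \<in> charts_at (slit M) u" using charts_at_slit[OF u] by simp
  let ?a = "slit.tvec i u (v i, 0)"
  have a: "?a \<in> tangent_space (slit M) u" by (rule slit.tvec_in[OF i'])
  have "rho M u ?a = v"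
    by (rule base.tangent_eqI[OF rho_tangent[OF u] v i])
      (simp only: rho_apply[OF u a i] slit.tvec_self[OF i'] fst_conv)
  then show ?thesis using a by blast
qed

lemma regular_linear: "regular_connection M D \<Longrightarrow> linear_connection M D"
  by (simp add: regular_connection_def)

lemma regular_inter:
  assumes D: "regular_connection M D" and u: "u \<in> points (slit M)" and a: "a \<in> tangent_space (slit M) u"
    and "Kmap D u a = 0" "rho M u a = 0"
  shows "a = 0"
proof -
  have "vertical M u \<inter> horizontal M D u = {0}" using D u unfolding regular_connection_def by blast
  moreover have "a \<in> vertical M u \<inter> horizontal M D u" using assms by (simp add: vertical_def horizontal_def)
  ultimately show ?thesis by blast
qed

lemma beta_unique:
  assumes D: "regular_connection M D" and u: "u \<in> points (slit M)" and a: "a \<in> tangent_space (slit M) u"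
    and K: "Kmap D u a = 0"
  shows "beta M D u (rho M u a) = a"
proof -
  have "inj_on (rho M u) (horizontal M D u)"
  proof (rule inj_onI)
    fix b c assume "b \<in> horizontal M D u" "c \<in> horizontal M D u" "rho M u b = rho M u c"
    then have "b - c = 0"
      using regular_inter[OF D u slit.tangent_diff[of b u c]] Kmap_diff[OF regular_linear[OF D] u, of b c]
        rho_diff[OF u, of b c] by (simp add: horizontal_def)
    then show "b = c" by simp
  qed
  moreover have "a \<in> horizontal M D u" using a K by (simp add: horizontal_def)
  ultimately show ?thesis unfolding beta_def by (rule inv_into_f_f)
qed

lemma beta_props:
  assumes D: "regular_connection M D" and u: "u \<in> points (slit M)" and v: "v \<in> tangent_space M (fst u)"
  shows "beta M D u v \<in> tangent_space (slit M) u" "Kmap D u (beta M D u v) = 0" "rho M u (beta M D u v) = v"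
proof -
  obtain a where a: "a \<in> tangent_space (slit M) u" "rho M u a = v" using rho_surj[OF u v] by blast
  have "{a + b | a b. a \<in> vertical M u \<and> b \<in> horizontal M D u} = tangent_space (slit M) u"
    using D u unfolding regular_connection_def by blast
  then obtain b c where bc: "a = b + c" "b \<in> vertical M u" "c \<in> horizontal M D u" using a(1) by blast
  then have c: "c \<in> tangent_space (slit M) u" "Kmap D u c = 0" and b: "b \<in> tangent_space (slit M) u" "rho M u b = 0"
    by (auto simp: vertical_def horizontal_def)
  have "rho M u c = v" using rho_add[OF u b(1) c(1)] b(2) a(2) bc(1) by simp
  then have "beta M D u v = c" using beta_unique[OF D u c] by simp
  then show "beta M D u v \<in> tangent_space (slit M) u" "Kmap D u (beta M D u v) = 0" "rho M u (beta M D u v) = v"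
    using c \<open>rho M u c = v\<close> by simp_all
qed

text \<open>\<open>beta M D \<star> Z\<close> differs from the smooth lift A by a vertical field
  \<gamma>W, and K \<gamma> W = K A. In chart \<open>i\<close> this is a linear system for W whose
  coefficients are smooth, up to a bump factor, because they come from covariant derivatives of
  \<eta> along smooth fields. It is injective at \<open>u\<close>, as V and H intersect
  trivially.\<close>

lemma beta_differentiable:
  assumes H: "Hausdorff_space (manifold_topology M)" and D: "regular_connection M D"
    and Z: "pi_vector_field M Z" and A: "vector_field (slit M) A"
    and rA: "\<And>w. w \<in> points (slit M) \<Longrightarrow> rho M w (A w) = Z w"
    and u: "u \<in> points (slit M)" and i: "i \<in> charts_at M (fst u)"
  shows "slit.loc i (beta M D \<star> Z) differentiable (at (chart_map (slit M) i u))"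
proof -
  note lin = regular_linear[OF D]
  note id = base.charts_atD(1)[OF i]
  have i': "i \<in> charts_at (slit M) u" using i charts_at_slit[OF u] by simp
  let ?z0 = "chart_map (slit M) i u" and ?inv = "chart_inv (slit M) i"
  obtain \<psi> :: "'e \<Rightarrow> real" where \<psi>: "smooth_on UNIV \<psi>" "0 < \<psi> (chart_map M i (fst u))"
    and frame: "\<And>b. \<exists>X. vector_field M X \<and> (\<forall>q. i \<in> charts_at M q \<longrightarrow> X q i = \<psi> (chart_map M i q) *\<^sub>R b)"
    using base.local_frame[OF H i] by blast
  from frame obtain X where X: "\<And>b. vector_field M (X b)"
    and Xi: "\<And>b q. i \<in> charts_at M q \<Longrightarrow> X b q i = \<psi> (chart_map M i q) *\<^sub>R b" by metis
  \<comment> \<open>The matrix of K \<gamma> in chart \<open>i\<close>.\<close>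
  define \<kappa> where "\<kappa> w v = Kmap D w (gam M w (base.tvec i (fst w) v)) i" for w v
  have kap: "linear (\<kappa> w)" if w: "w \<in> points (slit M)" "i \<in> charts_at M (fst w)" for w
  proof -
    have t: "gam M w (base.tvec i (fst w) v) \<in> tangent_space (slit M) w" for v
      by (rule gam_tangent[OF w(1) base.tvec_in[OF w(2)]])
    show ?thesis
      unfolding linear_iff \<kappa>_def Kmap_def
      by (simp add: base.tvec_add[OF w(2)] base.tvec_scale[OF w(2)] gam_add gam_scale
          linear_connectionD(3)[OF lin w(1) t t pi_vector_field_eta]
          linear_connectionD(4)[OF lin w(1) t pi_vector_field_eta])
  qed
  \<comment> \<open>The columns of this matrix, multiplied by the bump function: components of
    derivatives of \<eta> along global fields, hence smooth.\<close>
  define n where "n b = slit.loc i (cov D (gam M \<star> (\<lambda>w. X b (fst w))) eta)" for b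
  define y where "y = slit.loc i (cov D A eta)"
  have Xpi: "pi_vector_field M (\<lambda>w. X b (fst w))" for b by (rule pullback_pi_vector_field[OF X])
  have n: "n b differentiable (at ?z0)" for b unfolding n_def
    by (rule pi_vector_fieldD(3)[OF linear_connectionD(1)[OF lin vector_field_gam[OF Xpi] pi_vector_field_eta] u i])
  have y: "y differentiable (at ?z0)" unfolding y_def
    by (rule pi_vector_fieldD(3)[OF linear_connectionD(1)[OF lin A pi_vector_field_eta] u i])
  have n_eq: "n b z = \<psi> (fst z) *\<^sub>R \<kappa> (?inv z) b" if z: "z \<in> chart_image (slit M) i" for b z
  proof -
    note w = slit_inv_points[OF id z] and c = slit_inv_charts[OF id z]
    have "chart_map M i (fst (?inv z)) = fst z" using slit.map_inv[of i z] id z by (simp add: prod_eq_iff)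
    then have "X b (fst (?inv z)) i = \<psi> (fst z) *\<^sub>R b" using Xi[OF c] by simp
    moreover have "X b (fst (?inv z)) \<in> tangent_space M (fst (?inv z))" using pi_vector_fieldD(1)[OF Xpi w] .
    ultimately have "X b (fst (?inv z)) = base.tvec i (fst (?inv z)) (\<psi> (fst z) *\<^sub>R b)"
      using base.tvec_eq[OF _ c] by metis
    then have "n b z = \<kappa> (?inv z) (\<psi> (fst z) *\<^sub>R b)"
      by (simp add: n_def \<kappa>_def Kmap_def cov_def bundle_map_app_def)
    then show ?thesis by (simp only: linear_scale[OF kap[OF w c]])
  qed
  have sum_n: "(\<Sum>b\<in>Basis. (v \<bullet> b) *\<^sub>R n b z) = \<kappa> (?inv z) (\<psi> (fst z) *\<^sub>R v)" if z: "z \<in> chart_image (slit M) i" for v z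
  proof -
    note l = kap[OF slit_inv_points[OF id z] slit_inv_charts[OF id z]]
    have "\<kappa> (?inv z) (\<psi> (fst z) *\<^sub>R v) = \<psi> (fst z) *\<^sub>R \<kappa> (?inv z) (\<Sum>b\<in>Basis. (v \<bullet> b) *\<^sub>R b)"
      by (simp only: linear_scale[OF l] euclidean_representation)
    also have "\<kappa> (?inv z) (\<Sum>b\<in>Basis. (v \<bullet> b) *\<^sub>R b) = (\<Sum>b\<in>Basis. (v \<bullet> b) *\<^sub>R \<kappa> (?inv z) b)"
      by (simp only: linear_sum[OF l] linear_scale[OF l])
    finally show ?thesis by (simp add: n_eq[OF z] scaleR_sum_right mult.commute)
  qed
  \<comment> \<open>Where the bump function is positive, the cut-off fields form a frame, and one
    can divide by it.\<close>
  define S where "S = chart_image (slit M) i \<inter> (\<psi> \<circ> fst) -` {0<..}"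
  have "continuous_on UNIV \<psi>" using \<psi>(1) unfolding smooth_on_def by (metis Ck_on.simps(1))
  then have "open ((\<psi> \<circ> fst) -` {0<..} :: ('e \<times> 'e) set)"
    by (intro open_vimage) (auto intro!: continuous_intros simp: o_def intro: continuous_on_compose2)
  then have S: "open S" unfolding S_def using slit_open[OF id] by blast
  have z0: "?z0 \<in> chart_image (slit M) i" by (rule slit.map_in_image[OF i'])
  have z0S: "?z0 \<in> S" using z0 \<psi>(2) by (simp add: S_def)
  have inv0: "?inv ?z0 = u" by (rule slit.inv_map[OF i'])
  define W where "W w = (\<lambda>j. snd ((A w - beta M D w (Z w)) j))" for w
  have W: "W w \<in> tangent_space M (fst w)" "A w - beta M D w (Z w) = gam M w (W w)" if w: "w \<in> points (slit M)" for w
  proof -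
    note b = beta_props[OF D w pi_vector_fieldD(1)[OF Z w]] and a = slit.vector_fieldD(1)[OF A w]
    have "rho M w (A w - beta M D w (Z w)) = 0" using rho_diff[OF w a b(1)] b(3) rA[OF w] by simp
    from vertical_eq_gam[OF w slit.tangent_diff[OF a b(1)] this]
    show "W w \<in> tangent_space M (fst w)" "A w - beta M D w (Z w) = gam M w (W w)"
      unfolding W_def by (simp_all only:)
  qed
  \<comment> \<open>The columns carry the factor \<open>\<psi>\<close>, so the unknown of the system
    is W divided by it.\<close>
  define \<omega> where "\<omega> z = (1 / \<psi> (fst z)) *\<^sub>R W (?inv z) i" for z
  have W\<omega>: "W (?inv z) i = \<psi> (fst z) *\<^sub>R \<omega> z" if "z \<in> S" for z using that by (simp add: \<omega>_def S_def)
  have "\<omega> differentiable (at ?z0)"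
  proof (rule differentiable_linear_solve[OF _ _ y S z0S])
    show "n b differentiable (at ?z0)" for b by (rule n)
    show "v = 0" if "(\<Sum>b\<in>Basis. (v \<bullet> b) *\<^sub>R n b ?z0) = 0" for v
    proof -
      let ?v = "base.tvec i (fst u) (\<psi> (fst ?z0) *\<^sub>R v)"
      have t: "gam M u ?v \<in> tangent_space (slit M) u" by (rule gam_tangent[OF u base.tvec_in[OF i]])
      have "Kmap D u (gam M u ?v) i = 0" using that sum_n[OF z0] inv0 by (simp add: \<kappa>_def)
      then have "Kmap D u (gam M u ?v) = 0"
        using linear_connectionD(2)[OF lin u t pi_vector_field_eta]
        by (intro base.tangent_eqI[OF _ base.tangent_zero i]) (auto simp: Kmap_def)
      then have "gam M u ?v = 0" by (rule regular_inter[OF D u t]) (rule rho_gam[OF u base.tvec_in[OF i]])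
      then have "?v = 0" by (rule gam_inj[OF u base.tvec_in[OF i]])
      then have "?v i = 0" by simp
      then show "v = 0" using \<psi>(2) base.tvec_self[OF i] by simp
    qed
    fix z assume z: "z \<in> S"
    then have zi: "z \<in> chart_image (slit M) i" by (simp add: S_def)
    let ?w = "?inv z"
    note w = slit_inv_points[OF id zi] and c = slit_inv_charts[OF id zi]
    note b = beta_props[OF D w pi_vector_fieldD(1)[OF Z w]] and a = slit.vector_fieldD(1)[OF A w]
    have "Kmap D ?w (A ?w) = Kmap D ?w (gam M ?w (W ?w))"
      using Kmap_diff[OF lin w a b(1)] b(2) W(2)[OF w] by simp
    then have "y z = \<kappa> ?w (W ?w i)"
      using base.tvec_eq[OF W(1)[OF w] c] by (simp add: y_def cov_def Kmap_def \<kappa>_def)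
    then show "(\<Sum>b\<in>Basis. (\<omega> z \<bullet> b) *\<^sub>R n b z) = y z" unfolding sum_n[OF zi] W\<omega>[OF z] by simp
  qed
  moreover have "(\<lambda>z. \<psi> (fst z)) differentiable (at ?z0)"
    using smooth_on_differentiable[OF smooth_on_compose[OF open_UNIV open_UNIV _ \<psi>(1) smooth_on_linear[OF bounded_linear_fst open_UNIV]]]
    by simp
  ultimately have "(\<lambda>z. \<psi> (fst z) *\<^sub>R \<omega> z) differentiable (at ?z0)" by (rule differentiable_scaleR[rotated])
  then have "(\<lambda>z. slit.loc i A z - (0, \<psi> (fst z) *\<^sub>R \<omega> z)) differentiable (at ?z0)"
    using has_derivative_diff[OF has_derivative_fd[OF slit.vector_fieldD(3)[OF A i']]
        has_derivative_Pair[OF has_derivative_const has_derivative_fd]] by (blast intro: differentiableI)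
  moreover have "slit.loc i A z - (0, \<psi> (fst z) *\<^sub>R \<omega> z) = slit.loc i (beta M D \<star> Z) z" if z: "z \<in> S" for z
  proof -
    have zi: "z \<in> chart_image (slit M) i" using z by (simp add: S_def)
    note w = slit_inv_points[OF id zi] and c = slit_inv_charts[OF id zi]
    have "A (?inv z) i - beta M D (?inv z) (Z (?inv z)) i = (0, W (?inv z) i)"
      using fun_cong[OF W(2)[OF w], of i] gam_apply[OF w c] by simp
    then show ?thesis by (simp add: bundle_map_app_def W\<omega>[OF z] algebra_simps)
  qed
  ultimately show ?thesis
    using differentiable_cong_open[OF S z0S, of "\<lambda>z. slit.loc i A z - (0, \<psi> (fst z) *\<^sub>R \<omega> z)" "slit.loc i (beta M D \<star> Z)"]
    by blast
qed

end

section \<open>Sections as modules\<close>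

context finsler
begin

text \<open>
  Vector fields, sections and functions with value 0 off the slit bundle: for these, agreeing on the
  slit bundle means being equal.
\<close>

definition on_slit :: "(('a, 'i, 'e) tvec \<Rightarrow> 'w::zero) \<Rightarrow> ('a, 'i, 'e) tvec \<Rightarrow> 'w" where
  "on_slit X u = (if u \<in> points (slit M) then X u else 0)"

definition VF :: "('a, 'i, 'e) vfield set" where
  "VF = {A. vector_field (slit M) A \<and> (\<forall>u. u \<notin> points (slit M) \<longrightarrow> A u = 0)}"

definition PF :: "('a, 'i, 'e) pifield set" where
  "PF = {X. pi_vector_field M X \<and> (\<forall>u. u \<notin> points (slit M) \<longrightarrow> X u = 0)}"

definition FF :: "(('a, 'i, 'e) tvec \<Rightarrow> real) set" where
  "FF = {f. smooth_function (slit M) f \<and> (\<forall>u. u \<notin> points (slit M) \<longrightarrow> f u = 0)}"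

abbreviation "br \<equiv> bracket (slit M)"

definition rh :: "('a, 'i, 'e) vfield \<Rightarrow> ('a, 'i, 'e) pifield" where "rh A = on_slit (rho M \<star> A)"

definition ga :: "('a, 'i, 'e) pifield \<Rightarrow> ('a, 'i, 'e) vfield" where "ga X = gam M \<star> X"

definition act :: "('a, 'i, 'e) vfield \<Rightarrow> (('a, 'i, 'e) tvec \<Rightarrow> real) \<Rightarrow> ('a, 'i, 'e) tvec \<Rightarrow> real" where
  "act A f = on_slit (\<lambda>u. dfun (slit M) f u (A u))"

definition met :: "('a, 'i, 'e) pifield \<Rightarrow> ('a, 'i, 'e) pifield \<Rightarrow> ('a, 'i, 'e) tvec \<Rightarrow> real" where
  "met X Y = on_slit (\<lambda>u. finsler_metric L u (X u) (Y u))"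

definition con :: "('a, 'i, 'e) connection \<Rightarrow> ('a, 'i, 'e) vfield \<Rightarrow> ('a, 'i, 'e) pifield \<Rightarrow> ('a, 'i, 'e) pifield" where
  "con D A Y = on_slit (cov D A Y)"

lemma on_slit [simp]: "u \<in> points (slit M) \<Longrightarrow> on_slit X u = X u" "u \<notin> points (slit M) \<Longrightarrow> on_slit X u = 0"
  by (simp_all add: on_slit_def)

lemma on_slit_eqI: "(\<And>u. u \<in> points (slit M) \<Longrightarrow> X u = Y u) \<Longrightarrow> on_slit X = on_slit Y"
  by (auto simp: on_slit_def)

lemma on_slit_id: "(\<And>u. u \<notin> points (slit M) \<Longrightarrow> X u = 0) \<Longrightarrow> on_slit X = X"
  by (auto simp: on_slit_def)

lemma on_slit_eq: "(\<And>u. u \<notin> points (slit M) \<Longrightarrow> Y u = 0) \<Longrightarrow> (\<And>u. u \<in> points (slit M) \<Longrightarrow> X u = Y u) \<Longrightarrow> on_slit X = Y"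
  by (auto simp: on_slit_def)

lemma on_slit_add: "on_slit (X + Y) = (on_slit X + on_slit Y :: _ \<Rightarrow> _::monoid_add)"
  by (auto simp: on_slit_def fun_eq_iff)

lemma on_slit_diff: "on_slit (X - Y) = (on_slit X - on_slit Y :: _ \<Rightarrow> _::group_add)"
  by (auto simp: on_slit_def fun_eq_iff)

lemma on_slit_uminus: "on_slit (- X) = (- on_slit X :: _ \<Rightarrow> _::group_add)"
  by (auto simp: on_slit_def fun_eq_iff)

lemma VF_iff: "on_slit A \<in> VF \<longleftrightarrow> vector_field (slit M) A"
  using slit.vector_field_cong[of A "on_slit A"] slit.vector_field_cong[of "on_slit A" A] by (auto simp: VF_def)

lemma PF_iff: "on_slit X \<in> PF \<longleftrightarrow> pi_vector_field M X"
  using pi_vector_field_cong[of X "on_slit X"] pi_vector_field_cong[of "on_slit X" X] by (auto simp: PF_def)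

lemma FF_iff: "on_slit f \<in> FF \<longleftrightarrow> smooth_function (slit M) f"
proof -
  have *: "smooth_function (slit M) f'" if f: "smooth_function (slit M) f" and eq: "\<And>u. u \<in> points (slit M) \<Longrightarrow> f u = f' u"
    for f f' :: "('a, 'i, 'e) tvec \<Rightarrow> real"
  proof (rule slit.smooth_functionI)
    fix i assume i: "i \<in> chart_ids (slit M)"
    show "smooth_on (chart_image (slit M) i) (\<lambda>z. f' (chart_inv (slit M) i z))"
      by (rule smooth_on_cong[OF slit.open_image[OF i] slit.smooth_functionD(1)[OF f i]]) (simp add: eq slit.inv_in_points[OF i])
  qed
  show ?thesis using *[of f "on_slit f"] *[of "on_slit f" f] by (auto simp: FF_def)
qed

lemma on_slit_VF [simp]: "A \<in> VF \<Longrightarrow> on_slit A = A" and on_slit_PF [simp]: "X \<in> PF \<Longrightarrow> on_slit X = X"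
  by (auto simp: VF_def PF_def intro!: on_slit_id)

lemma VFD: assumes "A \<in> VF"
  shows "vector_field (slit M) A" "u \<in> points (slit M) \<Longrightarrow> A u \<in> tangent_space (slit M) u"
    "u \<notin> points (slit M) \<Longrightarrow> A u = 0"
  using assms slit.vector_fieldD(1)[of A u] unfolding VF_def by blast+

lemma PFD: assumes "X \<in> PF"
  shows "pi_vector_field M X" "u \<in> points (slit M) \<Longrightarrow> X u \<in> tangent_space M (fst u)"
    "u \<notin> points (slit M) \<Longrightarrow> X u = 0"
  using assms pi_vector_fieldD(1)[of X u] unfolding PF_def by blast+

lemma FFD: assumes "f \<in> FF"
  shows "smooth_function (slit M) f" "u \<notin> points (slit M) \<Longrightarrow> f u = 0"
  using assms unfolding FF_def by blast+

lemma bracket_outside: "u \<notin> points (slit M) \<Longrightarrow> br A B u = 0"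
  by (intro ext) (simp add: bracket_def charts_at_slit_outside)

lemma br_closed: "A \<in> VF \<Longrightarrow> B \<in> VF \<Longrightarrow> br A B \<in> VF"
  using slit.bracket_vector_field bracket_outside by (auto simp: VF_def)

lemma rh_apply: "u \<in> points (slit M) \<Longrightarrow> rh A u = rho M u (A u)" "u \<notin> points (slit M) \<Longrightarrow> rh A u = 0"
  by (simp_all add: rh_def bundle_map_app_def)

lemma rh_closed: "A \<in> VF \<Longrightarrow> rh A \<in> PF"
  unfolding rh_def PF_iff by (intro pi_vector_field_rho VFD)

lemma rh_on_slit: "rh (on_slit A) = on_slit (rho M \<star> A)"
  unfolding rh_def by (rule on_slit_eqI) (simp add: bundle_map_app_def)

lemma ga_closed: assumes "X \<in> PF" shows "ga X \<in> VF"
proof -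
  have "ga X u = 0" if "u \<notin> points (slit M)" for u
    using that by (intro ext) (simp add: ga_def bundle_map_app_def gam_outside)
  then show ?thesis using vector_field_gam[OF PFD(1)[OF assms]] by (simp add: VF_def ga_def)
qed

lemma ga_on_slit: "ga (on_slit X) = on_slit (gam M \<star> X)"
proof
  fix u show "ga (on_slit X) u = on_slit (gam M \<star> X) u"
    by (cases "u \<in> points (slit M)") (auto simp: ga_def bundle_map_app_def gam_outside)
qed

lemma met_closed: "X \<in> PF \<Longrightarrow> Y \<in> PF \<Longrightarrow> met X Y \<in> FF"
  unfolding met_def FF_iff by (intro smooth_finsler_metric PFD)

lemma act_closed: "A \<in> VF \<Longrightarrow> f \<in> FF \<Longrightarrow> act A f \<in> FF"
  unfolding act_def FF_iff by (intro slit.smooth_dfun FFD VFD)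

lemma dfun_on_slit: "u \<in> points (slit M) \<Longrightarrow> dfun (slit M) (on_slit f) u a = dfun (slit M) f u a"
  by (rule slit.dfun_cong) auto

lemma et_closed: "on_slit eta \<in> PF"
  unfolding PF_iff by (rule pi_vector_field_eta)

lemma VF_rho_eta:
  assumes "B \<in> VF" "rh B = Y" "w \<in> points (slit M)" "i \<in> charts_at M (fst w)"
  shows "fst (B w i) = Y w i"
  using rho_apply[OF assms(3) VFD(2)[OF assms(1,3)] assms(4)] assms(2,3) rh_apply(1) by metis

lemma VF_differentiable:
  "B \<in> VF \<Longrightarrow> u \<in> points (slit M) \<Longrightarrow> i \<in> charts_at M (fst u) \<Longrightarrow>
     slit.loc i B differentiable (at (chart_map (slit M) i u))"
  using slit.vector_fieldD(3)[OF VFD(1)] charts_at_slit by blast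

lemma subgrp_carriers: "subgrp VF" "subgrp PF" "subgrp FF"
proof -
  have "vector_field (slit M) 0" unfolding vector_field_def by (auto simp: slit.tangent_zero smooth_on_const)
  then show "subgrp VF" unfolding subgrp_def VF_def by (auto intro: slit.vector_field_diff)
  show "subgrp PF" unfolding subgrp_def PF_def by (auto intro: pi_vector_field_diff pi_vector_field_zero)
  have "smooth_function (slit M) (0 :: ('a, 'i, 'e) tvec \<Rightarrow> real)"
    by (rule slit.smooth_functionI) (simp add: smooth_on_const)
  moreover have "smooth_function (slit M) (f - f')" if "smooth_function (slit M) f" "smooth_function (slit M) f'"
    for f f' :: "('a, 'i, 'e) tvec \<Rightarrow> real"
    using slit.smooth_functionD(1)[OF that(1)] slit.smooth_functionD(1)[OF that(2)]
    by (intro slit.smooth_functionI) (simp add: smooth_on_diff slit.open_image)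
  ultimately show "subgrp FF" unfolding subgrp_def FF_def by auto
qed

lemma met_additive: "Y \<in> PF \<Longrightarrow> additive_on PF (\<lambda>X. met X Y)"
  unfolding additive_on_def
proof (intro ballI ext)
  fix X X' u assume "Y \<in> PF" "X \<in> PF" "X' \<in> PF"
  then show "met (X + X') Y u = (met X Y + met X' Y) u"
    by (cases "u \<in> points (slit M)") (simp_all add: met_def finsler_metric_add PFD(2))
qed

lemma met_sym: "X \<in> PF \<Longrightarrow> Y \<in> PF \<Longrightarrow> met X Y = met Y X"
  unfolding met_def by (intro on_slit_eqI finsler_metric_sym PFD)

lemma met_definite:
  assumes X: "X \<in> PF" and "met X X = 0" shows "X = 0"
proof
  fix u show "X u = 0 u"
  proof (cases "u \<in> points (slit M)")
    case True
    have "finsler_metric L u (X u) (X u) = 0" using fun_cong[OF assms(2), of u] True by (simp add: met_def)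
    then show ?thesis using finsler_metric_definite[OF True PFD(2)[OF X True]] by simp
  qed (simp add: PFD(3)[OF X])
qed

end

section \<open>The algebraic axioms for a Finsler manifold with its spray\<close>

locale finsler_spray = finsler +
  fixes G :: "('a, 'b, 'c) vfield"
  assumes spray: "canonical_spray M L G"
begin

text \<open>Identifies the 1-form d_J E with g(\<eta>, \<rho> _), the form in which the algebraic
  spray axiom is stated.\<close>

lemma d_J_energy:
  assumes u: "u \<in> points (slit M)" and A: "A \<in> VF"
  shows "d_J M (energy L) A u = met (on_slit eta) (rh A) u"
  using dfun_energy_gam[OF u rho_tangent[OF u]] u
  by (simp add: d_J_def bundle_map_app_def Jmap_def met_def rh_apply)

lemma pullback_algebra:
  "pullback_algebra VF PF FF br rh ga (on_slit eta) act met (on_slit (energy L)) (on_slit G)"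
proof
  note [simp] = rh_apply
  show "subgrp VF" "subgrp PF" "subgrp FF" by (fact subgrp_carriers)+
  show "br A B \<in> VF" if "A \<in> VF" "B \<in> VF" for A B using that by (rule br_closed)
  show "additive_on VF (\<lambda>A. br A B)" if "B \<in> VF" for B
    unfolding additive_on_def using slit.bracket_add1 VFD(1) that by blast
  show "br B A = - br A B" for A B by (rule slit.bracket_anti)
  show "br A (br B C) + br B (br C A) + br C (br A B) = 0" if "A \<in> VF" "B \<in> VF" "C \<in> VF" for A B C
    using that by (intro slit.bracket_jacobi VFD)
  show "rh A \<in> PF" if "A \<in> VF" for A using that by (rule rh_closed)
  show "additive_on VF rh"
    unfolding additive_on_def
  proof (intro ballI, rule ext)
    fix A B u assume "A \<in> VF" "B \<in> VF"
    then show "rh (A + B) u = (rh A + rh B) u"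
      using rho_add[of u "A u" "B u"] by (cases "u \<in> points (slit M)") (simp_all add: VFD)
  qed
  show "ga X \<in> VF" if "X \<in> PF" for X using that by (rule ga_closed)
  show "additive_on PF ga" unfolding additive_on_def by (simp add: ga_def bundle_map_app_def gam_add fun_eq_iff)
  show "on_slit eta \<in> PF" by (rule et_closed)
  show "rh (ga X) = 0" if X: "X \<in> PF" for X
  proof
    fix u show "rh (ga X) u = 0 u"
      using rho_gam[OF _ PFD(2)[OF X]] by (cases "u \<in> points (slit M)") (simp_all add: ga_def bundle_map_app_def)
  qed
  show "\<exists>X\<in>PF. A = ga X" if A: "A \<in> VF" and r: "rh A = 0" for A
  proof
    let ?X = "\<lambda>u i. snd (A u i)"
    have r': "rho M u (A u) = 0" if "u \<in> points (slit M)" for u using fun_cong[OF r, of u] that by simp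
    have "pi_vector_field M ?X"
      unfolding pi_vector_field_def
    proof (intro conjI ballI)
      fix u assume u: "u \<in> points (slit M)"
      show "?X u \<in> tangent_space M (fst u)" by (rule vertical_eq_gam(1)[OF u VFD(2)[OF A u] r'[OF u]])
    next
      fix i assume i: "i \<in> chart_ids M"
      then have "i \<in> chart_ids (slit M)" by simp
      from slit.vector_fieldD(2)[OF VFD(1)[OF A] this]
      show "smooth_on (chart_image (slit M) i) (slit.loc i ?X)" by (rule smooth_on_snd[OF slit_open[OF i]])
    qed
    moreover have "?X u = 0" if "u \<notin> points (slit M)" for u
      unfolding VFD(3)[OF A that] by (simp add: zero_fun_def)
    ultimately show X: "?X \<in> PF" unfolding PF_def by blast
    show "A = ga ?X"
    proof
      fix u show "A u = ga ?X u"
      proof (cases "u \<in> points (slit M)")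
        case True
        show ?thesis unfolding ga_def bundle_map_app_def by (rule vertical_eq_gam(2)[OF True VFD(2)[OF A True] r'[OF True]])
      next
        case False
        then have "ga ?X u = 0" using VFD(3)[OF ga_closed[OF X]] by blast
        then show ?thesis using VFD(3)[OF A False] by simp
      qed
    qed
  qed
  show "rh (br (ga X) (ga Y)) = 0" if "X \<in> PF" "Y \<in> PF" for X Y
  proof
    fix u show "rh (br (ga X) (ga Y)) u = 0 u"
      using rho_bracket_gam_gam PFD(1) that by (cases "u \<in> points (slit M)") (simp_all add: ga_def)
  qed
  show "rh (br (ga X) B) = X" if X: "X \<in> PF" and B: "B \<in> VF" and e: "rh B = on_slit eta" for X B
  proof
    fix u show "rh (br (ga X) B) u = X u"
    proof (cases "u \<in> points (slit M)")
      case True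
      have "fst (B w i) = eta w i" if "w \<in> points (slit M)" "i \<in> charts_at M (fst w)" for w i
        using VF_rho_eta[OF B e that] that(1) by simp
      from rho_bracket_gam[OF True PFD(1)[OF X] VF_differentiable[OF B True] this] True
      show ?thesis by (simp add: ga_def)
    qed (simp add: PFD(3)[OF X])
  qed
  show "act A f \<in> FF" if "A \<in> VF" "f \<in> FF" for A f using that by (rule act_closed)
  show "additive_on VF (\<lambda>A. act A f)" if "f \<in> FF" for f
    unfolding additive_on_def
  proof (intro ballI, rule ext)
    fix A B u assume "A \<in> VF" "B \<in> VF"
    then show "act (A + B) f u = (act A f + act B f) u"
      using that by (cases "u \<in> points (slit M)") (simp_all add: act_def slit.dfun_add_vector FFD(1) VFD(2))
  qed
  show "additive_on FF (act A)" if "A \<in> VF" for A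
    unfolding additive_on_def
  proof (intro ballI, rule ext)
    fix f f' u assume "f \<in> FF" "f' \<in> FF"
    then show "act A (f + f') u = (act A f + act A f') u"
      using that slit.dfun_add_fun[OF FFD(1) FFD(1), of f f' u "A u"]
      by (cases "u \<in> points (slit M)") (simp_all add: act_def VFD(2) plus_fun_def)
  qed
  show "act (br A B) f = act A (act B f) - act B (act A f)" if A: "A \<in> VF" and B: "B \<in> VF" and f: "f \<in> FF" for A B f
  proof
    fix u show "act (br A B) f u = (act A (act B f) - act B (act A f)) u"
      using slit.dfun_bracket[OF VFD(1)[OF A] VFD(1)[OF B] FFD(1)[OF f], of u]
      by (cases "u \<in> points (slit M)") (simp_all add: act_def dfun_on_slit)
  qed
  show "met X Y \<in> FF" if "X \<in> PF" "Y \<in> PF" for X Y using that by (rule met_closed)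
  show "met X Y = met Y X" if "X \<in> PF" "Y \<in> PF" for X Y using that by (rule met_sym)
  show "additive_on PF (\<lambda>X. met X Y)" if "Y \<in> PF" for Y using that by (rule met_additive)
  show "X = 0" if "X \<in> PF" "met X X = 0" for X using that by (rule met_definite)
  show "f = 0" if "f + f = 0" for f :: "('a, 'b, 'c) tvec \<Rightarrow> real"
    using that by (simp add: fun_eq_iff)
  show "on_slit (energy L) \<in> FF" unfolding FF_iff by (rule smooth_energy)
  show "act (ga X) (on_slit (energy L)) = met (on_slit eta) X" if X: "X \<in> PF" for X
    unfolding act_def met_def
    by (rule on_slit_eqI) (simp add: dfun_on_slit dfun_energy_gam PFD(2)[OF X] ga_def bundle_map_app_def)
  show "met (on_slit eta) (on_slit eta) = on_slit (energy L) + on_slit (energy L)"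
    unfolding met_def by (rule on_slit_eq) (simp_all add: finsler_metric_eta_eta)
  show "act (ga X) (met (on_slit eta) (rh B)) = met X (rh B) + met (on_slit eta) (rh (br (ga X) B))"
    if X: "X \<in> PF" and B: "B \<in> VF" for X B
  proof
    fix u
    show "act (ga X) (met (on_slit eta) (rh B)) u = (met X (rh B) + met (on_slit eta) (rh (br (ga X) B))) u"
    proof (cases "u \<in> points (slit M)")
      case True
      have "dfun (slit M) (met (on_slit eta) (rh B)) u (gam M u (X u))
          = dfun (slit M) (\<lambda>w. finsler_metric L w (eta w) (rh B w)) u (gam M u (X u))"
        by (rule slit.dfun_cong[OF _ True]) (simp add: met_def del: rh_apply)
      also have "\<dots> = finsler_metric L u (X u) (rh B u) + finsler_metric L u (eta u) (rho M u (br (gam M \<star> X) B u))"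
        by (rule dfun_gam_metric_eta[OF True PFD(1)[OF X] PFD(1)[OF rh_closed[OF B]] VF_differentiable[OF B True] VF_rho_eta[OF B refl]])
      finally show ?thesis using True by (simp add: act_def met_def ga_def bundle_map_app_def)
    qed (simp add: act_def met_def)
  qed
  have G: "vector_field (slit M) G" using spray unfolding canonical_spray_def by blast
  then show G': "on_slit G \<in> VF" by (simp add: VF_iff)
  show "act (on_slit G) (met (on_slit eta) (rh A)) - act A (met (on_slit eta) (rh (on_slit G)))
      - met (on_slit eta) (rh (br (on_slit G) A)) = - act A (on_slit (energy L))" if A: "A \<in> VF" for A
  proof
    fix u
    show "(act (on_slit G) (met (on_slit eta) (rh A)) - act A (met (on_slit eta) (rh (on_slit G)))
      - met (on_slit eta) (rh (br (on_slit G) A))) u = (- act A (on_slit (energy L))) u"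
    proof (cases "u \<in> points (slit M)")
      case True
      have "ext_deriv (slit M) (d_J M (energy L)) G A u = - dfun (slit M) (energy L) u (A u)"
        using spray VFD(1)[OF A] True unfolding canonical_spray_def by blast
      moreover have "dfun (slit M) (d_J M (energy L) A) u (G u) = dfun (slit M) (met (on_slit eta) (rh A)) u (G u)"
        by (rule slit.dfun_cong[OF d_J_energy[OF _ A] True])
      moreover have "dfun (slit M) (d_J M (energy L) G) u (A u) = dfun (slit M) (met (on_slit eta) (rh (on_slit G))) u (A u)"
      proof (rule slit.dfun_cong[OF _ True])
        fix q assume q: "q \<in> points (slit M)"
        have "d_J M (energy L) G q = d_J M (energy L) (on_slit G) q" using q by (simp add: d_J_def bundle_map_app_def)
        then show "d_J M (energy L) G q = met (on_slit eta) (rh (on_slit G)) q" using d_J_energy[OF q G'] by simp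
      qed
      moreover have "br G A = br (on_slit G) A" by (intro ext) (simp add: slit.bracket_cong[of G "on_slit G" A A])
      moreover have "d_J M (energy L) (br (on_slit G) A) u = met (on_slit eta) (rh (br (on_slit G) A)) u"
        by (rule d_J_energy[OF True br_closed[OF G' A]])
      ultimately show ?thesis using True by (simp add: ext_deriv_def act_def dfun_on_slit)
    qed (simp add: act_def met_def)
  qed
qed

end

section \<open>The Cartan and Chern connections\<close>

context finsler
begin

lemma con_apply: "u \<in> points (slit M) \<Longrightarrow> con D A Y u = D u (A u) Y" "u \<notin> points (slit M) \<Longrightarrow> con D A Y u = 0"
  by (simp_all add: con_def cov_def)

lemma con_on_slit:
  assumes "linear_connection M D" "vector_field (slit M) A" "pi_vector_field M Y"
  shows "on_slit (cov D A Y) = con D (on_slit A) (on_slit Y)"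
  unfolding con_def
proof (rule on_slit_eqI)
  fix u assume u: "u \<in> points (slit M)"
  have "D u (A u) Y = D u (A u) (on_slit Y)"
    by (rule connection_cong[OF assms(1) u slit.vector_fieldD(1)[OF assms(2) u] assms(3)]) simp
  then show "cov D A Y u = cov D (on_slit A) (on_slit Y) u" using u by (simp add: cov_def)
qed

lemma con_closed: "linear_connection M D \<Longrightarrow> A \<in> VF \<Longrightarrow> Y \<in> PF \<Longrightarrow> con D A Y \<in> PF"
  unfolding con_def PF_iff by (intro linear_connectionD(1) VFD(1) PFD(1))

lemma con_additive:
  assumes D: "linear_connection M D"
  shows "Y \<in> PF \<Longrightarrow> additive_on VF (\<lambda>A. con D A Y)" "A \<in> VF \<Longrightarrow> additive_on PF (con D A)"
proof -
  show "additive_on VF (\<lambda>A. con D A Y)" if Y: "Y \<in> PF"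
    unfolding additive_on_def
  proof (intro ballI, rule ext)
    fix A B u assume A: "A \<in> VF" and B: "B \<in> VF"
    show "con D (A + B) Y u = (con D A Y + con D B Y) u"
    proof (cases "u \<in> points (slit M)")
      case True
      have "con D (A + B) Y u = D u (A u + B u) Y" by (simp only: con_apply(1)[OF True] plus_fun_apply[of A B u])
      also have "\<dots> = con D A Y u + con D B Y u"
        unfolding con_apply(1)[OF True]
        by (rule linear_connectionD(3)[OF D True VFD(2)[OF A True] VFD(2)[OF B True] PFD(1)[OF Y]])
      also have "\<dots> = (con D A Y + con D B Y) u" by (rule plus_fun_apply[symmetric])
      finally show ?thesis .
    qed (simp add: con_apply)
  qed
  show "additive_on PF (con D A)" if A: "A \<in> VF"
    unfolding additive_on_def
  proof (intro ballI, rule ext)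
    fix X Y u assume X: "X \<in> PF" and Y: "Y \<in> PF"
    show "con D A (X + Y) u = (con D A X + con D A Y) u"
    proof (cases "u \<in> points (slit M)")
      case True
      have "con D A (X + Y) u = con D A X u + con D A Y u"
        unfolding con_apply(1)[OF True]
        by (rule linear_connectionD(5)[OF D True VFD(2)[OF A True] PFD(1)[OF X] PFD(1)[OF Y]])
      also have "\<dots> = (con D A X + con D A Y) u" by (rule plus_fun_apply[symmetric])
      finally show ?thesis .
    qed (simp add: con_apply)
  qed
qed

lemma con_eta:
  assumes "linear_connection M D" "u \<in> points (slit M)" "A \<in> VF"
  shows "con D A (on_slit eta) u = Kmap D u (A u)"
  unfolding con_apply(1)[OF assms(2)] Kmap_def
  by (rule connection_cong[OF assms(1,2) VFD(2)[OF assms(3,2)] pi_vector_field_eta, symmetric]) simp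

lemma on_slit_br: "on_slit (br A B) = br (on_slit A) (on_slit B)"
proof -
  have "on_slit (br A B) = br A B" by (rule on_slit_id) (rule bracket_outside)
  also have "br A B = br (on_slit A) (on_slit B)" by (rule ext) (rule slit.bracket_cong; simp)
  finally show ?thesis .
qed

lemma on_slit_torsion:
  assumes D: "linear_connection M D" and A: "vector_field (slit M) A" and B: "vector_field (slit M) B"
  shows "on_slit (torsion M D A B)
    = con D (on_slit A) (rh (on_slit B)) - con D (on_slit B) (rh (on_slit A)) - rh (br (on_slit A) (on_slit B))"
  unfolding torsion_def on_slit_diff rh_on_slit on_slit_br[symmetric]
  by (simp only: con_on_slit[OF D] A B pi_vector_field_rho)

lemma on_slit_curvature:
  assumes D: "linear_connection M D" and A: "vector_field (slit M) A" and B: "vector_field (slit M) B"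
    and Z: "pi_vector_field M Z"
  shows "on_slit (curvature M D A B Z)
    = - con D (on_slit A) (con D (on_slit B) (on_slit Z)) + con D (on_slit B) (con D (on_slit A) (on_slit Z))
      + con D (br (on_slit A) (on_slit B)) (on_slit Z)"
  unfolding curvature_def on_slit_add on_slit_uminus on_slit_br[symmetric]
  by (simp only: con_on_slit[OF D, symmetric] A B Z linear_connectionD(1)[OF D] slit.bracket_vector_field)

lemma met_apply: "u \<in> points (slit M) \<Longrightarrow> met X Y u = finsler_metric L u (X u) (Y u)"
  by (simp add: met_def)

lemma act_met_apply:
  assumes "u \<in> points (slit M)"
  shows "act A (met Y Z) u = dfun (slit M) (\<lambda>w. finsler_metric L w (Y w) (Z w)) u (A u)"
  unfolding act_def on_slit(1)[OF assms] by (rule slit.dfun_cong[OF _ assms]) (simp add: met_def)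

lemma finsler_metric_diff:
  assumes u: "u \<in> points (slit M)" and v: "v \<in> tangent_space M (fst u)" and v': "v' \<in> tangent_space M (fst u)"
    and w: "w \<in> tangent_space M (fst u)"
  shows "finsler_metric L u (v - v') w = finsler_metric L u v w - finsler_metric L u v' w"
  using finsler_metric_add[OF u base.tangent_diff[OF v v'] v' w] by simp

lemma connection_zero:
  assumes D: "linear_connection M D" and u: "u \<in> points (slit M)" and a: "a \<in> tangent_space (slit M) u"
  shows "D u a 0 = 0"
proof -
  have "D u a 0 + D u a 0 = D u a 0 + 0"
    using linear_connectionD(5)[OF D u a pi_vector_field_zero pi_vector_field_zero] by (simp only: add_0_right)
  then show ?thesis by (simp only: add_left_cancel)
qed

text \<open>A connection depends on the differentiating vector pointwise, so the torsion can be
  expanded before the lift is known to be smooth. The term with \<rho>\<gamma>X vanishes because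
  this is the zero section on the slit bundle.\<close>

lemma hv_torsion_apply:
  assumes D: "regular_connection M D" and u: "u \<in> points (slit M)"
    and X: "pi_vector_field M X" and Z: "pi_vector_field M Z"
  shows "hv_torsion M D X Z u = D u (gam M u (X u)) Z - rho M u (br (gam M \<star> X) (beta M D \<star> Z) u)"
proof -
  note lin = regular_linear[OF D]
  note b = beta_props[OF D _ pi_vector_fieldD(1)[OF Z]]
  have "cov D (gam M \<star> X) (rho M \<star> (beta M D \<star> Z)) u = D u (gam M u (X u)) Z"
    unfolding cov_def bundle_map_app_def
    by (rule connection_cong[OF lin u gam_tangent[OF u pi_vector_fieldD(1)[OF X u]] Z, symmetric]) (simp add: b(3))
  moreover have "cov D (beta M D \<star> Z) (rho M \<star> (gam M \<star> X)) u = D u (beta M D u (Z u)) 0"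
    unfolding cov_def bundle_map_app_def
    by (rule connection_cong[OF lin u b(1)[OF u u] pi_vector_field_zero, symmetric])
      (simp add: rho_gam pi_vector_fieldD(1)[OF X])
  ultimately show ?thesis
    by (simp add: hv_torsion_def torsion_def connection_zero[OF lin u b(1)[OF u u]])
      (simp add: bundle_map_app_def)
qed

end

sublocale finsler_spray \<subseteq> pa: pullback_algebra VF PF FF br rh ga "on_slit eta" act met "on_slit (energy L)" "on_slit G"
  by (rule pullback_algebra)

section \<open>The Cartan connection\<close>

locale finsler_cartan = finsler_spray +
  fixes C :: "('a, 'b, 'c) connection"
  assumes cartan: "cartan_connection M L C"
begin

lemma C_regular: "regular_connection M C" and C_linear: "linear_connection M C"
  using cartan regular_linear unfolding cartan_connection_def by blast+

text \<open>The lift supplied by the spray serves as the smooth lift from which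
  \<open>beta_differentiable\<close> starts.\<close>

lemma cartan_beta:
  assumes Z: "pi_vector_field M Z" and u: "u \<in> points (slit M)" and i: "i \<in> charts_at M (fst u)"
  shows "slit.loc i (beta M C \<star> Z) differentiable (at (chart_map (slit M) i u))"
    and "fst ((beta M C \<star> Z) u i) = Z u i"
proof -
  have Z': "on_slit Z \<in> PF" using Z by (simp add: PF_iff)
  have r: "rho M w (pa.lift (on_slit Z) w) = Z w" if "w \<in> points (slit M)" for w
    using fun_cong[OF pa.rh_lift[OF Z'], of w] that by (simp add: rh_apply)
  have "Hausdorff_space (manifold_topology M)" using manifold unfolding smooth_manifold_def by (elim conjE)
  then show "slit.loc i (beta M C \<star> Z) differentiable (at (chart_map (slit M) i u))"
    by (rule beta_differentiable[OF _ C_regular Z VFD(1)[OF pa.lift_closed[OF Z']] r u i])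
  note b = beta_props[OF C_regular u pi_vector_fieldD(1)[OF Z u]]
  show "fst ((beta M C \<star> Z) u i) = Z u i"
    using rho_apply[OF u b(1) i] b(3) by (simp add: bundle_map_app_def)
qed

text \<open>
  \<open>T(X, \<eta>) = K \<gamma> X - X\<close>, while metricity gives \<open>g(T(X, Z), \<eta>) = g(X - K \<gamma> X, Z)\<close>; by the symmetry
  condition on \<open>T\<close>, the latter is \<open>g(T(X, \<eta>), Z)\<close>, which therefore equals its own negative.
\<close>

lemma K_gam:
  assumes X: "X \<in> PF" and u: "u \<in> points (slit M)"
  shows "Kmap C u (gam M u (X u)) = X u"
proof -
  define N where "N = con C (ga X) (on_slit eta)"
  \<comment> \<open>The quantity whose vanishing is claimed is itself used as the test
    section.\<close>
  define Z where "Z = N - X"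
  have N: "N \<in> PF" unfolding N_def by (rule con_closed[OF C_linear ga_closed[OF X] et_closed])
  have Z: "Z \<in> PF" unfolding Z_def using N X by simp
  let ?m = "finsler_metric L u" and ?r = "rho M u (br (gam M \<star> X) (beta M C \<star> Z) u)"
  let ?CZ = "C u (gam M u (X u)) Z"
  note t = PFD(2)[OF X u] PFD(2)[OF N u] PFD(2)[OF Z u] rho_tangent[OF u]
    pi_vector_fieldD(1)[OF pi_vector_field_eta u]
    linear_connectionD(2)[OF C_linear u gam_tangent[OF u PFD(2)[OF X u]] PFD(1)[OF Z]]
  have Nu: "N u = Kmap C u (gam M u (X u))"
    using con_eta[OF C_linear u ga_closed[OF X]] by (simp add: N_def ga_def bundle_map_app_def)
  have Zu: "Z u = N u - X u" by (simp add: Z_def)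
  have "rho M u (br (gam M \<star> X) (beta M C \<star> eta) u) = X u"
    by (rule rho_bracket_gam[OF u PFD(1)[OF X] cartan_beta(1)[OF pi_vector_field_eta u] cartan_beta(2)[OF pi_vector_field_eta]])
  then have T1: "hv_torsion M C X eta u = Z u"
    using hv_torsion_apply[OF C_regular u PFD(1)[OF X] pi_vector_field_eta] Nu by (simp add: Zu Kmap_def)
  have T2: "hv_torsion M C X Z u = ?CZ - ?r"
    by (rule hv_torsion_apply[OF C_regular u PFD(1)[OF X] PFD(1)[OF Z]])
  have "?m (hv_torsion M C X eta u) (Z u) = ?m (hv_torsion M C X Z u) (eta u)"
    using cartan u PFD(1)[OF X] PFD(1)[OF Z] pi_vector_field_eta unfolding cartan_connection_def by blast
  then have 1: "?m (Z u) (Z u) = ?m ?CZ (eta u) - ?m ?r (eta u)"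
    unfolding T1 T2 by (simp only: finsler_metric_diff[OF u t(6) t(4) t(5)])
  have "dfun (slit M) (\<lambda>w. finsler_metric L w (eta w) (Z w)) u (gam M u (X u)) = ?m (X u) (Z u) + ?m (eta u) ?r"
    by (rule dfun_gam_metric_eta[OF u PFD(1)[OF X] PFD(1)[OF Z] cartan_beta(1)[OF PFD(1)[OF Z] u] cartan_beta(2)[OF PFD(1)[OF Z]]])
  moreover have "cov_metric M L C (gam M \<star> X) eta Z u = 0"
    using cartan u vector_field_gam[OF PFD(1)[OF X]] PFD(1)[OF Z] pi_vector_field_eta
    unfolding cartan_connection_def by blast
  then have "dfun (slit M) (\<lambda>w. finsler_metric L w (eta w) (Z w)) u (gam M u (X u)) = ?m (N u) (Z u) + ?m (eta u) ?CZ"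
    unfolding cov_metric_def by (simp add: cov_def bundle_map_app_def Nu Kmap_def)
  ultimately have "?m (X u) (Z u) + ?m (eta u) ?r = ?m (N u) (Z u) + ?m (eta u) ?CZ" by simp
  moreover have "?m (Z u) (Z u) = ?m (N u) (Z u) - ?m (X u) (Z u)"
    unfolding Zu by (rule finsler_metric_diff[OF u t(2) t(1)]) (simp only: Zu[symmetric] t(3))
  ultimately have "?m (Z u) (Z u) = 0"
    using 1 finsler_metric_sym[OF u t(5) t(6)] finsler_metric_sym[OF u t(5) t(4)] by simp
  then have "Z u = 0" by (rule finsler_metric_definite[OF u t(3)])
  then show ?thesis using Zu Nu by simp
qed

lemma con_metric:
  assumes "A \<in> VF" "Y \<in> PF" "Z \<in> PF"
  shows "act A (met Y Z) = met (con C A Y) Z + met Y (con C A Z)"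
proof
  fix u show "act A (met Y Z) u = (met (con C A Y) Z + met Y (con C A Z)) u"
  proof (cases "u \<in> points (slit M)")
    case True
    have "cov_metric M L C A Y Z u = 0"
      using cartan True VFD(1)[OF assms(1)] PFD(1)[OF assms(2)] PFD(1)[OF assms(3)]
      unfolding cartan_connection_def by blast
    then show ?thesis using True by (simp add: cov_metric_def act_met_apply met_apply con_apply cov_def)
  qed (simp add: act_def met_def)
qed

end

sublocale finsler_cartan \<subseteq> pa: cartan_algebra VF PF FF br rh ga "on_slit eta" act met "on_slit (energy L)" "on_slit G" "con C"
proof
  show "con C A Y \<in> PF" if "A \<in> VF" "Y \<in> PF" for A Y by (rule con_closed[OF C_linear that])
  show "additive_on VF (\<lambda>A. con C A Y)" if "Y \<in> PF" for Y by (rule con_additive(1)[OF C_linear that])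
  show "additive_on PF (con C A)" if "A \<in> VF" for A by (rule con_additive(2)[OF C_linear that])
  show "con C (ga X) (on_slit eta) = X" if X: "X \<in> PF" for X
  proof
    fix u show "con C (ga X) (on_slit eta) u = X u"
    proof (cases "u \<in> points (slit M)")
      case True
      then show ?thesis
        using con_eta[OF C_linear True ga_closed[OF X]] K_gam[OF X True] by (simp add: ga_def bundle_map_app_def)
    qed (simp add: con_apply PFD(3)[OF X])
  qed
  show "act A (met Y Z) = met (con C A Y) Z + met Y (con C A Z)" if "A \<in> VF" "Y \<in> PF" "Z \<in> PF" for A Y Z
    using that by (rule con_metric)
qed

context finsler
begin

text \<open>The horizontal lift is unique, so a smooth field with the right \<rho> and K agrees with
  it on the slit bundle. This replaces the pointwise inverse \<open>beta\<close> by the algebraic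
  lifts \<open>hor\<close> and \<open>be\<close>.\<close>

lemma on_slit_beta_eqI:
  assumes D: "regular_connection M D" and A: "A \<in> VF" and r: "rh A = on_slit X"
    and K: "con D A (on_slit eta) = 0"
  shows "on_slit (beta M D \<star> X) = A"
proof (rule on_slit_eq)
  fix u assume u: "u \<in> points (slit M)"
  have "Kmap D u (A u) = 0" using con_eta[OF regular_linear[OF D] u A] K by simp
  moreover have "rho M u (A u) = X u" using fun_cong[OF r, of u] u by (simp add: rh_apply)
  ultimately show "(beta M D \<star> X) u = A u"
    using beta_unique[OF D u VFD(2)[OF A u]] by (simp add: bundle_map_app_def)
qed (rule VFD(3)[OF A])

end

context finsler_cartan
begin

lemma on_slit_beta_C: "pi_vector_field M X \<Longrightarrow> on_slit (beta M C \<star> X) = pa.hor (on_slit X)"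
  by (rule on_slit_beta_eqI[OF C_regular]) (simp_all add: PF_iff)

text \<open>With K \<gamma> = 1 established, the lift is a smooth field minus its smooth vertical
  part; what was only differentiable so far is seen to be smooth.\<close>

lemma beta_C_vector_field: "pi_vector_field M X \<Longrightarrow> vector_field (slit M) (beta M C \<star> X)"
  unfolding VF_iff[symmetric] by (simp add: on_slit_beta_C PF_iff)

lemma on_slit_hv_torsion:
  assumes X: "pi_vector_field M X" and Y: "pi_vector_field M Y"
  shows "on_slit (hv_torsion M C X Y) = pa.tor (on_slit X) (on_slit Y)"
proof -
  note vf = vector_field_gam[OF X] beta_C_vector_field[OF Y]
  have "on_slit X \<in> PF" "on_slit Y \<in> PF" using X Y by (simp_all add: PF_iff)
  then show ?thesis
    unfolding hv_torsion_def on_slit_torsion[OF C_linear vf] pa.tor_def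
    by (simp add: on_slit_beta_C[OF Y] ga_on_slit[symmetric])
qed

lemma con_Q:
  assumes X: "X \<in> PF" and Y: "Y \<in> PF"
  shows "con C (pa.hor X) Y - con C (pa.hor Y) X = rh (br (pa.hor X) (pa.hor Y))"
proof -
  have "on_slit (h_torsion M C X Y) = 0"
    using cartan PFD(1)[OF X] PFD(1)[OF Y] unfolding cartan_connection_def by (intro on_slit_eq) auto
  then show ?thesis
    unfolding h_torsion_def on_slit_torsion[OF C_linear beta_C_vector_field[OF PFD(1)[OF X]] beta_C_vector_field[OF PFD(1)[OF Y]]]
    using X Y by (simp add: on_slit_beta_C PFD(1))
qed

lemma tor_sym:
  assumes X: "X \<in> PF" and Y: "Y \<in> PF" and Z: "Z \<in> PF"
  shows "met (pa.tor X Y) Z = met (pa.tor X Z) Y"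
proof -
  have t: "pa.tor X Y = on_slit (hv_torsion M C X Y)" if "Y \<in> PF" for Y
    using on_slit_hv_torsion[OF PFD(1)[OF X] PFD(1)[OF that]] X that by simp
  show ?thesis unfolding t[OF Y] t[OF Z] met_def
  proof (rule on_slit_eqI)
    fix u assume u: "u \<in> points (slit M)"
    show "finsler_metric L u (on_slit (hv_torsion M C X Y) u) (Z u) = finsler_metric L u (on_slit (hv_torsion M C X Z) u) (Y u)"
      using cartan u PFD(1)[OF X] PFD(1)[OF Y] PFD(1)[OF Z] unfolding on_slit(1)[OF u] cartan_connection_def by blast
  qed
qed

end

section \<open>The Chern connection\<close>

locale finsler_chern = finsler_cartan +
  fixes D :: "('a, 'b, 'c) connection"
  assumes chern: "chern_connection M L C D"
begin

lemma D_regular: "regular_connection M D" and D_linear: "linear_connection M D"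
  using chern regular_linear unfolding chern_connection_def by blast+

end

sublocale finsler_chern \<subseteq> pa: cartan_chern_algebra VF PF FF br rh ga "on_slit eta" act met "on_slit (energy L)" "on_slit G" "con C" "con D"
proof -
  \<comment> \<open>The candidate \<nabla> - T(K _, _) is a model of the algebra; additivity of T
    and T(_, \<eta>) = 0 are read off from it, while the conditions on the connection are checked
    for \<open>D\<close> itself.\<close>
  interpret D': chern_algebra VF PF FF br rh ga "on_slit eta" act met "on_slit (energy L)" "on_slit G" pa.tor
    "\<lambda>A Y. con C A Y - pa.tor (con C A (on_slit eta)) Y"
    by (rule pa.chern_algebra[OF con_Q tor_sym])
  show "cartan_chern_algebra VF PF FF br rh ga (on_slit eta) act met (on_slit (energy L)) (on_slit G) (con C) (con D)"
  proof
    show "pa.tor X Y \<in> PF" if "X \<in> PF" "Y \<in> PF" for X Y using that by (rule D'.T_closed)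
    show "additive_on PF (\<lambda>X. pa.tor X Y)" if "Y \<in> PF" for Y using that by (rule D'.T_additive)
    show "additive_on PF (pa.tor Y)" if "Y \<in> PF" for Y using that by (rule D'.T_additive)
    show "met (pa.tor X Y) Z = met (pa.tor X Z) Y" if "X \<in> PF" "Y \<in> PF" "Z \<in> PF" for X Y Z using that by (rule tor_sym)
    show "pa.tor X (on_slit eta) = 0" if "X \<in> PF" for X using that by (rule D'.T_et)
    show "con D A Y \<in> PF" if "A \<in> VF" "Y \<in> PF" for A Y by (rule con_closed[OF D_linear that])
    show "additive_on VF (\<lambda>A. con D A Y)" if "Y \<in> PF" for Y by (rule con_additive(1)[OF D_linear that])
    show "additive_on PF (con D A)" if "A \<in> VF" for A by (rule con_additive(2)[OF D_linear that])
    show "con D A (rh B) - con D B (rh A) = rh (br A B)" if A: "A \<in> VF" and B: "B \<in> VF" for A B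
    proof -
      have "on_slit (torsion M D A B) = 0"
        using chern VFD(1)[OF A] VFD(1)[OF B] unfolding chern_connection_def by (intro on_slit_eq) auto
      then show ?thesis using A B by (simp add: on_slit_torsion[OF D_linear VFD(1)[OF A] VFD(1)[OF B]])
    qed
    show "act A (met Y Z) = met (con D A Y) Z + met Y (con D A Z)
        + met (pa.tor (con D A (on_slit eta)) Y) Z + met (pa.tor (con D A (on_slit eta)) Y) Z"
      if A: "A \<in> VF" and Y: "Y \<in> PF" and Z: "Z \<in> PF" for A Y Z
    proof
      have K: "pi_vector_field M (Kmap D \<star> A)"
        using linear_connectionD(1)[OF D_linear VFD(1)[OF A] pi_vector_field_eta]
        by (simp add: cov_def[abs_def] bundle_map_app_def Kmap_def)
      have "on_slit (Kmap D \<star> A) = con D A (on_slit eta)"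
        using con_on_slit[OF D_linear VFD(1)[OF A] pi_vector_field_eta] A
        by (simp add: cov_def[abs_def] bundle_map_app_def Kmap_def)
      then have T: "pa.tor (con D A (on_slit eta)) Y = on_slit (hv_torsion M C (Kmap D \<star> A) Y)"
        using on_slit_hv_torsion[OF K PFD(1)[OF Y]] Y by simp
      fix u
      show "act A (met Y Z) u = (met (con D A Y) Z + met Y (con D A Z)
        + met (pa.tor (con D A (on_slit eta)) Y) Z + met (pa.tor (con D A (on_slit eta)) Y) Z) u"
      proof (cases "u \<in> points (slit M)")
        case True
        have "cov_metric M L D A Y Z u = 2 * finsler_metric L u (hv_torsion M C (Kmap D \<star> A) Y u) (Z u)"
          using chern True VFD(1)[OF A] PFD(1)[OF Y] PFD(1)[OF Z] unfolding chern_connection_def by blast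
        then show ?thesis using True by (simp add: T cov_metric_def act_met_apply met_apply con_apply cov_def)
      qed (simp add: act_def met_def)
    qed
    show "con C (pa.hor X) Y - con C (pa.hor Y) X = rh (br (pa.hor X) (pa.hor Y))" if "X \<in> PF" "Y \<in> PF" for X Y
      using that by (rule con_Q)
  qed
qed

context finsler_chern
begin

lemma on_slit_beta_D: "pi_vector_field M X \<Longrightarrow> on_slit (beta M D \<star> X) = pa.be (on_slit X)"
  by (rule on_slit_beta_eqI[OF D_regular]) (simp_all add: PF_iff)

text \<open>Both connections have the same K on smooth fields, hence the same horizontal
  lifts.\<close>

lemma on_slit_beta_C_be: "pi_vector_field M X \<Longrightarrow> on_slit (beta M C \<star> X) = pa.be (on_slit X)"
  by (simp add: on_slit_beta_C pa.hor_eq PF_iff)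

lemma beta_D_vector_field: "pi_vector_field M X \<Longrightarrow> vector_field (slit M) (beta M D \<star> X)"
  unfolding VF_iff[symmetric] by (simp add: on_slit_beta_D PF_iff)

lemma on_slit_gam: "pi_vector_field M X \<Longrightarrow> on_slit (gam M \<star> X) = ga (on_slit X)"
  by (simp add: ga_on_slit)

lemma on_slit_h_curvature:
  assumes X: "pi_vector_field M X" and Y: "pi_vector_field M Y" and Z: "pi_vector_field M Z"
  shows "on_slit (h_curvature M D X Y Z) = pa.curv (con D) (pa.be (on_slit X)) (pa.be (on_slit Y)) (on_slit Z)"
  unfolding h_curvature_def pa.curv_def
    on_slit_curvature[OF D_linear beta_D_vector_field[OF X] beta_D_vector_field[OF Y] Z]
  by (simp only: on_slit_beta_D X Y)

lemma on_slit_hv_curvature: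
  assumes X: "pi_vector_field M X" and Y: "pi_vector_field M Y" and Z: "pi_vector_field M Z"
  shows "on_slit (hv_curvature M D X Y Z) = pa.curv (con D) (pa.be (on_slit X)) (ga (on_slit Y)) (on_slit Z)"
  unfolding hv_curvature_def pa.curv_def
    on_slit_curvature[OF D_linear beta_D_vector_field[OF X] vector_field_gam[OF Y] Z]
  by (simp only: on_slit_beta_D ga_on_slit X Y)

lemma on_slit_cartan_h_curvature:
  assumes X: "pi_vector_field M X" and Y: "pi_vector_field M Y"
  shows "on_slit (contract_eta (h_curvature M C) X Y)
    = pa.curv (con D) (pa.be (on_slit X)) (pa.be (on_slit Y)) (on_slit eta)"
proof -
  have "on_slit (contract_eta (h_curvature M C) X Y) = pa.curv (con C) (pa.be (on_slit X)) (pa.be (on_slit Y)) (on_slit eta)"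
    unfolding contract_eta_def h_curvature_def pa.curv_def
      on_slit_curvature[OF C_linear beta_C_vector_field[OF X] beta_C_vector_field[OF Y] pi_vector_field_eta]
    by (simp only: on_slit_beta_C_be X Y)
  then show ?thesis using X Y by (simp add: pa.curv_C_be_be PF_iff)
qed

lemma on_slit_cartan_hv_curvature:
  assumes X: "pi_vector_field M X" and Y: "pi_vector_field M Y"
  shows "on_slit (contract_eta (hv_curvature M C) X Y)
    = pa.curv (con D) (pa.be (on_slit X)) (ga (on_slit Y)) (on_slit eta)"
proof -
  have "on_slit (contract_eta (hv_curvature M C) X Y) = pa.curv (con C) (pa.be (on_slit X)) (ga (on_slit Y)) (on_slit eta)"
    unfolding contract_eta_def hv_curvature_def pa.curv_def
      on_slit_curvature[OF C_linear beta_C_vector_field[OF X] vector_field_gam[OF Y] pi_vector_field_eta]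
    by (simp only: on_slit_beta_C_be ga_on_slit X Y)
  then show ?thesis using X Y by (simp add: pa.curv_C_be_ga PF_iff)
qed

lemma on_slit_cov_tensor:
  assumes A: "vector_field (slit M) A"
    and B: "\<And>X Y Z. pi_vector_field M X \<Longrightarrow> pi_vector_field M Y \<Longrightarrow> pi_vector_field M Z \<Longrightarrow>
      on_slit (B X Y Z) = B' (on_slit X) (on_slit Y) (on_slit Z)"
    and B': "\<And>X Y Z. X \<in> PF \<Longrightarrow> Y \<in> PF \<Longrightarrow> Z \<in> PF \<Longrightarrow> B' X Y Z \<in> PF"
    and X: "pi_vector_field M X" and Y: "pi_vector_field M Y" and Z: "pi_vector_field M Z"
  shows "on_slit (cov_tensor D A B X Y Z) = pa.covt (con D) (on_slit A) B' (on_slit X) (on_slit Y) (on_slit Z)"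
proof -
  have "pi_vector_field M (B X Y Z)" using B'[of "on_slit X" "on_slit Y" "on_slit Z"] X Y Z
    by (simp add: PF_iff B[OF X Y Z, symmetric])
  then show ?thesis
    unfolding cov_tensor_def pa.covt_def on_slit_diff
    by (simp only: B X Y Z con_on_slit[OF D_linear A] linear_connectionD(1)[OF D_linear A])
qed

lemma on_slit_cov_h_curvature:
  assumes "vector_field (slit M) A" "pi_vector_field M X" "pi_vector_field M Y" "pi_vector_field M Z"
  shows "on_slit (cov_tensor D A (h_curvature M D) X Y Z)
    = pa.covt (con D) (on_slit A) pa.R (on_slit X) (on_slit Y) (on_slit Z)"
  by (rule on_slit_cov_tensor[where B = "h_curvature M D" and B' = pa.R, OF assms(1) on_slit_h_curvature _ assms(2-4)]) simp_all

lemma on_slit_cov_hv_curvature: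
  assumes "vector_field (slit M) A" "pi_vector_field M X" "pi_vector_field M Y" "pi_vector_field M Z"
  shows "on_slit (cov_tensor D A (hv_curvature M D) X Y Z)
    = pa.covt (con D) (on_slit A) pa.P (on_slit X) (on_slit Y) (on_slit Z)"
  by (rule on_slit_cov_tensor[where B = "hv_curvature M D" and B' = pa.P, OF assms(1) on_slit_hv_curvature _ assms(2-4)]) simp_all

section \<open>The curvature of the Barthel connection\<close>

lemma on_slit_barthel:
  assumes A: "A \<in> VF" shows "on_slit (barthel M G A) = pa.be (rh A) + pa.be (rh A) - A"
proof -
  have J: "on_slit (Jmap M \<star> B) = ga (rh (on_slit B))" for B
    unfolding rh_on_slit ga_on_slit by (rule on_slit_eqI) (simp add: bundle_map_app_def Jmap_def)
  have "on_slit (barthel M G A) = br (ga (rh A)) (on_slit G) - ga (rh (br A (on_slit G)))"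
    using A by (simp only: barthel_def on_slit_diff on_slit_br J on_slit_VF)
  then show ?thesis using pa.barthel_eq[OF A] by simp
qed

text \<open>\<Gamma> = 2\<beta>\<rho> - 1 makes h = \<beta>\<rho> and v = 1 - \<beta>\<rho>, so
  horizontal lifts are fixed by h and the curvature is -v[\<beta>X, \<beta>Y]. K kills the \<beta>
  part and turns the rest into -K[\<beta>X, \<beta>Y], which is minus \<open>Rh\<close>.\<close>

lemma barthel_curvature_eq:
  assumes X: "pi_vector_field M X" and Y: "pi_vector_field M Y" and u: "u \<in> points (slit M)"
  shows "(Kmap C \<star> barthel_curvature M G (beta M C \<star> X) (beta M C \<star> Y)) u
    = - contract_eta (h_curvature M C) X Y u"
proof -
  define A B where AB: "A = pa.be (on_slit X)" "B = pa.be (on_slit Y)"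
  have X': "on_slit X \<in> PF" and Y': "on_slit Y \<in> PF" using X Y by (simp_all add: PF_iff)
  have AB_VF: "A \<in> VF" "B \<in> VF" using X' Y' by (simp_all add: AB)
  \<comment> \<open>Brackets and J only see values on the slit bundle, so a field may be replaced by
    its truncation, to which \<open>on_slit_barthel\<close> applies.\<close>
  have barthel_cong: "on_slit (barthel M G A) = on_slit (barthel M G (on_slit A))" for A
  proof -
    have J': "on_slit (Jmap M \<star> B) = ga (rh (on_slit B))" for B
      unfolding rh_on_slit ga_on_slit by (rule on_slit_eqI) (simp add: bundle_map_app_def Jmap_def)
    have "on_slit (on_slit A) = on_slit A" by (rule on_slit_eqI) simp
    then show ?thesis by (simp only: barthel_def on_slit_diff on_slit_br J')
  qed
  have half: "(1 / 2) \<odot> (a + a) = a" for a :: "'b \<Rightarrow> 'c \<times> 'c"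
    by (rule ext) (simp add: scaleR_2[symmetric] vscale_def)
  have h: "on_slit (barthel_h M G (beta M C \<star> X)) = pa.be (on_slit X)" if X: "pi_vector_field M X" for X
  proof -
    have X': "on_slit X \<in> PF" using X by (simp add: PF_iff)
    have b: "on_slit (barthel M G (beta M C \<star> X)) = pa.be (on_slit X)"
      unfolding barthel_cong[of "beta M C \<star> X"] on_slit_beta_C_be[OF X]
      using X' by (simp add: on_slit_barthel)
    show ?thesis
    proof (rule on_slit_eq)
      fix w assume w: "w \<in> points (slit M)"
      have "barthel M G (beta M C \<star> X) w = pa.be (on_slit X) w" "(beta M C \<star> X) w = pa.be (on_slit X) w"
        using fun_cong[OF b, of w] fun_cong[OF on_slit_beta_C_be[OF X], of w] w by simp_all
      then show "barthel_h M G (beta M C \<star> X) w = pa.be (on_slit X) w" unfolding barthel_h_def by (simp only: half)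
    qed (rule VFD(3)[OF pa.be_closed[OF X']])
  qed
  define N where "N = br (barthel_h M G (beta M C \<star> X)) (barthel_h M G (beta M C \<star> Y))"
  define N' where "N' = br A B"
  have N': "N' \<in> VF" using AB_VF by (simp add: N'_def)
  have NN: "on_slit N = N'" by (simp only: N_def N'_def on_slit_br h X Y AB)
  have BN: "on_slit (barthel M G N) = pa.be (rh N') + pa.be (rh N') - N'"
    unfolding barthel_cong[of N] NN by (rule on_slit_barthel[OF N'])
  have "barthel M G N u = pa.be (rh N') u + pa.be (rh N') u - N' u"
    using fun_cong[OF BN, of u] unfolding on_slit(1)[OF u] by simp
  moreover have "N u = N' u" using fun_cong[OF NN, of u] u by simp
  ultimately have "N u - barthel M G N u = (N' u - pa.be (rh N') u) + (N' u - pa.be (rh N') u)" by simp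
  then have v: "barthel_v M G N u = N' u - pa.be (rh N') u" unfolding barthel_v_def by (simp only: half)
  have b: "pa.be (rh N') \<in> VF" using N' by simp
  note t = VFD(2)[OF N' u] VFD(2)[OF b u]
  have "barthel_curvature M G (beta M C \<star> X) (beta M C \<star> Y) u = pa.be (rh N') u - N' u"
    using v by (simp add: barthel_curvature_def N_def)
  then have "(Kmap C \<star> barthel_curvature M G (beta M C \<star> X) (beta M C \<star> Y)) u = Kmap C u (pa.be (rh N') u) - Kmap C u (N' u)"
    unfolding bundle_map_app_def by (simp add: Kmap_diff[OF C_linear u t(2,1)])
  also have "Kmap C u (pa.be (rh N') u) = 0"
    using con_eta[OF C_linear u b] pa.K_eq[OF b] N' by simp
  also have "Kmap C u (N' u) = con D N' (on_slit eta) u"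
    using con_eta[OF C_linear u N'] pa.K_eq[OF N'] by simp
  also have "con D N' (on_slit eta) = on_slit (contract_eta (h_curvature M C) X Y)"
    unfolding on_slit_cartan_h_curvature[OF X Y] N'_def AB using X' Y' by (simp only: pa.Rh_eq)
  finally show ?thesis by (simp only: on_slit(1)[OF u] diff_0)
qed

end


theorem theorem5p7:
  fixes M :: "('a, 'i, 'e::euclidean_space) atlas"
    and L :: "('a, 'i, 'e) tvec \<Rightarrow> real"
    and G :: "('a, 'i, 'e) vfield"
    and C D :: "('a, 'i, 'e) connection"
    and X Y Z W :: "('a, 'i, 'e) pifield"
    and u :: "('a, 'i, 'e) tvec"
  assumes "finsler_manifold M L"
    and "canonical_spray M L G"
    and "cartan_connection M L C"
    and "chern_connection M L C D"
    and "pi_vector_field M X" and "pi_vector_field M Y"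
    and "pi_vector_field M Z" and "pi_vector_field M W"
    and "u \<in> points (slit M)"
  shows
    "(finsler_metric L u (h_curvature M D X Y Z u) (W u)
       = - finsler_metric L u (h_curvature M D Y X Z u) (W u)) \<and>
     (contract_eta (h_curvature M D) X Y u = contract_eta (h_curvature M C) X Y u) \<and>
     (contract_eta (h_curvature M C) X Y u
       = - (Kmap C \<star> barthel_curvature M G (beta M C \<star> X) (beta M C \<star> Y)) u) \<and>
     (finsler_metric L u (h_curvature M D X Y Z u) (W u)
       = - finsler_metric L u (h_curvature M D X Y W u) (Z u)
         - 2 * finsler_metric L u (hv_torsion M C (contract_eta (h_curvature M C) X Y) Z u) (W u)) \<and>
     (cyclic_sum (h_curvature M D) X Y Z u = 0) \<and>
     (cyclic_sum (\<lambda>X Y Z.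
         cov_tensor D (beta M C \<star> X) (h_curvature M D) Y Z W
         + hv_curvature M D X (contract_eta (h_curvature M C) Y Z) W) X Y Z u = 0) \<and>
     ((cov_tensor D (gam M \<star> X) (h_curvature M D) Y Z W
      + cov_tensor D (beta M C \<star> Y) (hv_curvature M D) Z X W
      - cov_tensor D (beta M C \<star> Z) (hv_curvature M D) Y X W
      - hv_curvature M D Z (contract_eta (hv_curvature M C) Y X) W
      + hv_curvature M D Y (contract_eta (hv_curvature M C) Z X) W) u = 0) \<and>
     (cov_tensor D (gam M \<star> eta) (h_curvature M D) X Y Z u = 0)"
proof -
  interpret finsler_chern M L G C D
    using assms(1-4)
    unfolding finsler_chern_def finsler_chern_axioms_def finsler_cartan_def finsler_cartan_axioms_def
      finsler_spray_def finsler_spray_axioms_def finsler_def by blast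
  note X = assms(5) and Y = assms(6) and Z = assms(7) and W = assms(8) and u = assms(9)
  have [simp]: "on_slit X \<in> PF" "on_slit Y \<in> PF" "on_slit Z \<in> PF" "on_slit W \<in> PF"
    using X Y Z W by (simp_all add: PF_iff)
  let ?R = "h_curvature M D" and ?P = "hv_curvature M D"
  let ?Rh = "contract_eta (h_curvature M C)" and ?Ph = "contract_eta (hv_curvature M C)"
  \<comment> \<open>Each identity is proved for truncated fields, where it is an equation of the
    algebra, and then evaluated at \<open>u\<close>.\<close>
  have at_u: "F u = 0" if "on_slit F = 0" for F :: "('a, 'i, 'e) pifield"
    using fun_cong[OF that, of u] u by simp
  have met_u: "finsler_metric L u (F u) (V u) = met (on_slit F) (on_slit V) u" for F V
    using u by (simp add: met_apply)
  have Rh_pi: "pi_vector_field M (?Rh X Y)" if "pi_vector_field M X" "pi_vector_field M Y" for X Y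
    using that unfolding PF_iff[symmetric] on_slit_cartan_h_curvature[OF that] by simp
  have Ph_pi: "pi_vector_field M (?Ph X Y)" if "pi_vector_field M X" "pi_vector_field M Y" for X Y
    using that unfolding PF_iff[symmetric] on_slit_cartan_hv_curvature[OF that] by simp
  have a: "finsler_metric L u (?R X Y Z u) (W u) = - finsler_metric L u (?R Y X Z u) (W u)"
  proof -
    have "pa.R (on_slit X) (on_slit Y) (on_slit Z) = - pa.R (on_slit Y) (on_slit X) (on_slit Z)"
      by (rule pa.curv_anti) simp_all
    then show ?thesis unfolding met_u by (simp add: on_slit_h_curvature X Y Z)
  qed
  have b1: "contract_eta ?R X Y u = ?Rh X Y u"
  proof -
    have "on_slit (contract_eta ?R X Y) = pa.Rh (on_slit X) (on_slit Y)"
      unfolding contract_eta_def by (rule on_slit_h_curvature[OF X Y pi_vector_field_eta])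
    also have "\<dots> = on_slit (?Rh X Y)" by (rule on_slit_cartan_h_curvature[OF X Y, symmetric])
    finally have "on_slit (contract_eta ?R X Y) = on_slit (?Rh X Y)" .
    from fun_cong[OF this, of u] show ?thesis using u by simp
  qed
  have b2: "?Rh X Y u = - (Kmap C \<star> barthel_curvature M G (beta M C \<star> X) (beta M C \<star> Y)) u"
    by (simp only: barthel_curvature_eq[OF X Y u] minus_minus)
  have c: "finsler_metric L u (?R X Y Z u) (W u)
      = - finsler_metric L u (?R X Y W u) (Z u) - 2 * finsler_metric L u (hv_torsion M C (?Rh X Y) Z u) (W u)"
    using fun_cong[OF pa.R_metric[of "on_slit X" "on_slit Y" "on_slit Z" "on_slit W"], of u]
    unfolding met_u by (simp add: on_slit_h_curvature on_slit_hv_torsion[OF Rh_pi[OF X Y] Z] on_slit_cartan_h_curvature X Y Z W)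
  have d: "cyclic_sum ?R X Y Z u = 0"
    by (rule at_u, unfold cyclic_sum_def on_slit_add)
      (simp only: on_slit_h_curvature X Y Z pa.R_cyclic \<open>on_slit X \<in> PF\<close> \<open>on_slit Y \<in> PF\<close> \<open>on_slit Z \<in> PF\<close>)
  \<comment> \<open>The lift in the statement is that of the Cartan connection, the one inside the
    curvatures that of \<open>D\<close>; on the slit bundle both become \<open>be\<close>.\<close>
  have e: "cyclic_sum (\<lambda>X Y Z. cov_tensor D (beta M C \<star> X) ?R Y Z W + ?P X (?Rh Y Z) W) X Y Z u = 0"
    by (rule at_u, unfold cyclic_sum_def on_slit_add)
      (simp only: on_slit_cov_h_curvature beta_C_vector_field on_slit_beta_C_be on_slit_hv_curvature
        on_slit_cartan_h_curvature Rh_pi X Y Z W pa.R_bianchi2 \<open>on_slit X \<in> PF\<close> \<open>on_slit Y \<in> PF\<close> \<open>on_slit Z \<in> PF\<close> \<open>on_slit W \<in> PF\<close>)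
  have f: "(cov_tensor D (gam M \<star> X) ?R Y Z W + cov_tensor D (beta M C \<star> Y) ?P Z X W - cov_tensor D (beta M C \<star> Z) ?P Y X W
      - ?P Z (?Ph Y X) W + ?P Y (?Ph Z X) W) u = 0"
  proof -
    have "on_slit (cov_tensor D (gam M \<star> X) ?R Y Z W + cov_tensor D (beta M C \<star> Y) ?P Z X W
        - cov_tensor D (beta M C \<star> Z) ?P Y X W - ?P Z (?Ph Y X) W + ?P Y (?Ph Z X) W) = 0"
      unfolding on_slit_add on_slit_diff
      by (simp only: on_slit_cov_h_curvature on_slit_cov_hv_curvature beta_C_vector_field vector_field_gam on_slit_gam
          on_slit_beta_C_be on_slit_hv_curvature on_slit_cartan_hv_curvature Ph_pi X Y Z W pa.R_bianchi2_mixed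
          \<open>on_slit X \<in> PF\<close> \<open>on_slit Y \<in> PF\<close> \<open>on_slit Z \<in> PF\<close> \<open>on_slit W \<in> PF\<close>)
    from at_u[OF this] show ?thesis .
  qed
  have g: "cov_tensor D (gam M \<star> eta) ?R X Y Z u = 0"
    by (rule at_u) (simp add: on_slit_cov_h_curvature vector_field_gam pi_vector_field_eta on_slit_gam X Y Z pa.R_ga_et)
  show ?thesis using a b1 b2 c d e f g by blast
qed

end
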